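(* Let $\phi: GL_1(\mathscr{R})^{+}\to GL_1(\mathscr{R})^{+}$ be a bijection. Then $$\Delta(\phi(A)+\phi(B))=\Delta(\phi(I))\cdot \Delta(A+B)$$ holds for all $A,B \in GL_1(\mathscr{R})^{+}$ if and only if there is a $\tau$-preserving Jordan $*$-isomorphism $J:\mathscr{R}\to \mathscr{R}$ and a positive invertible element $T\in GL_1(\mathscr{R})^{+}$ such that $$\phi(A)=TJ(A)T \quad \text{for all } A\in GL_1(\mathscr{R})^{+}.$$
   Context: $\mathscr{R}$ is a finite von Neumann algebra acting on a complex (separable) Hilbert space $\mathscr{H}$ and containing the identity operator $I$. $\tau$ is a fixed faithful tracial state on $\mathscr{R}$: a linear functional $\tau:\mathscr{R}\to\mathbb{C}$ such that $\tau(AB)=\tau(BA)$ for all $A,B \in \mathscr{R}$, $\tau(A^*A)\ge 0$ with equality if and only if $A=0$, and $\tau(I)=1$. $GL_1(\mathscr{R})^{+}$ denotes the set of invertible positive operators in $\mathscr{R}$. $\Delta$ is the Fuglede-Kadison determinant associated with $\tau$: for invertible $A\in\mathscr{R}$, $\Delta(A)=\exp(\tau(\log\sqrt{A^*A}))$. A linear map $J:\mathscr{R}\to\mathscr{R}$ is a Jordan homomorphism if $J(A^2)=J(A)^2$ for all $A\in\mathscr{R}$; it is a Jordan $*$-homomorphism if moreover $J(A^* )=J(A)^*$ for all $A\in\mathscr{R}$; it is a Jordan $*$-isomorphism if it is a bijective Jordan $*$-homomorphism. $J$ is $\tau$-preserving if $\tau(J(A))=\tau(A)$ for all $A\in\mathscr{R}$.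 *)

theory Defs
  imports "HOL-Analysis.Analysis" "HOL-Computational_Algebra.Polynomial"
begin

section \<open>Complex Hilbert spaces\<close>

text \<open>
  A complex Hilbert space is rendered as a complete real inner product space carrying a complex
  scalar multiplication and a sesquilinear form (linear in the first argument) whose real part is
  the real inner product; in particular the norm of \<open>x\<close> is the square root of \<open>cinner x x\<close>.
\<close>

class complex_hilbert_space = real_inner + complete_space +
  fixes scaleC :: "complex \<Rightarrow> 'a \<Rightarrow> 'a" (infixr "*\<^sub>C" 75)
    and cinner :: "'a \<Rightarrow> 'a \<Rightarrow> complex"
  assumes scaleC_add_right: "c *\<^sub>C (x + y) = c *\<^sub>C x + c *\<^sub>C y"
    and scaleC_add_left: "(c + d) *\<^sub>C x = c *\<^sub>C x + d *\<^sub>C x"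
    and scaleC_scaleC: "c *\<^sub>C (d *\<^sub>C x) = (c * d) *\<^sub>C x"
    and scaleR_scaleC: "r *\<^sub>R x = complex_of_real r *\<^sub>C x"
    and cinner_commute: "cinner x y = cnj (cinner y x)"
    and cinner_add_left: "cinner (x + y) z = cinner x z + cinner y z"
    and cinner_scaleC_left: "cinner (c *\<^sub>C x) y = c * cinner x y"
    and Re_cinner: "Re (cinner x y) = inner x y"
begin

subclass banach ..

end

lemma norm_scaleC: "norm (c *\<^sub>C x) = cmod c * norm (x :: 'h::complex_hilbert_space)"
proof -
  have self: "Im (cinner x x) = 0"
    using cinner_commute[of x x] by (metis complex_cnj_cancel_iff Reals_cnj_iff complex_is_Real_iff)
  have "cinner (c *\<^sub>C x) (c *\<^sub>C x) = c * cnj (c * cinner x x)"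
    by (metis cinner_commute cinner_scaleC_left)
  also have "\<dots> = complex_of_real ((cmod c)\<^sup>2) * cnj (cinner x x)"
    by (simp only: complex_cnj_mult mult.assoc[symmetric] complex_norm_square)
  finally have "inner (c *\<^sub>C x) (c *\<^sub>C x) = (cmod c)\<^sup>2 * inner x x"
    by (simp add: Re_cinner[symmetric] self)
  then show ?thesis
    by (simp add: norm_eq_sqrt_inner real_sqrt_mult)
qed

lemma bounded_linear_scaleC: "bounded_linear (\<lambda>x::'h::complex_hilbert_space. c *\<^sub>C x)"
  by (rule bounded_linear_intro[where K = "cmod c"])
    (simp_all add: scaleC_add_right scaleR_scaleC scaleC_scaleC norm_scaleC mult.commute)

section \<open>Bounded operators\<close>

text \<open>
  The library type \<open>'h \<Rightarrow>\<^sub>L 'h\<close> consists of the bounded real-linear operators; the algebra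
  \<open>B(H)\<close> is the subset \<open>clinear_ops\<close> of the complex-linear ones.
\<close>

type_synonym 'h op = "'h \<Rightarrow>\<^sub>L 'h"

definition clinear_ops :: "'h::complex_hilbert_space op set" where
  "clinear_ops = {A. \<forall>c x. blinfun_apply A (c *\<^sub>C x) = c *\<^sub>C blinfun_apply A x}"

definition cscale :: "complex \<Rightarrow> 'h op \<Rightarrow> 'h::complex_hilbert_space op" (infixr "\<cdot>\<^sub>C" 75) where
  "c \<cdot>\<^sub>C A = Blinfun (\<lambda>x. c *\<^sub>C blinfun_apply A x)"

lemma cscale_apply [simp]: "blinfun_apply (c \<cdot>\<^sub>C A) x = c *\<^sub>C blinfun_apply A x"
proof -
  have "bounded_linear (\<lambda>x. c *\<^sub>C blinfun_apply A x)"
    by (rule bounded_linear_compose[OF bounded_linear_scaleC blinfun.bounded_linear_right])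
  then show ?thesis
    by (simp add: cscale_def bounded_linear_Blinfun_apply)
qed

definition adj :: "'h op \<Rightarrow> 'h::complex_hilbert_space op" where
  "adj A = (THE B. \<forall>x y. cinner (blinfun_apply A x) y = cinner x (blinfun_apply B y))"

definition positive_op :: "'h::complex_hilbert_space op \<Rightarrow> bool" where
  "positive_op A \<longleftrightarrow> A \<in> clinear_ops \<and> (\<forall>x. cinner (blinfun_apply A x) x \<in> \<real>\<^sub>\<ge>\<^sub>0)"

definition projection_op :: "'h::complex_hilbert_space op \<Rightarrow> bool" where
  "projection_op E \<longleftrightarrow> E \<in> clinear_ops \<and> E o\<^sub>L E = E \<and> adj E = E"

definition invertible_in :: "'h::complex_hilbert_space op set \<Rightarrow> 'h op \<Rightarrow> bool" where
  "invertible_in S A \<longleftrightarrow> (\<exists>B\<in>S. A o\<^sub>L B = id_blinfun \<and> B o\<^sub>L A = id_blinfun)"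

definition op_spectrum :: "'h::complex_hilbert_space op \<Rightarrow> complex set" where
  "op_spectrum A = {z. \<not> invertible_in clinear_ops (A - z \<cdot>\<^sub>C id_blinfun)}"

section \<open>Continuous functional calculus\<close>

definition poly_op :: "real poly \<Rightarrow> 'h op \<Rightarrow> 'h::complex_hilbert_space op" where
  "poly_op p A = (\<Sum>i\<le>degree p. coeff p i *\<^sub>R (((o\<^sub>L) A ^^ i) id_blinfun))"

text \<open>
  For self-adjoint \<open>A\<close> (whose spectrum is real) and \<open>f\<close> continuous on the spectrum, \<open>f(A)\<close> is the
  norm limit of \<open>p\<^sub>n(A)\<close> for polynomials \<open>p\<^sub>n\<close> converging to \<open>f\<close> uniformly on the spectrum.
\<close>

definition cfc :: "(real \<Rightarrow> real) \<Rightarrow> 'h op \<Rightarrow> 'h::complex_hilbert_space op" where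
  "cfc f A = (THE B. \<exists>p :: nat \<Rightarrow> real poly.
      uniform_limit {x. complex_of_real x \<in> op_spectrum A} (\<lambda>n x. poly (p n) x) f sequentially \<and>
      (\<lambda>n. poly_op (p n) A) \<longlonglongrightarrow> B)"

section \<open>Finite von Neumann algebras\<close>

definition von_neumann_algebra :: "'h::complex_hilbert_space op set \<Rightarrow> bool" where
  "von_neumann_algebra R \<longleftrightarrow>
     R \<subseteq> clinear_ops \<and> id_blinfun \<in> R \<and>
     (\<forall>A\<in>R. \<forall>B\<in>R. A + B \<in> R \<and> A o\<^sub>L B \<in> R) \<and>
     (\<forall>c. \<forall>A\<in>R. c \<cdot>\<^sub>C A \<in> R) \<and>
     (\<forall>A\<in>R. adj A \<in> R) \<and>
     closedin strong_operator_topology R"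

text \<open>Murray-von Neumann equivalence of projections relative to \<open>R\<close>.\<close>

definition mvn_equiv :: "'h::complex_hilbert_space op set \<Rightarrow> 'h op \<Rightarrow> 'h op \<Rightarrow> bool" where
  "mvn_equiv R E F \<longleftrightarrow> (\<exists>V\<in>R. adj V o\<^sub>L V = E \<and> V o\<^sub>L adj V = F)"

definition finite_projection :: "'h::complex_hilbert_space op set \<Rightarrow> 'h op \<Rightarrow> bool" where
  "finite_projection R E \<longleftrightarrow> E \<in> R \<and> projection_op E \<and>
     (\<forall>F\<in>R. projection_op F \<and> positive_op (E - F) \<and> mvn_equiv R E F \<longrightarrow> F = E)"

definition finite_von_neumann_algebra :: "'h::complex_hilbert_space op set \<Rightarrow> bool" where
  "finite_von_neumann_algebra R \<longleftrightarrow> von_neumann_algebra R \<and> finite_projection R id_blinfun"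

text \<open>
  Maps on the algebra are total functions on the operator type; only their restriction to \<open>R\<close>
  (respectively to \<open>GL_pos R\<close>) is ever constrained or used.
\<close>

definition faithful_tracial_state ::
    "'h::complex_hilbert_space op set \<Rightarrow> ('h op \<Rightarrow> complex) \<Rightarrow> bool" where
  "faithful_tracial_state R \<tau> \<longleftrightarrow>
     (\<forall>A\<in>R. \<forall>B\<in>R. \<tau> (A + B) = \<tau> A + \<tau> B) \<and>
     (\<forall>c. \<forall>A\<in>R. \<tau> (c \<cdot>\<^sub>C A) = c * \<tau> A) \<and>
     (\<forall>A\<in>R. \<forall>B\<in>R. \<tau> (A o\<^sub>L B) = \<tau> (B o\<^sub>L A)) \<and>
     (\<forall>A\<in>R. \<tau> (adj A o\<^sub>L A) \<in> \<real>\<^sub>\<ge>\<^sub>0 \<and> (\<tau> (adj A o\<^sub>L A) = 0 \<longleftrightarrow> A = 0)) \<and>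
     \<tau> id_blinfun = 1"

definition GL_pos :: "'h::complex_hilbert_space op set \<Rightarrow> 'h op set" where
  "GL_pos R = {A \<in> R. positive_op A \<and> invertible_in R A}"

text \<open>The Fuglede-Kadison determinant, meaningful for invertible \<open>A \<in> R\<close>.\<close>

definition fk_det :: "('h op \<Rightarrow> complex) \<Rightarrow> 'h::complex_hilbert_space op \<Rightarrow> complex" where
  "fk_det \<tau> A = exp (\<tau> (cfc ln (cfc sqrt (adj A o\<^sub>L A))))"

definition jordan_hom ::
    "'h::complex_hilbert_space op set \<Rightarrow> ('h op \<Rightarrow> 'h op) \<Rightarrow> bool" where
  "jordan_hom R J \<longleftrightarrow>
     (\<forall>A\<in>R. J A \<in> R) \<and>
     (\<forall>A\<in>R. \<forall>B\<in>R. J (A + B) = J A + J B) \<and>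
     (\<forall>c. \<forall>A\<in>R. J (c \<cdot>\<^sub>C A) = c \<cdot>\<^sub>C J A) \<and>
     (\<forall>A\<in>R. J (A o\<^sub>L A) = J A o\<^sub>L J A)"

definition jordan_star_iso ::
    "'h::complex_hilbert_space op set \<Rightarrow> ('h op \<Rightarrow> 'h op) \<Rightarrow> bool" where
  "jordan_star_iso R J \<longleftrightarrow> jordan_hom R J \<and> (\<forall>A\<in>R. J (adj A) = adj (J A)) \<and> bij_betw J R R"

definition trace_preserving ::
    "'h::complex_hilbert_space op set \<Rightarrow> ('h op \<Rightarrow> complex) \<Rightarrow> ('h op \<Rightarrow> 'h op) \<Rightarrow> bool" where
  "trace_preserving R \<tau> J \<longleftrightarrow> (\<forall>A\<in>R. \<tau> (J A) = \<tau> A)"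

end

theory Submission
  imports Defs "HOL-Computational_Algebra.Fundamental_Theorem_Algebra"
begin

text \<open>
  Let \<open>d = \<Delta>(\<phi>(I))\<close>. The argument takes place in a norm-closed \<open>*\<close>-algebra with a faithful
  tracial state (locale \<open>tracial_algebra\<close>), and everything is expressed through
  \<open>lndet A = ln \<Delta>(A) = \<tau>(ln A)\<close> on positive invertible elements.

  Three facts about \<open>lndet\<close> carry the proof. Its first variation is \<open>\<tau>(A\<^sup>-\<^sup>1 B)\<close>
  (\<open>lndet_variation\<close>): the logarithm is a power series in \<open>1 - A/b\<close>, and under the trace the
  derivative of a power is the scalar one. Integrating along a path gives
  \<open>\<Delta>(TXT) = \<Delta>(T)\<^sup>2 \<Delta>(X)\<close> (\<open>lndet_sandwich\<close>). Finally, equality in Minkowski's inequality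
  \<open>\<Delta>(X + Y) \<ge> \<Delta>(X) + \<Delta>(Y)\<close> forces \<open>X\<close> and \<open>Y\<close> to be proportional (\<open>minkowski_equality\<close>).

  Suppose \<open>\<Delta>(\<phi>(A) + \<phi>(B)) = d \<Delta>(A + B)\<close>. Taking \<open>B = A\<close> gives \<open>\<Delta>(\<phi>(A)) = d \<Delta>(A)\<close>; taking
  \<open>B = tA\<close> gives equality in Minkowski's inequality, so \<open>\<phi>(tA) = t \<phi>(A)\<close>. Differentiating
  \<open>\<Delta>(\<phi>(A) + t \<phi>(B)) = d \<Delta>(A + tB)\<close> at \<open>t = 0\<close> yields \<open>\<tau>(\<phi>(A)\<^sup>-\<^sup>1 \<phi>(B)) = \<tau>(A\<^sup>-\<^sup>1 B)\<close>. As
  \<open>\<phi>(A)\<^sup>-\<^sup>1\<close> runs through all positive invertible elements and the trace is faithful, \<open>\<phi>\<close> is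
  additive. After conjugation by \<open>\<phi>(I)\<^sup>-\<^sup>1\<^sup>/\<^sup>2\<close> the map is unital, and expanding
  \<open>\<tau>((1 + s \<psi>(X))\<^sup>-\<^sup>1 \<psi>(Y)) = \<tau>((1 + s X)\<^sup>-\<^sup>1 Y)\<close> to second order in \<open>s\<close> gives
  \<open>\<psi>(X\<^sup>2) = \<psi>(X)\<^sup>2\<close>; its linear extension is the Jordan isomorphism.

  Conversely, a trace-preserving Jordan \<open>*\<close>-isomorphism preserves order bounds and the traces of
  all powers, hence \<open>\<Delta>\<close> by the power series, and the factor \<open>\<Delta>(T)\<^sup>2 = \<Delta>(\<phi>(I))\<close> comes from
  \<open>lndet_sandwich\<close>.
\<close>

section \<open>Symmetric operators and adjoints\<close>

lemma cinner_ii_right: "cinner x (\<i> *\<^sub>C y) = - \<i> * cinner x (y :: 'h::complex_hilbert_space)"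
  by (metis cinner_commute cinner_scaleC_left complex_cnj_i complex_cnj_mult)

text \<open>
  The complex inner product is determined by the real one, so adjoints and positivity can be
  handled with the real inner product alone.
\<close>

lemma cinner_conv_inner:
  "cinner x y = Complex (inner x y) (inner x (\<i> *\<^sub>C (y :: 'h::complex_hilbert_space)))"
proof -
  have "Im (cinner x y) = Re (- \<i> * cinner x y)" by simp
  also have "\<dots> = inner x (\<i> *\<^sub>C y)" by (simp only: cinner_ii_right[symmetric] Re_cinner)
  finally show ?thesis by (simp add: complex_eq_iff Re_cinner)
qed

lemma scaleC_one [simp]: "1 *\<^sub>C x = (x :: 'h::complex_hilbert_space)"
  using scaleR_scaleC[of 1 x] by simp

lemma scaleC_minus_one: "(- 1) *\<^sub>C x = - (x :: 'h::complex_hilbert_space)"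
  using scaleR_scaleC[of "- 1" x] by simp

lemma inner_ii_ii [simp]: "inner (\<i> *\<^sub>C x) (\<i> *\<^sub>C y) = inner x (y :: 'h::complex_hilbert_space)"
proof -
  have "cinner (\<i> *\<^sub>C x) (\<i> *\<^sub>C y) = cinner x y"
    by (simp add: cinner_scaleC_left cinner_ii_right)
  then show ?thesis by (metis Re_cinner)
qed

lemma inner_ii_shift: "inner (\<i> *\<^sub>C x) y = - inner x (\<i> *\<^sub>C (y :: 'h::complex_hilbert_space))"
proof -
  have "inner (\<i> *\<^sub>C x) y = inner (\<i> *\<^sub>C \<i> *\<^sub>C x) (\<i> *\<^sub>C y)" by simp
  also have "\<i> *\<^sub>C \<i> *\<^sub>C x = - x" by (simp add: scaleC_scaleC scaleC_minus_one)
  finally show ?thesis by simp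
qed

lemma clinear_ii:
  "A \<in> clinear_ops \<Longrightarrow> blinfun_apply A (\<i> *\<^sub>C x) = \<i> *\<^sub>C blinfun_apply A (x :: 'h::complex_hilbert_space)"
  by (simp add: clinear_ops_def)

lemma adj_eqI:
  fixes A B :: "'h::complex_hilbert_space op"
  assumes A: "A \<in> clinear_ops" and B: "\<And>x y. inner (A x) y = inner x (B y)"
  shows "adj A = B"
  unfolding adj_def
proof (rule the_equality)
  have "inner (A x) (\<i> *\<^sub>C y) = inner x (\<i> *\<^sub>C B y)" for x y
    using B[of "\<i> *\<^sub>C x" y] by (simp add: clinear_ii[OF A] inner_ii_shift)
  then show "\<forall>x y. cinner (A x) y = cinner x (B y)"
    by (simp add: cinner_conv_inner B)
next
  fix B' assume "\<forall>x y. cinner (A x) y = cinner x (blinfun_apply B' y)"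
  then have "inner x (B' y) = inner x (B y)" for x y
    by (metis B Re_cinner)
  then show "B' = B"
    by (intro blinfun_eqI) (metis vector_eq_ldot)
qed

text \<open>
  Self-adjointness with respect to the real inner product; for complex-linear operators this is
  self-adjointness in the usual sense (\<open>adj_sym\<close>, \<open>positive_op_iff\<close>).
\<close>

definition sym_op :: "'h::real_inner op \<Rightarrow> bool" where
  "sym_op A \<longleftrightarrow> (\<forall>x y. inner (blinfun_apply A x) y = inner x (blinfun_apply A y))"

lemma adj_sym: "A \<in> clinear_ops \<Longrightarrow> sym_op A \<Longrightarrow> adj A = A"
  by (rule adj_eqI) (auto simp: sym_op_def)

text \<open>
  Riesz representation, by minimising the quadratic functional \<open>\<parallel>x\<parallel>\<^sup>2 - 2 f x\<close>: the parallelogram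
  law makes every minimising sequence Cauchy.
\<close>

lemma riesz_representation:
  fixes f :: "'h::{real_inner,complete_space} \<Rightarrow> real"
  assumes f: "bounded_linear f"
  obtains z where "\<And>x. f x = inner z x"
proof -
  interpret f: bounded_linear f by fact
  define Q where "Q x = inner x x - 2 * f x" for x
  obtain K where K: "\<And>x. norm (f x) \<le> norm x * K" using f.bounded by blast
  have lb: "- K\<^sup>2 \<le> Q x" for x
  proof -
    have "0 \<le> (norm x - K)\<^sup>2" by simp
    moreover have "f x \<le> norm x * K" using K[of x] by simp
    ultimately show ?thesis by (simp add: Q_def power2_norm_eq_inner[symmetric] power2_diff)
  qed
  then have bdd: "bdd_below (range Q)" by (meson bdd_belowI2)
  define m where "m = Inf (range Q)"
  have m: "m \<le> Q x" for x unfolding m_def by (rule cInf_lower[OF _ bdd]) auto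
  have "\<exists>x. Q x < m + inverse (real (Suc n))" for n
    using cInf_lessD[of "range Q" "m + inverse (real (Suc n))"] by (auto simp: m_def)
  then obtain s where s: "\<And>n. Q (s n) < m + inverse (real (Suc n))" by metis
  have para: "inner (x - y) (x - y) = 2 * Q x + 2 * Q y - 4 * Q ((1/2) *\<^sub>R (x + y))" for x y
    by (simp add: Q_def f.scaleR f.add f.diff inner_add inner_diff inner_commute algebra_simps)
  have "Cauchy s"
  proof (rule metric_CauchyI)
    fix e :: real assume e: "e > 0"
    then obtain N where N: "inverse (real (Suc N)) < e\<^sup>2 / 4"
      using reals_Archimedean[of "e\<^sup>2 / 4"] by auto
    have "dist (s i) (s j) < e" if "i \<ge> N" "j \<ge> N" for i j
    proof -
      have "Q (s k) < m + e\<^sup>2 / 4" if "k \<ge> N" for k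
      proof -
        have "inverse (real (Suc k)) \<le> inverse (real (Suc N))"
          using that by (intro le_imp_inverse_le) auto
        then show ?thesis using s[of k] N by linarith
      qed
      from this[OF that(1)] this[OF that(2)] m[of "(1/2) *\<^sub>R (s i + s j)"]
      have "(norm (s i - s j))\<^sup>2 < e\<^sup>2" unfolding power2_norm_eq_inner para by linarith
      then show ?thesis using e by (simp add: dist_norm power2_less_imp_less)
    qed
    then show "\<exists>M. \<forall>i\<ge>M. \<forall>j\<ge>M. dist (s i) (s j) < e" by blast
  qed
  then obtain z where z: "s \<longlonglongrightarrow> z" using Cauchy_convergent convergent_def by blast
  have "(\<lambda>n. Q (s n)) \<longlonglongrightarrow> Q z" unfolding Q_def
    by (intro tendsto_intros z f.tendsto)
  moreover have "(\<lambda>n. m + inverse (real (Suc n))) \<longlonglongrightarrow> m + 0"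
    by (intro tendsto_intros LIMSEQ_inverse_real_of_nat)
  ultimately have "Q z \<le> m + 0" using s by (intro LIMSEQ_le) (auto intro!: exI[of _ 0] less_imp_le)
  then have min: "Q z \<le> Q x" for x using m[of x] by linarith
  have "f x = inner z x" for x
  proof (rule ccontr)
    define c where "c = inner z x - f x"
    assume "f x \<noteq> inner z x"
    then have c: "c \<noteq> 0" by (simp add: c_def)
    then have x: "inner x x > 0" by (auto simp: c_def f.zero)
    have "Q (z + t *\<^sub>R x) = Q z + 2 * t * c + t\<^sup>2 * inner x x" for t
      by (simp add: Q_def c_def f.add f.scaleR inner_add inner_commute algebra_simps power2_eq_square)
    from this[of "- c / inner x x"] min[of "z + (- c / inner x x) *\<^sub>R x"]
    have "2 * (- c / inner x x) * c + (- c / inner x x)\<^sup>2 * inner x x \<ge> 0" by linarith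
    then have "- (c\<^sup>2 / inner x x) \<ge> 0"
      using x by (simp add: field_simps power2_eq_square)
    then show False using c x by (simp add: divide_le_0_iff)
  qed
  then show ?thesis using that by blast
qed

lemma adj_inner:
  fixes A :: "'h::complex_hilbert_space op"
  assumes A: "A \<in> clinear_ops"
  shows "inner (A x) y = inner x (adj A y)"
proof -
  have "\<exists>z. \<forall>x. inner (A x) y = inner z x" for y
  proof -
    have "bounded_linear (\<lambda>x. inner (A x) y)"
      by (rule bounded_linear_compose[OF bounded_linear_inner_left blinfun.bounded_linear_right])
    then show ?thesis by (rule riesz_representation) blast
  qed
  then obtain B where B: "\<And>x y. inner (A x) y = inner (B y) x" by metis
  have eq: "u = v" if "\<And>x. inner u x = inner v x" for u v :: 'h
    using that by (metis vector_eq_rdot)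
  have "norm (B y) \<le> norm y * norm A" for y
  proof -
    have "norm (B y) * norm (B y) = inner (A (B y)) y"
      by (simp add: B norm_eq_sqrt_inner)
    also have "\<dots> \<le> norm (A (B y)) * norm y" by (rule norm_cauchy_schwarz)
    also have "\<dots> \<le> norm A * norm (B y) * norm y" by (intro mult_right_mono norm_blinfun) simp
    finally have "norm (B y) * norm (B y) \<le> norm (B y) * (norm y * norm A)" by (simp add: ac_simps)
    then show ?thesis by (cases "norm (B y) = 0") (auto simp: mult_le_cancel_left)
  qed
  then have "bounded_linear B"
  proof (rule bounded_linear_intro[rotated 2])
    show "B (x + y) = B x + B y" for x y
      by (rule eq) (simp add: B[symmetric] inner_add_left inner_add_right)
    show "B (r *\<^sub>R x) = r *\<^sub>R B x" for r x
      by (rule eq) (simp add: B[symmetric])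
  qed
  then have app: "blinfun_apply (Blinfun B) = B" by (rule bounded_linear_Blinfun_apply)
  have B': "inner (A x) y = inner x (B y)" for x y using B[of x y] by (metis inner_commute)
  then have "adj A = Blinfun B" by (intro adj_eqI[OF A]) (simp add: app)
  then show ?thesis by (simp add: app B')
qed

lemma positive_op_iff:
  fixes A :: "'h::complex_hilbert_space op"
  shows "positive_op A \<longleftrightarrow> A \<in> clinear_ops \<and> sym_op A \<and> (\<forall>x. 0 \<le> inner (A x) x)"
proof
  assume pos: "positive_op A"
  then have A: "A \<in> clinear_ops" and nn: "cinner (A x) x \<in> \<real>\<^sub>\<ge>\<^sub>0" for x
    by (auto simp: positive_op_def)
  have im: "inner (A x) (\<i> *\<^sub>C x) = 0" for x
    using nn[of x] by (simp add: complex_nonneg_Reals_iff cinner_conv_inner)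
  have ii: "inner (A x) (\<i> *\<^sub>C y) = inner x (A (\<i> *\<^sub>C y))" for x y
  proof -
    have "inner (A x) (\<i> *\<^sub>C y) + inner (A y) (\<i> *\<^sub>C x) = 0"
      using im[of "x + y"] im[of x] im[of y]
      by (simp add: blinfun.add_right scaleC_add_right inner_add)
    moreover have "inner (A y) (\<i> *\<^sub>C x) = - inner x (A (\<i> *\<^sub>C y))"
      using inner_ii_shift[of "A y" x] by (simp add: clinear_ii[OF A] inner_commute)
    ultimately show ?thesis by simp
  qed
  have "sym_op A" unfolding sym_op_def
  proof (intro allI)
    fix x y :: 'h
    \<comment> \<open>\<open>\<i>y\<close> runs through all vectors\<close>
    have "\<i> *\<^sub>C (- \<i>) *\<^sub>C y = y" by (simp add: scaleC_scaleC)
    then show "inner (A x) y = inner x (A y)" using ii[of x "(- \<i>) *\<^sub>C y"] by simp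
  qed
  then show "A \<in> clinear_ops \<and> sym_op A \<and> (\<forall>x. 0 \<le> inner (A x) x)"
    using A nn by (auto simp: complex_nonneg_Reals_iff cinner_conv_inner)
next
  assume A: "A \<in> clinear_ops \<and> sym_op A \<and> (\<forall>x. 0 \<le> inner (A x) x)"
  have "inner (A x) (\<i> *\<^sub>C x) = 0" for x
  proof -
    have "inner (A x) (\<i> *\<^sub>C x) = - inner (A (\<i> *\<^sub>C x)) x"
      using A by (simp add: clinear_ii inner_ii_shift)
    also have "\<dots> = - inner (A x) (\<i> *\<^sub>C x)"
      using A by (metis sym_op_def inner_commute)
    finally show ?thesis by simp
  qed
  then show "positive_op A"
    using A by (simp add: positive_op_def complex_nonneg_Reals_iff cinner_conv_inner)
qed

section \<open>Polynomials of an operator\<close>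

lemma comp_simps:
  fixes A B C :: "'h::real_normed_vector op"
  shows "((A + B) o\<^sub>L C) = (A o\<^sub>L C) + (B o\<^sub>L C)" "(A o\<^sub>L (B + C)) = (A o\<^sub>L B) + (A o\<^sub>L C)"
    "((A - B) o\<^sub>L C) = (A o\<^sub>L C) - (B o\<^sub>L C)" "(A o\<^sub>L (B - C)) = (A o\<^sub>L B) - (A o\<^sub>L C)"
    "(r *\<^sub>R A o\<^sub>L C) = r *\<^sub>R (A o\<^sub>L C)" "(A o\<^sub>L r *\<^sub>R C) = r *\<^sub>R (A o\<^sub>L C)"
    "(- A o\<^sub>L C) = - (A o\<^sub>L C)" "(A o\<^sub>L - C) = - (A o\<^sub>L C)"
    "((A o\<^sub>L B) o\<^sub>L C) = (A o\<^sub>L (B o\<^sub>L C))" "(A o\<^sub>L id_blinfun) = A" "(id_blinfun o\<^sub>L A) = A"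
    "(0 o\<^sub>L A) = 0" "(A o\<^sub>L 0) = 0"
  by (auto intro!: blinfun_eqI simp: blinfun.add_left blinfun.add_right blinfun.diff_left
      blinfun.diff_right blinfun.scaleR_left blinfun.scaleR_right blinfun.minus_left blinfun.minus_right)

lemma poly_op_altdef:
  "degree p \<le> n \<Longrightarrow> poly_op p A = (\<Sum>i\<le>n. coeff p i *\<^sub>R (((o\<^sub>L) A ^^ i) id_blinfun))"
  unfolding poly_op_def by (intro sum.mono_neutral_left) (auto simp: coeff_eq_0)

lemma poly_op_0 [simp]: "poly_op 0 A = 0"
  by (simp add: poly_op_def)

lemma poly_op_pCons:
  "poly_op (pCons c p) A = c *\<^sub>R id_blinfun + (A o\<^sub>L poly_op p (A :: 'h::complex_hilbert_space op))"
proof -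
  have "poly_op (pCons c p) A
      = (\<Sum>i\<le>Suc (degree p). coeff (pCons c p) i *\<^sub>R (((o\<^sub>L) A ^^ i) id_blinfun))"
    by (rule poly_op_altdef) (simp add: degree_pCons_le)
  also have "\<dots> = c *\<^sub>R id_blinfun + (\<Sum>i\<le>degree p. coeff p i *\<^sub>R (A o\<^sub>L ((o\<^sub>L) A ^^ i) id_blinfun))"
    by (subst sum.atMost_Suc_shift) simp
  also have "(\<Sum>i\<le>degree p. coeff p i *\<^sub>R (A o\<^sub>L ((o\<^sub>L) A ^^ i) id_blinfun)) = A o\<^sub>L poly_op p A"
    unfolding poly_op_def by (rule blinfun_eqI) (simp add: blinfun.sum_right blinfun.sum_left blinfun.scaleR_left blinfun.scaleR_right)
  finally show ?thesis .
qed

lemma poly_op_const [simp]: "poly_op [:c:] A = c *\<^sub>R id_blinfun"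
  by (simp add: poly_op_pCons[of c 0])

lemma poly_op_1 [simp]: "poly_op 1 A = id_blinfun"
  using poly_op_const[of 1 A] by (simp add: one_pCons)

lemma poly_op_linear: "poly_op [:c, d:] A = c *\<^sub>R id_blinfun + d *\<^sub>R A"
  using poly_op_pCons[of c "[:d:]" A] by (simp add: comp_simps)

lemma poly_op_add: "poly_op (p + q) A = poly_op p A + poly_op q A"
proof (induction p arbitrary: q)
  case 0 then show ?case by simp
next
  case (pCons a p)
  show ?case
  proof (cases q)
    case (pCons b r)
    then show ?thesis using pCons.IH[of r] by (simp add: poly_op_pCons comp_simps algebra_simps)
  qed
qed

lemma poly_op_smult: "poly_op (smult c p) A = c *\<^sub>R poly_op p A"
  by (induction p) (auto simp: poly_op_pCons comp_simps algebra_simps)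

lemma poly_op_diff: "poly_op (p - q) A = poly_op p A - poly_op q A"
  using poly_op_add[of p "smult (- 1) q" A] poly_op_smult[of "- 1" q A] by simp

lemma poly_op_mult: "poly_op (p * q) A = poly_op p A o\<^sub>L poly_op q A"
  by (induction p) (auto simp: poly_op_pCons poly_op_add poly_op_smult comp_simps)

lemma poly_op_commute: "poly_op p A o\<^sub>L poly_op q A = poly_op q A o\<^sub>L poly_op p A"
  by (simp add: poly_op_mult[symmetric] mult.commute)

lemma poly_op_pcompose: "poly_op (pcompose p q) A = poly_op p (poly_op q A)"
  by (induction p) (auto simp: poly_op_pCons pcompose_pCons poly_op_add poly_op_mult)

lemma poly_op_sum: "poly_op (\<Sum>i\<in>I. p i) A = (\<Sum>i\<in>I. poly_op (p i) A)"
  by (induction I rule: infinite_finite_induct) (auto simp: poly_op_add)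

section \<open>Operator bounds and the spectrum\<close>

lemma sym_op_id [simp]: "sym_op id_blinfun"
  and sym_op_add: "sym_op A \<Longrightarrow> sym_op B \<Longrightarrow> sym_op (A + B)"
  and sym_op_diff: "sym_op A \<Longrightarrow> sym_op B \<Longrightarrow> sym_op (A - B)"
  and sym_op_scaleR: "sym_op A \<Longrightarrow> sym_op (r *\<^sub>R A)"
  and sym_op_sandwich: "sym_op A \<Longrightarrow> sym_op B \<Longrightarrow> sym_op (A o\<^sub>L (B o\<^sub>L A))"
  and sym_op_commuting: "sym_op A \<Longrightarrow> sym_op B \<Longrightarrow> (A o\<^sub>L B) = (B o\<^sub>L A) \<Longrightarrow> sym_op (A o\<^sub>L B)"
  by (simp_all add: sym_op_def blinfun.add_left blinfun.diff_left blinfun.scaleR_left inner_add inner_diff)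
    (metis blinfun_apply_blinfun_compose)

lemma sym_op_poly: "sym_op A \<Longrightarrow> sym_op (poly_op p A)"
proof (induction p)
  case 0 then show ?case by (simp add: sym_op_def)
next
  case (pCons c p)
  have "(A o\<^sub>L poly_op p A) = (poly_op p A o\<^sub>L A)"
    using poly_op_commute[of "[:0, 1:]" A p] by (simp add: poly_op_linear)
  then show ?case using pCons
    by (simp add: poly_op_pCons sym_op_add sym_op_scaleR sym_op_commuting)
qed

lemma sym_op_tendsto:
  fixes F :: "nat \<Rightarrow> 'h::real_inner op"
  assumes "F \<longlonglongrightarrow> A" "\<And>n. sym_op (F n)"
  shows "sym_op A"
  unfolding sym_op_def
proof (intro allI)
  fix x y
  have "(\<lambda>n. inner (F n x) y) \<longlonglongrightarrow> inner (A x) y"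
    by (intro tendsto_intros blinfun.tendsto assms)
  moreover have "(\<lambda>n. inner (F n x) y) \<longlonglongrightarrow> inner x (A y)"
    using assms(2) by (simp add: sym_op_def) (intro tendsto_intros blinfun.tendsto assms)
  ultimately show "inner (A x) y = inner x (A y)" by (rule LIMSEQ_unique)
qed

text \<open>The numerical range of a symmetric operator lies in \<open>[a, b]\<close>, i.e. \<open>a \<le> A \<le> b\<close>.\<close>

definition sa_between :: "real \<Rightarrow> real \<Rightarrow> 'h::real_inner op \<Rightarrow> bool" where
  "sa_between a b A \<longleftrightarrow> sym_op A \<and>
     (\<forall>x. a * inner x x \<le> inner (blinfun_apply A x) x \<and> inner (blinfun_apply A x) x \<le> b * inner x x)"

text \<open>
  The norm of a symmetric operator is its numerical radius (polarisation).
\<close>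

lemma norm_sym_op_le:
  fixes A :: "'h::real_inner op"
  assumes A: "sym_op A" and k: "0 \<le> k" and bound: "\<And>x. \<bar>inner (A x) x\<bar> \<le> k * inner x x"
  shows "norm A \<le> k"
proof (rule norm_blinfun_bound[OF k])
  fix x
  show "norm (A x) \<le> k * norm x"
  proof (cases "A x = 0 \<or> x = 0")
    case False
    define y where "y = (norm x / norm (A x)) *\<^sub>R A x"
    have y: "norm y = norm x" "inner (A x) y = norm x * norm (A x)"
      using False by (auto simp: y_def dot_square_norm power2_eq_square)
    have "4 * inner (A x) y = inner (A (x + y)) (x + y) - inner (A (x - y)) (x - y)"
      using A by (simp add: sym_op_def blinfun.add_right blinfun.diff_right inner_add inner_diff)
        (simp add: inner_commute)
    also have "\<dots> \<le> k * inner (x + y) (x + y) + k * inner (x - y) (x - y)"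
      using bound[of "x + y"] bound[of "x - y"] by linarith
    also have "\<dots> = k * (2 * (norm x)\<^sup>2 + 2 * (norm y)\<^sup>2)"
      by (simp add: power2_norm_eq_inner inner_add inner_diff inner_commute algebra_simps)
    finally have "norm x * norm (A x) \<le> norm x * (k * norm x)"
      by (simp add: y power2_eq_square algebra_simps)
    then show ?thesis using False by (simp add: mult_le_cancel_left)
  qed (use k in auto)
qed

lemma abs_inner_blinfun_le: "\<bar>inner (blinfun_apply A x) x\<bar> \<le> norm A * inner x x"
proof -
  have "\<bar>inner (A x) x\<bar> \<le> norm (A x) * norm x" by (rule Cauchy_Schwarz_ineq2)
  also have "\<dots> \<le> norm A * norm x * norm x" by (intro mult_right_mono norm_blinfun) simp
  finally show ?thesis by (simp add: dot_square_norm power2_eq_square)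
qed

lemma sa_between_norm:
  fixes A :: "'h::real_inner op"
  assumes "sym_op A" "norm A \<le> k"
  shows "sa_between (- k) k A"
  unfolding sa_between_def
proof (intro conjI allI)
  fix x :: 'h
  have "norm A * inner x x \<le> k * inner x x" using assms(2) by (intro mult_right_mono) auto
  with abs_inner_blinfun_le[of A x] show "- k * inner x x \<le> inner (blinfun_apply A x) x"
    "inner (blinfun_apply A x) x \<le> k * inner x x" by linarith+
qed (rule assms)

lemma sa_between_affine:
  assumes "sa_between a b A" "0 \<le> d"
  shows "sa_between (c + d * a) (c + d * b) (c *\<^sub>R id_blinfun + d *\<^sub>R A)"
proof -
  have "d * (a * inner x x) \<le> d * inner (A x) x" "d * inner (A x) x \<le> d * (b * inner x x)" for x
    using assms by (auto simp: sa_between_def intro!: mult_left_mono)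
  then show ?thesis using assms(1)
    by (simp add: sa_between_def sym_op_add sym_op_scaleR blinfun.add_left blinfun.scaleR_left
        inner_add algebra_simps)
qed

lemma sa_between_uminus:
  assumes "sa_between a b A" shows "sa_between (- b) (- a) (- A)"
  using assms sym_op_scaleR[of A "- 1"] by (simp add: sa_between_def blinfun.minus_left)

lemma sa_between_mono: "sa_between a b A \<Longrightarrow> a' \<le> a \<Longrightarrow> b \<le> b' \<Longrightarrow> sa_between a' b' A"
  unfolding sa_between_def by (meson inner_ge_zero mult_right_mono order_trans)

text \<open>A real-linear norm-closed unital algebra of operators.\<close>

locale closed_op_algebra =
  fixes S :: "'h::complex_hilbert_space op set"
  assumes id_mem [simp]: "id_blinfun \<in> S"
    and add_mem: "A \<in> S \<Longrightarrow> B \<in> S \<Longrightarrow> A + B \<in> S"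
    and comp_mem: "A \<in> S \<Longrightarrow> B \<in> S \<Longrightarrow> (A o\<^sub>L B) \<in> S"
    and scaleR_mem: "A \<in> S \<Longrightarrow> r *\<^sub>R A \<in> S"
    and closed_mem: "closed S"
begin

lemma diff_mem: "A \<in> S \<Longrightarrow> B \<in> S \<Longrightarrow> A - B \<in> S"
  using add_mem[of A "(- 1) *\<^sub>R B"] scaleR_mem[of B "- 1"] by simp

lemma zero_mem [simp]: "0 \<in> S"
  using diff_mem[of id_blinfun id_blinfun] by simp

lemma poly_op_mem: "A \<in> S \<Longrightarrow> poly_op p A \<in> S"
  by (induction p) (auto simp: poly_op_pCons intro!: add_mem comp_mem scaleR_mem)

lemma limit_mem: "F \<longlonglongrightarrow> A \<Longrightarrow> (\<And>n. F n \<in> S) \<Longrightarrow> A \<in> S"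
  using closed_mem closed_sequential_limits by blast

end

text \<open>
  The powers \<open>C\<^sup>n\<close>, as values of the monomials \<open>X\<^sup>n\<close>, so that the laws for polynomials of an
  operator apply to them.
\<close>

definition opow :: "'h::complex_hilbert_space op \<Rightarrow> nat \<Rightarrow> 'h op" where
  "opow C n = poly_op ([:0, 1:] ^ n) C"

lemma opow_0 [simp]: "opow C 0 = id_blinfun"
  and opow_Suc: "opow C (Suc n) = (C o\<^sub>L opow C n)"
  by (simp_all only: opow_def power.simps poly_op_mult poly_op_linear poly_op_1) (simp add: comp_simps)

lemma opow_Suc2: "opow C (Suc n) = (opow C n o\<^sub>L C)"
  using poly_op_commute[of "[:0, 1:]" C "[:0, 1:] ^ n"]
  by (simp add: opow_Suc) (simp add: opow_def poly_op_linear)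

lemma norm_opow_le: "norm (opow C n) \<le> norm C ^ n"
proof (induction n)
  case 0 show ?case by (simp add: norm_blinfun_id_le)
next
  case (Suc n)
  have "norm (opow C (Suc n)) \<le> norm C * norm (opow C n)"
    by (simp add: opow_Suc norm_blinfun_compose)
  also have "\<dots> \<le> norm C * norm C ^ n" by (intro mult_left_mono Suc) simp
  finally show ?case by simp
qed

lemma summable_opow:
  assumes "norm C < 1" shows "summable (\<lambda>n. opow C n)"
proof (rule summable_comparison_test')
  show "summable (\<lambda>n. norm C ^ n)" using assms by (intro summable_geometric) simp
  show "norm (opow C n) \<le> norm C ^ n" if "n \<ge> 0" for n by (rule norm_opow_le)
qed

text \<open>
  The inverse of an operator; it is only used for invertible ones.
\<close>

definition op_inv :: "'h::real_normed_vector op \<Rightarrow> 'h op" where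
  "op_inv A = (THE B. (A o\<^sub>L B) = id_blinfun \<and> (B o\<^sub>L A) = id_blinfun)"

lemma op_inv_eqI:
  assumes "(A o\<^sub>L B) = id_blinfun" "(B o\<^sub>L A) = id_blinfun"
  shows "op_inv A = B"
  unfolding op_inv_def
proof (rule the_equality)
  fix B' assume B': "(A o\<^sub>L B') = id_blinfun \<and> (B' o\<^sub>L A) = id_blinfun"
  have "B' = (B' o\<^sub>L (A o\<^sub>L B))" using assms by (simp add: comp_simps)
  also have "\<dots> = B" using B' by (simp add: comp_simps(9)[symmetric]) (simp add: comp_simps)
  finally show "B' = B" .
qed (use assms in auto)

text \<open>
  Neumann series.
\<close>

lemma neumann:
  fixes C :: "'h::complex_hilbert_space op"
  assumes "norm C < 1"
  defines "B \<equiv> \<Sum>n. opow C n"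
  shows "((id_blinfun - C) o\<^sub>L B) = id_blinfun" "(B o\<^sub>L (id_blinfun - C)) = id_blinfun"
proof -
  have s: "(\<lambda>N. \<Sum>n<N. opow C n) \<longlonglongrightarrow> B"
    using summable_LIMSEQ[OF summable_opow[OF assms(1)]] by (simp add: B_def)
  have "(\<lambda>n. norm C ^ n) \<longlonglongrightarrow> 0" using assms(1) by (intro LIMSEQ_realpow_zero) auto
  then have "(\<lambda>n. opow C n) \<longlonglongrightarrow> 0"
    by (rule Lim_null_comparison[OF always_eventually, rotated]) (simp add: norm_opow_le)
  then have lim: "(\<lambda>N. id_blinfun - opow C N) \<longlonglongrightarrow> id_blinfun"
    using tendsto_diff[OF tendsto_const] by fastforce
  have 1: "((id_blinfun - C) o\<^sub>L (\<Sum>n<N. opow C n)) = id_blinfun - opow C N" for N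
    by (induction N) (simp_all add: comp_simps opow_Suc)
  have 2: "((\<Sum>n<N. opow C n) o\<^sub>L (id_blinfun - C)) = id_blinfun - opow C N" for N
  proof (induction N)
    case (Suc N)
    have "(opow C N o\<^sub>L (id_blinfun - C)) = opow C N - opow C (Suc N)"
      by (simp add: opow_Suc2 comp_simps)
    with Suc show ?case by (simp add: comp_simps(1))
  qed (simp add: comp_simps)
  have "(\<lambda>N. (id_blinfun - C) o\<^sub>L (\<Sum>n<N. opow C n)) \<longlonglongrightarrow> ((id_blinfun - C) o\<^sub>L B)"
    by (intro bounded_bilinear.tendsto[OF bounded_bilinear_blinfun_compose] tendsto_const s)
  then show "((id_blinfun - C) o\<^sub>L B) = id_blinfun"
    unfolding 1 using lim LIMSEQ_unique by blast
  have "(\<lambda>N. (\<Sum>n<N. opow C n) o\<^sub>L (id_blinfun - C)) \<longlonglongrightarrow> (B o\<^sub>L (id_blinfun - C))"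
    by (intro bounded_bilinear.tendsto[OF bounded_bilinear_blinfun_compose] tendsto_const s)
  then show "(B o\<^sub>L (id_blinfun - C)) = id_blinfun"
    unfolding 2 using lim LIMSEQ_unique by blast
qed

lemma norm_one_minus_le:
  assumes "sa_between a b A" "0 < a" "a \<le> b"
  shows "norm (id_blinfun - (1 / b) *\<^sub>R A) \<le> 1 - a / b"
proof (rule norm_sym_op_le)
  have b: "b > 0" using assms by simp
  show "sym_op (id_blinfun - (1 / b) *\<^sub>R A)"
    using assms(1) by (simp add: sa_between_def sym_op_diff sym_op_scaleR)
  show "0 \<le> 1 - a / b" using assms by simp
  fix x
  have "a * inner x x \<le> inner (A x) x" "inner (A x) x \<le> b * inner x x"
    using assms(1) by (auto simp: sa_between_def)
  then have "a * inner x x / b \<le> inner (A x) x / b" "inner (A x) x / b \<le> inner x x"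
    using b by (auto simp: divide_simps mult.commute)
  then show "\<bar>inner ((id_blinfun - (1 / b) *\<^sub>R A) x) x\<bar> \<le> (1 - a / b) * inner x x"
    by (simp add: blinfun.diff_left blinfun.scaleR_left inner_diff algebra_simps)
qed

lemma sa_between_le:
  fixes A :: "'h::real_inner op"
  assumes "sa_between a b A" "(x::'h) \<noteq> 0" shows "a \<le> b"
proof -
  have "a * inner x x \<le> b * inner x x" using assms by (meson order_trans sa_between_def)
  then show ?thesis using assms(2) by (simp add: mult_le_cancel_right)
qed

lemma (in closed_op_algebra) op_inv_bounded_below:
  assumes A: "A \<in> S" "sa_between a b A" "0 < a"
  shows "op_inv A \<in> S \<and> (A o\<^sub>L op_inv A) = id_blinfun \<and> (op_inv A o\<^sub>L A) = id_blinfun"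
proof -
  define c where "c = max a b"
  have Ac: "sa_between a c A" "a \<le> c" "0 < c"
    using A sa_between_mono[of a b A a c] by (auto simp: c_def)
  define C where "C = id_blinfun - (1 / c) *\<^sub>R A"
  define B where "B = (\<Sum>n. opow C n)"
  have "norm C \<le> 1 - a / c" unfolding C_def by (rule norm_one_minus_le[OF Ac(1) A(3) Ac(2)])
  then have C: "norm C < 1" using Ac(3) A(3) by (smt (verit) divide_pos_pos)
  have CS: "C \<in> S" using A by (auto simp: C_def intro: diff_mem scaleR_mem)
  have "(\<lambda>N. \<Sum>n<N. opow C n) \<longlonglongrightarrow> B"
    using summable_LIMSEQ[OF summable_opow[OF C]] by (simp add: B_def)
  moreover have "(\<Sum>n<N. opow C n) \<in> S" for N
    by (induction N) (auto simp: opow_def intro!: add_mem poly_op_mem CS)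
  ultimately have BS: "(1 / c) *\<^sub>R B \<in> S" by (rule scaleR_mem[OF limit_mem])
  have A_eq: "A = c *\<^sub>R (id_blinfun - C)" using Ac(3) by (simp add: C_def algebra_simps)
  have "(A o\<^sub>L (1 / c) *\<^sub>R B) = id_blinfun" "((1 / c) *\<^sub>R B o\<^sub>L A) = id_blinfun"
    using neumann[OF C] Ac(3) unfolding A_eq B_def[symmetric] by (simp_all add: comp_simps(5,6))
  with op_inv_eqI[OF this] BS show ?thesis by simp
qed

lemma clinear_ops_closed_algebra: "closed_op_algebra (clinear_ops :: 'h::complex_hilbert_space op set)"
proof
  have comm: "r *\<^sub>R c *\<^sub>C x = c *\<^sub>C r *\<^sub>R x" for r c and x :: 'h
    by (simp add: scaleR_scaleC scaleC_scaleC mult.commute)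
  show "closed (clinear_ops :: 'h op set)"
    unfolding closed_sequential_limits
  proof (intro allI impI, elim conjE)
    fix F and A :: "'h op" assume F: "\<forall>n. F n \<in> clinear_ops" and lim: "F \<longlonglongrightarrow> A"
    have "A (c *\<^sub>C x) = c *\<^sub>C A x" for c x
    proof -
      have "(\<lambda>n. F n (c *\<^sub>C x)) \<longlonglongrightarrow> A (c *\<^sub>C x)" by (intro blinfun.tendsto lim tendsto_const)
      moreover have "(\<lambda>n. c *\<^sub>C F n x) \<longlonglongrightarrow> c *\<^sub>C A x"
        by (intro bounded_linear.tendsto[OF bounded_linear_scaleC] blinfun.tendsto lim tendsto_const)
      ultimately show ?thesis using F LIMSEQ_unique by (auto simp: clinear_ops_def)
    qed
    then show "A \<in> clinear_ops" by (simp add: clinear_ops_def)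
  qed
qed (auto simp: clinear_ops_def blinfun.add_left scaleC_add_right blinfun.scaleR_left
    scaleR_scaleC scaleC_scaleC mult.commute)

lemma cscale_of_real: "complex_of_real r \<cdot>\<^sub>C A = r *\<^sub>R A"
  by (rule blinfun_eqI) (simp add: blinfun.scaleR_left scaleR_scaleC)

text \<open>
  If \<open>a \<le> A \<le> b\<close> then \<open>A - x\<close> or \<open>x - A\<close> is bounded below by a positive constant for every real
  \<open>x\<close> outside \<open>[a, b]\<close>.
\<close>

lemma spectrum_subset:
  fixes A :: "'h::complex_hilbert_space op"
  assumes A: "A \<in> clinear_ops" "sa_between a b A" and x: "complex_of_real x \<in> op_spectrum A"
  shows "a \<le> x \<and> x \<le> b"
proof (rule ccontr)
  assume no: "\<not> (a \<le> x \<and> x \<le> b)"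
  interpret closed_op_algebra "clinear_ops :: 'h op set" by (rule clinear_ops_closed_algebra)
  have mem: "A - x *\<^sub>R id_blinfun \<in> clinear_ops" by (intro diff_mem scaleR_mem A id_mem)
  have "\<exists>B\<in>clinear_ops. (A - x *\<^sub>R id_blinfun o\<^sub>L B) = id_blinfun \<and> (B o\<^sub>L A - x *\<^sub>R id_blinfun) = id_blinfun"
  proof (cases "x < a")
    case True
    have "sa_between (a - x) (b - x) (A - x *\<^sub>R id_blinfun)"
      using sa_between_affine[OF A(2), of 1 "- x"] by (simp add: algebra_simps)
    from op_inv_bounded_below[OF mem this] True show ?thesis by auto
  next
    case False
    have "sa_between (x - b) (x - a) (- (A - x *\<^sub>R id_blinfun))"
      using sa_between_affine[OF A(2), of 1 "- x"] sa_between_uminus by (fastforce simp: algebra_simps)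
    from op_inv_bounded_below[OF _ this] False no mem scaleR_mem[of _ "- 1"]
    obtain B where B: "B \<in> clinear_ops" "(- (A - x *\<^sub>R id_blinfun) o\<^sub>L B) = id_blinfun"
      "(B o\<^sub>L - (A - x *\<^sub>R id_blinfun)) = id_blinfun" by fastforce
    have "(- 1) *\<^sub>R B \<in> clinear_ops" using B(1) by (rule scaleR_mem)
    then show ?thesis using B(2,3)
      by (intro bexI[of _ "- B"]) (simp_all only: comp_simps(7,8) scaleR_minus1_left)
  qed
  then show False using x
    by (auto simp: op_spectrum_def invertible_in_def cscale_of_real)
qed

subsection \<open>The norm of a polynomial of a symmetric operator\<close>

text \<open>
  Bounded below in norm, i.e. \<open>0\<close> is not in the approximate point spectrum.
\<close>

definition bounded_below :: "'h::real_normed_vector op \<Rightarrow> bool" where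
  "bounded_below A \<longleftrightarrow> (\<exists>c>0. \<forall>x. c * norm x \<le> norm (blinfun_apply A x))"

lemma bounded_below_comp:
  assumes "bounded_below A" "bounded_below B" shows "bounded_below (A o\<^sub>L B)"
proof -
  obtain c d where c: "c > 0" "\<And>x. c * norm x \<le> norm (A x)"
    and d: "d > 0" "\<And>x. d * norm x \<le> norm (B x)"
    using assms by (auto simp: bounded_below_def)
  have "(c * d) * norm x \<le> norm (A (B x))" for x
  proof -
    have "c * (d * norm x) \<le> c * norm (B x)" using c d by (intro mult_left_mono) auto
    also have "\<dots> \<le> norm (A (B x))" by (rule c)
    finally show ?thesis by (simp add: mult.assoc)
  qed
  then show ?thesis using c d unfolding bounded_below_def by (intro exI[of _ "c * d"]) auto
qed

text \<open>Either \<open>\<parallel>T\<parallel>\<close> or \<open>-\<parallel>T\<parallel>\<close> is an approximate eigenvalue of a symmetric operator: otherwise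
  \<open>T\<^sup>2 - \<parallel>T\<parallel>\<^sup>2\<close> is bounded below, which forces \<open>\<parallel>T x\<parallel>\<close> to stay uniformly below \<open>\<parallel>T\<parallel> \<parallel>x\<parallel>\<close>.\<close>

lemma norm_approx_eigenvalue:
  fixes T :: "'h::complex_hilbert_space op"
  assumes T: "sym_op T" and nontriv: "(v::'h) \<noteq> 0"
  shows "\<exists>l. \<bar>l\<bar> = norm T \<and> \<not> bounded_below (T - l *\<^sub>R id_blinfun)"
proof (cases "T = 0")
  case True
  have "\<not> bounded_below (0 :: 'h op)"
    using nontriv by (auto simp: bounded_below_def not_le intro!: exI[of _ v])
  with True show ?thesis by auto
next
  case False
  define c where "c = norm T"
  have c: "c > 0" using False by (simp add: c_def)
  show ?thesis
  proof (rule ccontr)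
    assume "\<nexists>l. \<bar>l\<bar> = norm T \<and> \<not> bounded_below (T - l *\<^sub>R id_blinfun)"
    then have "bounded_below (T - l *\<^sub>R id_blinfun)" if "\<bar>l\<bar> = norm T" for l
      using that by blast
    from this[of c] this[of "- c"] c
    have "bounded_below (T - c *\<^sub>R id_blinfun)" "bounded_below (T - (- c) *\<^sub>R id_blinfun)"
      by (simp_all add: c_def)
    then have "bounded_below ((T - c *\<^sub>R id_blinfun) o\<^sub>L (T - (- c) *\<^sub>R id_blinfun))"
      by (rule bounded_below_comp)
    then obtain d where d: "d > 0"
      "\<And>x. d * norm x \<le> norm (T (T x) - (c * c) *\<^sub>R x)"
      by (auto simp: bounded_below_def blinfun.add_left blinfun.diff_left blinfun.scaleR_left
          blinfun.diff_right blinfun.add_right blinfun.scaleR_right algebra_simps)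
    have key: "d\<^sup>2 * (norm x)\<^sup>2 \<le> c\<^sup>2 * (c\<^sup>2 * (norm x)\<^sup>2 - (norm (T x))\<^sup>2)" for x
    proof -
      have "d\<^sup>2 * (norm x)\<^sup>2 \<le> (norm (T (T x) - (c * c) *\<^sub>R x))\<^sup>2"
        using d power_mono[OF d(2)[of x], of 2] by (simp add: power_mult_distrib)
      also have "\<dots> = (norm (T (T x)))\<^sup>2 - 2 * c\<^sup>2 * (norm (T x))\<^sup>2 + c\<^sup>2 * (c\<^sup>2 * (norm x)\<^sup>2)"
      proof -
        have "inner (T (T x)) x = inner (T x) (T x)" using T by (simp add: sym_op_def)
        then show ?thesis
          unfolding power2_norm_eq_inner
          by (simp add: inner_diff inner_commute[of x "T (T x)"] power2_eq_square algebra_simps)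
      qed
      also have "(norm (T (T x)))\<^sup>2 \<le> (c * norm (T x))\<^sup>2"
        by (intro power_mono) (simp_all add: c_def norm_blinfun)
      finally show ?thesis by (simp add: power_mult_distrib algebra_simps)
    qed
    define k where "k = c\<^sup>2 - d\<^sup>2 / c\<^sup>2"
    have le: "(norm (T x))\<^sup>2 \<le> k * (norm x)\<^sup>2" for x
      using key[of x] c by (simp add: k_def field_simps)
    have k: "0 \<le> k" using le[of v] nontriv
      by (smt (verit) mult_neg_pos zero_le_power2 zero_less_norm_iff zero_less_power)
    have "norm T \<le> sqrt k"
    proof (rule norm_blinfun_bound)
      show "norm (T x) \<le> sqrt k * norm x" for x
        using real_sqrt_le_mono[OF le[of x]] by (simp add: real_sqrt_mult)
    qed (use k in simp)
    also have "sqrt k < sqrt (c\<^sup>2)" using c d by (intro real_sqrt_less_mono) (simp add: k_def)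
    finally show False using c by (simp add: c_def)
  qed
qed

lemma poly_of_real_cmod:
  "poly (map_poly complex_of_real p) (complex_of_real x) = complex_of_real (poly p x)"
  by (induction p) (auto simp: map_poly_pCons)

lemma map_poly_of_real_mult_add:
  "map_poly complex_of_real (p * q + r) =
     map_poly complex_of_real p * map_poly complex_of_real q + map_poly complex_of_real r"
  by (intro poly_eqI) (simp add: coeff_map_poly coeff_mult)

text \<open>A polynomial is bounded below at a symmetric \<open>A\<close> once \<open>A - x\<close> is for each real root \<open>x\<close>:
  over the reals the polynomial splits into linear factors and factors \<open>(X - u)\<^sup>2 + v\<^sup>2\<close>.\<close>

lemma bounded_below_poly_op:
  fixes A :: "'h::complex_hilbert_space op"
  assumes A: "sym_op A"
  shows "q \<noteq> 0 \<Longrightarrow> (\<And>x. poly q x = 0 \<Longrightarrow> bounded_below (A - x *\<^sub>R id_blinfun)) \<Longrightarrow>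
    bounded_below (poly_op q A)"
proof (induction "degree q" arbitrary: q rule: less_induct)
  case less
  show ?case
  proof (cases "degree q = 0")
    case True
    then obtain c where "q = [:c:]" by (metis degree_eq_zeroE)
    then show ?thesis using less.prems
      by (auto simp: bounded_below_def blinfun.scaleR_left intro!: exI[of _ "\<bar>c\<bar>"])
  next
    case False
    let ?q = "map_poly complex_of_real q"
    have "\<not> constant (poly ?q)" using False by (simp add: constant_degree degree_map_poly)
    then obtain z where z: "poly ?q z = 0" using fundamental_theorem_of_algebra by blast
    have "\<exists>f g. q = f * g \<and> 0 < degree f \<and> bounded_below (poly_op f A)"
    proof (cases "Im z = 0")
      case True
      then have "z = complex_of_real (Re z)" by (simp add: complex_eq_iff)
      with z have root: "poly q (Re z) = 0" by (metis poly_of_real_cmod of_real_eq_0_iff)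
      then obtain g where "q = [:- Re z, 1:] * g" by (metis dvdE poly_eq_0_iff_dvd)
      moreover have "bounded_below (poly_op [:- Re z, 1:] A)"
        using less.prems(2)[OF root] by (simp add: poly_op_linear)
      ultimately show ?thesis by (intro exI[of _ "[:- Re z, 1:]"] exI[of _ g]) simp
    next
      case False
      define u v where "u = Re z" and "v = Im z"
      define Q where "Q = [:u\<^sup>2 + v\<^sup>2, - 2 * u, 1:]"
      have v: "v \<noteq> 0" using False by (simp add: v_def)
      have Q0: "poly (map_poly complex_of_real Q) z = 0"
        by (simp add: Q_def map_poly_pCons complex_eq_iff u_def v_def power2_eq_square algebra_simps)
      have "degree Q = 2" by (simp add: Q_def)
      have "q mod Q = 0"
      proof (rule ccontr)
        assume nz: "q mod Q \<noteq> 0"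
        then have "degree (q mod Q) < 2"
          using degree_mod_less[of Q q] \<open>degree Q = 2\<close> by (cases "Q = 0") auto
        then obtain c d where cd: "q mod Q = [:c, d:]"
          by (metis One_nat_def degree_eq_zeroE degree_pCons_eq_if less_2_cases_iff
              nat.inject pCons_0_0 pCons_cases)
        have "?q = map_poly complex_of_real (Q * (q div Q) + q mod Q)" by simp
        then have "poly (map_poly complex_of_real (q mod Q)) z = 0"
          using z Q0 unfolding map_poly_of_real_mult_add by simp
        then have "d * v = 0" "c + d * u = 0"
          by (auto simp: cd map_poly_pCons complex_eq_iff u_def v_def algebra_simps split: if_splits)
        then show False using v nz cd by simp
      qed
      then have "q = Q * (q div Q)" by (metis add.right_neutral mult_div_mod_eq)
      moreover have "bounded_below (poly_op Q A)"
      proof -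
        define B where "B = A - u *\<^sub>R id_blinfun"
        have B: "sym_op B" using A by (simp add: B_def sym_op_diff sym_op_scaleR)
        have eq: "poly_op Q A = v\<^sup>2 *\<^sub>R id_blinfun + (B o\<^sub>L B)"
          by (simp add: Q_def poly_op_pCons B_def comp_simps algebra_simps power2_eq_square)
            (simp add: scaleR_2[symmetric])
        have "v\<^sup>2 * norm x \<le> norm (poly_op Q A x)" for x
        proof (cases "x = 0")
          case False
          have "v\<^sup>2 * (norm x)\<^sup>2 \<le> inner (poly_op Q A x) x"
            using B[unfolded sym_op_def, rule_format, of "B x" x]
            by (simp add: eq blinfun.add_left blinfun.scaleR_left inner_add power2_norm_eq_inner)
          also have "\<dots> \<le> norm (poly_op Q A x) * norm x" by (rule norm_cauchy_schwarz)
          finally show ?thesis using False by (simp add: power2_eq_square)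
        qed simp
        then show ?thesis using v by (auto simp: bounded_below_def intro!: exI[of _ "v\<^sup>2"])
      qed
      ultimately show ?thesis using \<open>degree Q = 2\<close> by (intro exI[of _ Q] exI[of _ "q div Q"]) simp
    qed
    then obtain f g where fg: "q = f * g" "0 < degree f" "bounded_below (poly_op f A)" by blast
    then have "degree g < degree q" using less.prems(1) by (auto simp: degree_mult_eq)
    then have "bounded_below (poly_op g A)" using less fg by auto
    with fg show ?thesis by (simp add: poly_op_mult bounded_below_comp)
  qed
qed

text \<open>
  The bound is taken over the spectrum itself, not over an interval containing it, because
  uniqueness of the limit in \<open>cfc\<close> depends on it.
\<close>

lemma norm_poly_op_spectrum:
  fixes A :: "'h::complex_hilbert_space op"
  assumes A: "sym_op A" and M: "0 \<le> M"
    and bound: "\<And>x. complex_of_real x \<in> op_spectrum A \<Longrightarrow> \<bar>poly p x\<bar> \<le> M"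
  shows "norm (poly_op p A) \<le> M"
proof (rule ccontr)
  assume big: "\<not> norm (poly_op p A) \<le> M"
  then have "poly_op p A \<noteq> 0" using M by auto
  then obtain v :: 'h where v: "v \<noteq> 0" by (metis blinfun.zero_right blinfun_eqI blinfun.zero_left)
  have spec: "complex_of_real x \<in> op_spectrum A" if "\<not> bounded_below (A - x *\<^sub>R id_blinfun)" for x
  proof (rule ccontr)
    assume "complex_of_real x \<notin> op_spectrum A"
    then obtain B where B: "(B o\<^sub>L (A - x *\<^sub>R id_blinfun)) = id_blinfun"
      by (auto simp: op_spectrum_def invertible_in_def cscale_of_real)
    have "norm y \<le> (norm B + 1) * norm ((A - x *\<^sub>R id_blinfun) y)" for y
    proof -
      have "norm y = norm (B ((A - x *\<^sub>R id_blinfun) y))"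
        by (metis B blinfun_apply_blinfun_compose blinfun_apply_id_blinfun id_apply)
      also have "\<dots> \<le> norm B * norm ((A - x *\<^sub>R id_blinfun) y)" by (rule norm_blinfun)
      also have "\<dots> \<le> (norm B + 1) * norm ((A - x *\<^sub>R id_blinfun) y)" by (intro mult_right_mono) auto
      finally show ?thesis .
    qed
    then have "bounded_below (A - x *\<^sub>R id_blinfun)"
      unfolding bounded_below_def
      by (intro exI[of _ "1 / (norm B + 1)"] conjI allI)
        (simp_all add: pos_divide_le_eq add_nonneg_pos mult.commute)
    with that show False by simp
  qed
  obtain l where l: "\<bar>l\<bar> = norm (poly_op p A)" "\<not> bounded_below (poly_op p A - l *\<^sub>R id_blinfun)"
    using norm_approx_eigenvalue[OF sym_op_poly[OF A] v] by blast
  show False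
  proof (cases "p = [:l:]")
    case True
    obtain m where m: "\<not> bounded_below (A - m *\<^sub>R id_blinfun)"
      using norm_approx_eigenvalue[OF A v] by blast
    have "poly p m = l" by (subst True) simp
    with bound[OF spec[OF m]] l(1) big show False by linarith
  next
    case False
    have "bounded_below (poly_op (p - [:l:]) A)"
    proof (rule bounded_below_poly_op[OF A])
      show "p - [:l:] \<noteq> 0" using False by simp
      fix x assume "poly (p - [:l:]) x = 0"
      then show "bounded_below (A - x *\<^sub>R id_blinfun)"
          using bound[OF spec[of x]] l(1) big by (cases "bounded_below (A - x *\<^sub>R id_blinfun)") auto
    qed
    then show False using l(2) by (simp add: poly_op_diff)
  qed
qed

section \<open>Continuous functional calculus\<close>

lemma norm_poly_op_le:
  fixes A :: "'h::complex_hilbert_space op"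
  assumes A: "A \<in> clinear_ops" "sa_between a b A" and M: "0 \<le> M"
    and bound: "\<And>x. a \<le> x \<Longrightarrow> x \<le> b \<Longrightarrow> \<bar>poly p x\<bar> \<le> M"
  shows "norm (poly_op p A) \<le> M"
  using A spectrum_subset[OF A] by (intro norm_poly_op_spectrum M bound) (auto simp: sa_between_def)

text \<open>
  If \<open>m \<le> p \<le> M\<close> on \<open>[a, b]\<close> then \<open>\<parallel>M - p(A)\<parallel> \<le> M - m\<close>, which contains the lower bound
  \<open>m \<le> p(A)\<close>.
\<close>

lemma poly_op_lower_bound:
  fixes A :: "'h::complex_hilbert_space op"
  assumes A: "A \<in> clinear_ops" "sa_between a b A"
    and bound: "\<And>x. a \<le> x \<Longrightarrow> x \<le> b \<Longrightarrow> m \<le> poly p x"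
  shows "m * inner v v \<le> inner (poly_op p A v) v"
proof -
  have "compact (poly p ` {a..b})" by (intro compact_continuous_image) (auto intro: continuous_intros)
  then obtain B where B: "\<And>x. x \<in> {a..b} \<Longrightarrow> \<bar>poly p x\<bar> \<le> B"
    using compact_imp_bounded bounded_real by (metis (no_types, opaque_lifting) image_eqI)
  define M where "M = max B m"
  have "norm (poly_op ([:M:] - p) A) \<le> M - m"
  proof (rule norm_poly_op_le[OF A])
    fix x assume "a \<le> x" "x \<le> b"
    then show "\<bar>poly ([:M:] - p) x\<bar> \<le> M - m"
      using B[of x] bound[of x] by (auto simp: M_def)
  qed (simp add: M_def)
  then have "norm (poly_op ([:M:] - p) A) * inner v v \<le> (M - m) * inner v v"
    by (intro mult_right_mono) auto
  with abs_inner_blinfun_le[of "poly_op ([:M:] - p) A" v]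
  have "inner (poly_op ([:M:] - p) A v) v \<le> (M - m) * inner v v" by linarith
  then show ?thesis
    by (simp add: poly_op_diff blinfun.diff_left blinfun.scaleR_left inner_diff algebra_simps)
qed

lemma sa_between_poly_op:
  fixes A :: "'h::complex_hilbert_space op"
  assumes A: "A \<in> clinear_ops" "sa_between a b A"
    and bound: "\<And>x. a \<le> x \<Longrightarrow> x \<le> b \<Longrightarrow> m \<le> poly p x \<and> poly p x \<le> M"
  shows "sa_between m M (poly_op p A)"
  unfolding sa_between_def
proof (intro conjI allI)
  show "sym_op (poly_op p A)" using A by (simp add: sa_between_def sym_op_poly)
  fix v
  show "m * inner v v \<le> inner (poly_op p A v) v"
    using bound by (intro poly_op_lower_bound[OF A]) auto
  have "- M * inner v v \<le> inner (poly_op (smult (- 1) p) A v) v"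
    using bound by (intro poly_op_lower_bound[OF A]) auto
  then show "inner (poly_op p A v) v \<le> M * inner v v"
    by (simp add: poly_op_smult[of "- 1", simplified] blinfun.minus_left)
qed

lemma weierstrass_poly:
  fixes f :: "real \<Rightarrow> real"
  assumes "continuous_on {a..b} f"
  obtains p :: "nat \<Rightarrow> real poly"
  where "uniform_limit {a..b} (\<lambda>n x. poly (p n) x) f sequentially"
proof -
  have "\<exists>q. \<forall>x\<in>{a..b}. \<bar>f x - poly q x\<bar> < inverse (real (Suc n))" for n
  proof -
    obtain g where g: "real_polynomial_function g"
      "\<And>x. x \<in> {a..b} \<Longrightarrow> \<bar>f x - g x\<bar> < inverse (real (Suc n))"
      using Stone_Weierstrass_real_polynomial_function[of "{a..b}" f "inverse (real (Suc n))"] assms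
      by auto
    obtain c N where "g = (\<lambda>x. \<Sum>i\<le>N. c i * x ^ i)"
      using g(1) real_polynomial_function_iff_sum by blast
    then have "g x = poly (\<Sum>i\<le>N. monom (c i) i) x" for x by (simp add: poly_sum poly_monom)
    with g(2) show ?thesis by metis
  qed
  then obtain p where p: "\<And>n x. x \<in> {a..b} \<Longrightarrow> \<bar>f x - poly (p n) x\<bar> < inverse (real (Suc n))"
    by metis
  have "uniform_limit {a..b} (\<lambda>n x. poly (p n) x) f sequentially"
  proof (rule uniform_limitI)
    fix e :: real assume "e > 0"
    then obtain N where N: "inverse (real (Suc N)) < e" using reals_Archimedean by blast
    have "dist (poly (p n) x) (f x) < e" if "n \<ge> N" "x \<in> {a..b}" for n x
    proof -
      have "inverse (real (Suc n)) \<le> inverse (real (Suc N))"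
        using that by (intro le_imp_inverse_le) auto
      with p[OF that(2), of n] N have "\<bar>f x - poly (p n) x\<bar> < e" by linarith
      then show ?thesis by (simp add: dist_real_def abs_minus_commute)
    qed
    then show "\<forall>\<^sub>F n in sequentially. \<forall>x\<in>{a..b}. dist (poly (p n) x) (f x) < e"
      unfolding eventually_sequentially by blast
  qed
  then show ?thesis by (rule that)
qed

lemma cfc_eqI:
  fixes A :: "'h::complex_hilbert_space op"
  assumes A: "sym_op A"
    and lim: "uniform_limit {x. complex_of_real x \<in> op_spectrum A} (\<lambda>n x. poly (p n) x) f sequentially"
      "(\<lambda>n. poly_op (p n) A) \<longlonglongrightarrow> B"
  shows "cfc f A = B"
  unfolding cfc_def
proof (rule the_equality)
  let ?S = "{x. complex_of_real x \<in> op_spectrum A}"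
  show "\<exists>p. uniform_limit ?S (\<lambda>n. poly (p n)) f sequentially \<and> (\<lambda>n. poly_op (p n) A) \<longlonglongrightarrow> B"
    using lim by blast
  fix B' assume "\<exists>p. uniform_limit ?S (\<lambda>n. poly (p n)) f sequentially \<and> (\<lambda>n. poly_op (p n) A) \<longlonglongrightarrow> B'"
  then obtain q where q: "uniform_limit ?S (\<lambda>n. poly (q n)) f sequentially"
    "(\<lambda>n. poly_op (q n) A) \<longlonglongrightarrow> B'" by blast
  have "uniform_limit ?S (\<lambda>n x. poly (p n) x - poly (q n) x) (\<lambda>x. f x - f x) sequentially"
    by (intro uniform_limit_intros lim q)
  then have unif: "uniform_limit ?S (\<lambda>n x. poly (p n - q n) x) (\<lambda>x. 0) sequentially" by simp
  have "(\<lambda>n. poly_op (p n - q n) A) \<longlonglongrightarrow> 0"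
  proof (rule tendstoI)
    fix e :: real assume e: "e > 0"
    have "\<forall>\<^sub>F n in sequentially. \<forall>x\<in>?S. dist (poly (p n - q n) x) 0 < e / 2"
      using uniform_limitD[OF unif, of "e / 2"] e by simp
    then show "\<forall>\<^sub>F n in sequentially. dist (poly_op (p n - q n) A) 0 < e"
    proof eventually_elim
      case (elim n)
      then have "norm (poly_op (p n - q n) A) \<le> e / 2"
        using e by (intro norm_poly_op_spectrum A) (auto simp: dist_real_def intro!: less_imp_le)
      then show ?case using e by simp
    qed
  qed
  moreover have "(\<lambda>n. poly_op (p n - q n) A) \<longlonglongrightarrow> B - B'"
    unfolding poly_op_diff by (intro tendsto_diff lim q)
  ultimately have "B - B' = 0" using LIMSEQ_unique by blast
  then show "B' = B" by simp
qed

text \<open>Polynomials converging uniformly on \<open>[a, b]\<close> converge in norm at every \<open>A\<close> with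
  \<open>a \<le> A \<le> b\<close>, and the bounds of the limit function carry over to the limit operator.\<close>

lemma poly_op_convergent:
  fixes A :: "'h::complex_hilbert_space op"
  assumes A: "A \<in> clinear_ops" "sa_between a b A"
    and lim: "uniform_limit {a..b} (\<lambda>n x. poly (p n) x) f sequentially"
  shows "convergent (\<lambda>n. poly_op (p n) A)"
proof (rule Cauchy_convergent, rule metric_CauchyI)
  fix e :: real assume e: "e > 0"
  then have "e / 4 > 0" by simp
  from uniform_limitD[OF lim this]
  obtain N where N: "\<And>n x. n \<ge> N \<Longrightarrow> x \<in> {a..b} \<Longrightarrow> dist (poly (p n) x) (f x) < e / 4"
    unfolding eventually_sequentially by blast
  have "dist (poly_op (p m) A) (poly_op (p n) A) < e" if "m \<ge> N" "n \<ge> N" for m n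
  proof -
    have "norm (poly_op (p m - p n) A) \<le> e / 2"
    proof (rule norm_poly_op_le[OF A])
      fix x assume "a \<le> x" "x \<le> b"
      with N[OF that(1), of x] N[OF that(2), of x]
      have "\<bar>poly (p m) x - f x\<bar> < e / 4" "\<bar>poly (p n) x - f x\<bar> < e / 4"
        by (auto simp only: dist_real_def atLeastAtMost_iff)
      then show "\<bar>poly (p m - p n) x\<bar> \<le> e / 2" unfolding poly_diff by linarith
    qed (use e in simp)
    then show ?thesis using e by (simp add: poly_op_diff dist_norm)
  qed
  then show "\<exists>N. \<forall>m\<ge>N. \<forall>n\<ge>N. dist (poly_op (p m) A) (poly_op (p n) A) < e" by blast
qed

lemma sa_between_poly_op_limit:
  fixes A :: "'h::complex_hilbert_space op"
  assumes A: "A \<in> clinear_ops" "sa_between a b A"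
    and lim: "uniform_limit {a..b} (\<lambda>n x. poly (p n) x) f sequentially"
      "(\<lambda>n. poly_op (p n) A) \<longlonglongrightarrow> B"
    and bound: "\<And>x. a \<le> x \<Longrightarrow> x \<le> b \<Longrightarrow> m \<le> f x \<and> f x \<le> M"
  shows "sa_between m M B"
  unfolding sa_between_def
proof (intro conjI allI)
  show "sym_op B" using A by (intro sym_op_tendsto[OF lim(2)] sym_op_poly) (auto simp: sa_between_def)
  fix v :: 'h
  have conv: "(\<lambda>n. inner (poly_op (p n) A v) v) \<longlonglongrightarrow> inner (B v) v"
    by (intro tendsto_intros blinfun.tendsto lim)
  have ev: "\<forall>\<^sub>F n in sequentially. (m - e) * inner v v \<le> inner (poly_op (p n) A v) v \<and>
      inner (poly_op (p n) A v) v \<le> (M + e) * inner v v" if "e > 0" for e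
    using uniform_limitD[OF lim(1) that]
  proof eventually_elim
    case (elim n)
    have "m - e \<le> poly (p n) x \<and> poly (p n) x \<le> M + e" if "a \<le> x" "x \<le> b" for x
      using elim[rule_format, of x] bound[OF that] that by (simp add: dist_real_def abs_if split: if_splits)
    then have "sa_between (m - e) (M + e) (poly_op (p n) A)" by (intro sa_between_poly_op[OF A]) auto
    then show ?case by (simp add: sa_between_def)
  qed
  have bnd: "(m - e) * inner v v \<le> inner (B v) v" "inner (B v) v \<le> (M + e) * inner v v" if "e > 0" for e
    using ev[OF that] by (auto intro!: tendsto_lowerbound[OF conv] tendsto_upperbound[OF conv]
        elim!: eventually_mono)
  have *: "m * inner v v \<le> inner (B v) v + e * inner v v" "inner (B v) v \<le> M * inner v v + e * inner v v"
    if "e > 0" for e using bnd[OF that] by (auto simp: algebra_simps)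
  have r: "x \<le> y" if "\<And>e. e > 0 \<Longrightarrow> x \<le> y + e * inner v v" for x y
  proof (rule field_le_epsilon)
    fix e :: real assume e: "e > 0"
    have "x \<le> y + (e / (inner v v + 1)) * inner v v" using e by (intro that) (simp add: add_nonneg_pos)
    also have "(e / (inner v v + 1)) * inner v v \<le> e"
      using e by (simp add: pos_divide_le_eq add_nonneg_pos distrib_left)
    finally show "x \<le> y + e" by simp
  qed
  show "m * inner v v \<le> inner (B v) v" "inner (B v) v \<le> M * inner v v" using r[OF *(1)] r[OF *(2)] by auto
qed

lemma continuous_on_sqrt: "continuous_on T sqrt"
  using continuous_on_real_sqrt[OF continuous_on_id, of T] by simp

lemma (in closed_op_algebra) sqrt_exists:
  assumes A: "A \<in> S" "A \<in> clinear_ops" "sa_between a b A" and a: "0 \<le> a"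
  shows "\<exists>B\<in>S. sa_between (sqrt a) (sqrt b) B \<and> (B o\<^sub>L B) = A"
proof -
  obtain p where p: "uniform_limit {a..b} (\<lambda>n x. poly (p n) x) sqrt sequentially"
    using weierstrass_poly[OF continuous_on_sqrt] by blast
  obtain B where B: "(\<lambda>n. poly_op (p n) A) \<longlonglongrightarrow> B"
    using poly_op_convergent[OF A(2,3) p] by (auto simp: convergent_def)
  have "B \<in> S" using B by (rule limit_mem) (intro poly_op_mem A)
  moreover have "sa_between (sqrt a) (sqrt b) B"
    by (rule sa_between_poly_op_limit[OF A(2,3) p B]) auto
  moreover have "(B o\<^sub>L B) = A"
  proof -
    have "bounded (sqrt ` {a..b})"
      by (intro compact_imp_bounded compact_continuous_image) (auto intro: continuous_intros)
    then have "uniform_limit {a..b} (\<lambda>n x. poly (p n) x * poly (p n) x) (\<lambda>x. sqrt x * sqrt x) sequentially"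
      by (intro uniform_lim_mult p)
    then have "uniform_limit {a..b} (\<lambda>n x. poly (p n) x * poly (p n) x - x) (\<lambda>x. sqrt x * sqrt x - x) sequentially"
      by (intro uniform_limit_minus uniform_limit_const)
    then have u: "uniform_limit {a..b} (\<lambda>n x. poly (p n * p n - [:0, 1:]) x) (\<lambda>x. 0) sequentially"
      using a by (auto elim!: uniform_limit_cong'[THEN iffD1, rotated 2])
    have "(\<lambda>n. poly_op (p n * p n - [:0, 1:]) A) \<longlonglongrightarrow> 0"
    proof -
      obtain Z where Z: "(\<lambda>n. poly_op (p n * p n - [:0, 1:]) A) \<longlonglongrightarrow> Z"
        using poly_op_convergent[OF A(2,3) u] by (auto simp: convergent_def)
      have "sa_between 0 0 Z" by (rule sa_between_poly_op_limit[OF A(2,3) u Z]) auto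
      then have "norm Z \<le> 0" by (intro norm_sym_op_le) (auto simp: sa_between_def)
      with Z show ?thesis by simp
    qed
    moreover have "(\<lambda>n. poly_op (p n * p n - [:0, 1:]) A) \<longlonglongrightarrow> (B o\<^sub>L B) - A"
      unfolding poly_op_diff poly_op_mult poly_op_linear
      by (auto intro!: tendsto_intros bounded_bilinear.tendsto[OF bounded_bilinear_blinfun_compose] B)
    ultimately have "(B o\<^sub>L B) - A = 0" using LIMSEQ_unique by blast
    then show ?thesis by simp
  qed
  ultimately show ?thesis by blast
qed

text \<open>
  Polynomials \<open>p\<^sub>n(x) \<rightarrow> \<surd>x\<close> on \<open>[a\<^sup>2, b\<^sup>2]\<close> satisfy \<open>p\<^sub>n(x\<^sup>2) \<rightarrow> x\<close> on \<open>[a, b]\<close>, and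
  \<open>p\<^sub>n(A\<^sup>2)\<close> is the value at \<open>A\<close> of the latter polynomial.
\<close>

lemma cfc_sqrt_square:
  fixes A :: "'h::complex_hilbert_space op"
  assumes A: "A \<in> clinear_ops" "sa_between a b A" and a: "0 \<le> a"
  shows "cfc sqrt (A o\<^sub>L A) = A"
proof -
  have sq: "(A o\<^sub>L A) = poly_op [:0, 0, 1:] A"
    by (simp add: poly_op_pCons comp_simps)
  have bw: "sa_between (a\<^sup>2) (b\<^sup>2) (A o\<^sub>L A)" unfolding sq
    using a by (intro sa_between_poly_op[OF A]) (auto simp: power2_eq_square intro!: mult_mono)
  have cl: "(A o\<^sub>L A) \<in> clinear_ops" using A(1) by (simp add: clinear_ops_def)
  obtain p where p: "uniform_limit {a\<^sup>2..b\<^sup>2} (\<lambda>n x. poly (p n) x) sqrt sequentially"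
    using weierstrass_poly[OF continuous_on_sqrt] by blast
  show ?thesis
  proof (rule cfc_eqI)
    show "sym_op (A o\<^sub>L A)" using bw by (simp add: sa_between_def)
    show "uniform_limit {x. complex_of_real x \<in> op_spectrum (A o\<^sub>L A)} (\<lambda>n. poly (p n)) sqrt sequentially"
      by (rule uniform_limit_on_subset[OF p]) (use spectrum_subset[OF cl bw] in auto)
    show "(\<lambda>n. poly_op (p n) (A o\<^sub>L A)) \<longlonglongrightarrow> A"
    proof (rule tendstoI)
      fix e :: real assume e: "e > 0"
      have "\<forall>\<^sub>F n in sequentially. \<forall>x\<in>{a\<^sup>2..b\<^sup>2}. dist (poly (p n) x) (sqrt x) < e / 2"
        using uniform_limitD[OF p, of "e / 2"] e by simp
      then show "\<forall>\<^sub>F n in sequentially. dist (poly_op (p n) (A o\<^sub>L A)) A < e"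
      proof eventually_elim
        case (elim n)
        have "norm (poly_op (pcompose (p n) [:0, 0, 1:] - [:0, 1:]) A) \<le> e / 2"
        proof (rule norm_poly_op_le[OF A])
          fix x assume x: "a \<le> x" "x \<le> b"
          then have "x\<^sup>2 \<in> {a\<^sup>2..b\<^sup>2}" using a by (auto intro!: power_mono)
          from elim[rule_format, OF this] show "\<bar>poly (pcompose (p n) [:0, 0, 1:] - [:0, 1:]) x\<bar> \<le> e / 2"
            using x a by (simp add: poly_pcompose dist_real_def power2_eq_square real_sqrt_mult)
        qed (use e in simp)
        then show ?case using e
          by (simp add: poly_op_diff poly_op_pcompose sq[symmetric] poly_op_linear dist_norm)
      qed
    qed
  qed
qed

text \<open>
  \<open>ln A = ln b - \<Sum> C\<^sup>n / n\<close> with \<open>C = 1 - A/b\<close>.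
\<close>

lemma cfc_ln_series:
  fixes A :: "'h::complex_hilbert_space op"
  assumes A: "A \<in> clinear_ops" "sa_between a b A" and ab: "0 < a" "a \<le> b"
  defines "C \<equiv> id_blinfun - (1 / b) *\<^sub>R A"
  shows "(\<lambda>n. (1 / real (Suc n)) *\<^sub>R opow C (Suc n)) sums (ln b *\<^sub>R id_blinfun - cfc ln A)"
proof -
  define k where "k = 1 - a / b"
  have b: "b > 0" and k: "0 \<le> k" "k < 1" using ab by (auto simp: k_def)
  have C: "norm C \<le> k" unfolding C_def k_def by (rule norm_one_minus_le[OF A(2) ab])
  have "summable (\<lambda>n. (1 / real (Suc n)) *\<^sub>R opow C (Suc n))"
  proof (rule summable_comparison_test')
    show "summable (\<lambda>n. k ^ n)" using k by (intro summable_geometric) simp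
    fix n
    have "norm (opow C (Suc n)) \<le> norm C ^ Suc n" by (rule norm_opow_le)
    also have "\<dots> \<le> k ^ Suc n" using C by (intro power_mono) auto
    also have "\<dots> \<le> k ^ n" using k by (simp add: mult_left_le_one_le)
    finally have "norm (opow C (Suc n)) \<le> k ^ n" .
    then have "norm (opow C (Suc n)) / real (Suc n) \<le> k ^ n / 1" using k by (intro frac_le) auto
    then show "norm ((1 / real (Suc n)) *\<^sub>R opow C (Suc n)) \<le> k ^ n" by simp
  qed
  then obtain L where L: "(\<lambda>n. (1 / real (Suc n)) *\<^sub>R opow C (Suc n)) sums L"
    by (auto simp: summable_def)
  define P where "P N = [:ln b:] - (\<Sum>n<N. smult (1 / real (Suc n)) ([:1, - 1 / b:] ^ Suc n))" for N
  have PA: "poly_op (P N) A = ln b *\<^sub>R id_blinfun - (\<Sum>n<N. (1 / real (Suc n)) *\<^sub>R opow C (Suc n))" for N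
  proof -
    have "poly_op ([:1, - 1 / b:] ^ n) A = opow C n" for n
    proof (induction n)
      case (Suc n)
      then show ?case
        by (simp only: power_Suc poly_op_mult opow_Suc) (simp add: poly_op_linear C_def)
    qed simp
    then show ?thesis
      unfolding P_def poly_op_diff poly_op_sum poly_op_smult poly_op_const by (simp only:)
  qed
  have "cfc ln A = ln b *\<^sub>R id_blinfun - L"
  proof (rule cfc_eqI)
    show "sym_op A" using A by (simp add: sa_between_def)
    show "(\<lambda>N. poly_op (P N) A) \<longlonglongrightarrow> ln b *\<^sub>R id_blinfun - L"
      unfolding PA using L by (intro tendsto_diff tendsto_const) (simp add: sums_def)
    have "uniform_limit {a..b} (\<lambda>N x. \<Sum>n<N. (1 / real (Suc n)) * (1 - x / b) ^ Suc n)
        (\<lambda>x. \<Sum>n. (1 / real (Suc n)) * (1 - x / b) ^ Suc n) sequentially"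
    proof (rule Weierstrass_m_test)
      show "summable (\<lambda>n. k ^ Suc n)" using k by (simp add: summable_geometric)
      fix n x assume "x \<in> {a..b}"
      then have x: "0 \<le> 1 - x / b" "1 - x / b \<le> k" using b by (auto simp: k_def divide_right_mono)
      then have "(1 - x / b) ^ Suc n \<le> k ^ Suc n" by (intro power_mono)
      then have "(1 - x / b) ^ Suc n / real (Suc n) \<le> k ^ Suc n / 1"
        using k by (intro frac_le) auto
      then show "norm ((1 / real (Suc n)) * (1 - x / b) ^ Suc n) \<le> k ^ Suc n"
        using x by (simp add: abs_mult)
    qed
    then have "uniform_limit {a..b} (\<lambda>N x. ln b - (\<Sum>n<N. (1 / real (Suc n)) * (1 - x / b) ^ Suc n))
        (\<lambda>x. ln b - (\<Sum>n. (1 / real (Suc n)) * (1 - x / b) ^ Suc n)) sequentially"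
      by (intro uniform_limit_minus uniform_limit_const)
    moreover have "ln b - (\<Sum>n. (1 / real (Suc n)) * (1 - x / b) ^ Suc n) = ln x" if "x \<in> {a..b}" for x
    proof -
      have x: "0 < x / b" "x / b < 2" using that ab b by (auto simp: field_simps)
      have "ln x - ln b = ln (x / b)" using that ab b by (simp add: ln_div)
      also have "\<dots> = (\<Sum>n. (- 1) ^ n * (1 / real (n + 1)) * (x / b - 1) ^ Suc n)"
        by (rule ln_series[OF x])
      also have "(\<lambda>n. (- 1) ^ n * (1 / real (n + 1)) * (x / b - 1) ^ Suc n)
          = (\<lambda>n. - ((1 / real (Suc n)) * (1 - x / b) ^ Suc n))"
      proof
        fix n
        have "(x / b - 1) ^ Suc n = (- 1) ^ Suc n * (1 - x / b) ^ Suc n"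
          by (simp only: power_mult_distrib[symmetric]) simp
        then show "(- 1) ^ n * (1 / real (n + 1)) * (x / b - 1) ^ Suc n
            = - ((1 / real (Suc n)) * (1 - x / b) ^ Suc n)"
          by (simp add: power_mult_distrib[symmetric] mult.assoc[symmetric])
      qed
      also have "(\<Sum>n. - ((1 / real (Suc n)) * (1 - x / b) ^ Suc n))
          = - (\<Sum>n. (1 / real (Suc n)) * (1 - x / b) ^ Suc n)"
      proof (rule suminf_minus)
        have "norm (1 - x / b) < 1" using that ab b by (auto simp: field_simps abs_if)
        then have "summable (\<lambda>n. (1 - x / b) ^ Suc n)"
          by (simp add: summable_geometric)
        then show "summable (\<lambda>n. (1 / real (Suc n)) * (1 - x / b) ^ Suc n)"
        proof (rule summable_comparison_test')
          have "0 \<le> 1 - x / b" using that b by simp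
          then show "norm ((1 / real (Suc n)) * (1 - x / b) ^ Suc n) \<le> (1 - x / b) ^ Suc n" for n
            using frac_le[of "(1 - x / b) ^ Suc n" "(1 - x / b) ^ Suc n" 1 "real (Suc n)"]
            by (simp add: abs_mult)
        qed
      qed
      finally show ?thesis by simp
    qed
    ultimately have "uniform_limit {a..b} (\<lambda>N x. ln b - (\<Sum>n<N. (1 / real (Suc n)) * (1 - x / b) ^ Suc n))
        ln sequentially"
      using uniform_limit_cong'[of "{a..b}"] by (smt (verit, ccfv_SIG))
    moreover have "poly (P N) x = ln b - (\<Sum>n<N. (1 / real (Suc n)) * (1 - x / b) ^ Suc n)" for N x
      by (simp add: P_def poly_sum poly_power del: power_Suc)
    ultimately have "uniform_limit {a..b} (\<lambda>N x. poly (P N) x) ln sequentially" by simp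
    then show "uniform_limit {x. complex_of_real x \<in> op_spectrum A} (\<lambda>N. poly (P N)) ln sequentially"
      by (rule uniform_limit_on_subset) (use spectrum_subset[OF A] in auto)
  qed
  with L show ?thesis by simp
qed

section \<open>Tracial algebras\<close>

text \<open>
  A norm-closed unital \<open>*\<close>-algebra of complex-linear operators with a faithful tracial state.
\<close>

locale tracial_algebra = closed_op_algebra R
  for R :: "'h::complex_hilbert_space op set" +
  fixes \<tau> :: "'h op \<Rightarrow> complex"
  assumes clinear: "R \<subseteq> clinear_ops"
    and cscale_mem: "A \<in> R \<Longrightarrow> c \<cdot>\<^sub>C A \<in> R"
    and adj_mem: "A \<in> R \<Longrightarrow> adj A \<in> R"
    and state: "faithful_tracial_state R \<tau>"

lemma von_neumann_tracial_algebra: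
  assumes R: "von_neumann_algebra R" and t: "faithful_tracial_state R \<tau>"
  shows "tracial_algebra R \<tau>"
proof -
  have "closedin euclidean {A \<in> topspace euclidean. A \<in> R}"
    by (rule closedin_continuous_map_preimage[OF strong_operator_topology_weaker_than_euclidean])
      (use R in \<open>simp add: von_neumann_algebra_def\<close>)
  then have "closed R" by simp
  moreover have "r *\<^sub>R A \<in> R" if "A \<in> R" for r A
    using R that by (auto simp: von_neumann_algebra_def cscale_of_real[symmetric])
  ultimately show ?thesis
    using R t by (unfold_locales) (auto simp: von_neumann_algebra_def)
qed

context tracial_algebra
begin

lemma clin: "A \<in> R \<Longrightarrow> A \<in> clinear_ops" using clinear by blast

text \<open>
  The real part of the trace; it is real-linear, tracial, of norm one, and agrees with \<open>\<tau>\<close> on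
  symmetric elements (\<open>tau_sym\<close>).
\<close>

definition tr :: "'h op \<Rightarrow> real" where "tr A = Re (\<tau> A)"

lemma tau_add: "A \<in> R \<Longrightarrow> B \<in> R \<Longrightarrow> \<tau> (A + B) = \<tau> A + \<tau> B"
  and tau_cscale: "A \<in> R \<Longrightarrow> \<tau> (c \<cdot>\<^sub>C A) = c * \<tau> A"
  and tau_comm: "A \<in> R \<Longrightarrow> B \<in> R \<Longrightarrow> \<tau> (A o\<^sub>L B) = \<tau> (B o\<^sub>L A)"
  and tau_star: "A \<in> R \<Longrightarrow> \<tau> (adj A o\<^sub>L A) \<in> \<real>\<^sub>\<ge>\<^sub>0"
  and tau_star_0: "A \<in> R \<Longrightarrow> \<tau> (adj A o\<^sub>L A) = 0 \<longleftrightarrow> A = 0"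
  and tau_id: "\<tau> id_blinfun = 1"
  using state unfolding faithful_tracial_state_def by blast+

lemma tau_scaleR: "A \<in> R \<Longrightarrow> \<tau> (r *\<^sub>R A) = of_real r * \<tau> A"
  using tau_cscale[of A "of_real r"] by (simp add: cscale_of_real)

lemma tr_add: "A \<in> R \<Longrightarrow> B \<in> R \<Longrightarrow> tr (A + B) = tr A + tr B"
  and tr_scaleR: "A \<in> R \<Longrightarrow> tr (r *\<^sub>R A) = r * tr A"
  and tr_comm: "A \<in> R \<Longrightarrow> B \<in> R \<Longrightarrow> tr (A o\<^sub>L B) = tr (B o\<^sub>L A)"
  and tr_id [simp]: "tr id_blinfun = 1"
  by (simp_all add: tr_def tau_add tau_scaleR tau_comm tau_id)

lemma tr_diff: "A \<in> R \<Longrightarrow> B \<in> R \<Longrightarrow> tr (A - B) = tr A - tr B"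
  using tr_add[of A "(- 1) *\<^sub>R B"] tr_scaleR[of B "- 1"] scaleR_mem[of B "- 1"] by simp

lemma tr_zero [simp]: "tr 0 = 0"
  using tr_diff[of id_blinfun id_blinfun] by simp

lemma id_nonzero: "(id_blinfun :: 'h op) \<noteq> 0"
proof
  assume "(id_blinfun :: 'h op) = 0"
  from tr_id[unfolded this] show False by simp
qed

lemma nonzero_vector: "\<exists>v::'h. v \<noteq> 0"
proof (rule ccontr)
  assume "\<nexists>v::'h. v \<noteq> 0"
  then have "(id_blinfun :: 'h op) = 0" by (intro blinfun_eqI) auto
  with id_nonzero show False by simp
qed

lemma bounds_le: "sa_between a b (A :: 'h op) \<Longrightarrow> a \<le> b"
  using nonzero_vector sa_between_le by blast

lemma sym_adj: "A \<in> R \<Longrightarrow> sym_op A \<Longrightarrow> adj A = A"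
  using adj_sym clin by blast

lemma tau_square: "A \<in> R \<Longrightarrow> sym_op A \<Longrightarrow> \<tau> (A o\<^sub>L A) \<in> \<real>\<^sub>\<ge>\<^sub>0"
  and tau_square_0: "A \<in> R \<Longrightarrow> sym_op A \<Longrightarrow> \<tau> (A o\<^sub>L A) = 0 \<longleftrightarrow> A = 0"
  using tau_star[of A] tau_star_0[of A] sym_adj[of A] by simp_all

lemma tau_nonneg:
  assumes "A \<in> R" "sa_between 0 b A" shows "\<tau> A \<in> \<real>\<^sub>\<ge>\<^sub>0"
proof -
  obtain B where "B \<in> R" "sa_between (sqrt 0) (sqrt b) B" "(B o\<^sub>L B) = A"
    using sqrt_exists[OF assms(1) clin[OF assms(1)] assms(2)] by auto
  then show ?thesis using tau_square[of B] by (simp add: sa_between_def)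
qed

lemma tr_nonneg: "A \<in> R \<Longrightarrow> sa_between 0 b A \<Longrightarrow> 0 \<le> tr A"
  using tau_nonneg by (simp add: tr_def complex_nonneg_Reals_iff)

lemma tr_square_nonneg: "A \<in> R \<Longrightarrow> sym_op A \<Longrightarrow> 0 \<le> tr (A o\<^sub>L A)"
  using tau_square by (simp add: tr_def complex_nonneg_Reals_iff)

lemma tr_square_eq_0: "A \<in> R \<Longrightarrow> sym_op A \<Longrightarrow> tr (A o\<^sub>L A) = 0 \<longleftrightarrow> A = 0"
  using tau_square[of A] tau_square_0[of A]
  by (auto simp: tr_def complex_nonneg_Reals_iff complex_eq_iff)

lemma tau_sym:
  assumes A: "A \<in> R" "sym_op A"
  shows "\<tau> A = complex_of_real (tr A)" "\<bar>tr A\<bar> \<le> norm A"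
proof -
  define k where "k = norm A"
  have bw: "sa_between (- k) k A" using sa_between_norm[OF A(2)] by (simp add: k_def)
  have 1: "sa_between 0 (k + k) (k *\<^sub>R id_blinfun + A)"
    using sa_between_affine[OF bw, of 1 k] by simp
  have 2: "sa_between 0 (k + k) (k *\<^sub>R id_blinfun - A)"
    using sa_between_affine[OF sa_between_uminus[OF bw], of 1 k] by simp
  have R: "k *\<^sub>R id_blinfun + A \<in> R" "k *\<^sub>R id_blinfun - A \<in> R" "k *\<^sub>R (id_blinfun :: 'h op) \<in> R"
    by (intro add_mem diff_mem scaleR_mem id_mem A)+
  have "Im (\<tau> A) = 0"
    using tau_nonneg[OF R(1) 1] A R(3)
    by (simp add: tau_add tau_scaleR tau_id complex_nonneg_Reals_iff)
  then show "\<tau> A = complex_of_real (tr A)" by (simp add: tr_def complex_eq_iff)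
  have "0 \<le> k + tr A" "0 \<le> k - tr A"
    using tr_nonneg[OF R(1) 1] tr_nonneg[OF R(2) 2] A R(3)
    by (simp_all add: tr_add tr_diff tr_scaleR)
  then show "\<bar>tr A\<bar> \<le> norm A" by (simp add: k_def abs_le_iff)
qed

text \<open>Real and imaginary part: every \<open>A \<in> R\<close> is \<open>X + iY\<close> with \<open>X\<close>, \<open>Y\<close> symmetric in \<open>R\<close>.\<close>

definition re_part :: "'h op \<Rightarrow> 'h op" where
  "re_part A = (1 / 2) *\<^sub>R (A + adj A)"

definition im_part :: "'h op \<Rightarrow> 'h op" where
  "im_part A = (1 / 2) *\<^sub>R ((- \<i>) \<cdot>\<^sub>C (A - adj A))"

lemma re_im_part:
  assumes A: "A \<in> R"
  shows "re_part A \<in> R" "sym_op (re_part A)" "im_part A \<in> R" "sym_op (im_part A)"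
    "A = re_part A + \<i> \<cdot>\<^sub>C im_part A"
proof -
  show "re_part A \<in> R" "im_part A \<in> R"
    unfolding re_part_def im_part_def
    by (intro scaleR_mem add_mem cscale_mem diff_mem A adj_mem)+
  have adj: "inner x (adj A y) = inner (A x) y" "inner (adj A y) x = inner y (A x)" for x y
    using adj_inner[OF clin[OF A]] by (simp_all add: inner_commute)
  show "sym_op (re_part A)"
    by (simp add: sym_op_def re_part_def blinfun.add_left blinfun.scaleR_left inner_add adj)
  have ii: "(- \<i>) *\<^sub>C x = - (\<i> *\<^sub>C x)" for x :: 'h
    using scaleC_scaleC[of "- 1" \<i> x] by (simp add: scaleC_minus_one)
  have scaleC_diff_right: "c *\<^sub>C (x - y) = c *\<^sub>C x - c *\<^sub>C y" for c and x y :: 'h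
    using scaleC_add_right[of c "x - y" y] by simp
  have c: "A \<in> clinear_ops" "adj A \<in> clinear_ops" using A clin adj_mem by auto
  show "sym_op (im_part A)"
    unfolding sym_op_def
  proof (intro allI)
    fix x y :: 'h
    have "inner (\<i> *\<^sub>C adj A x) y = - inner x (\<i> *\<^sub>C A y)"
      by (simp add: inner_ii_shift adj clinear_ii[OF c(1), symmetric])
    moreover have "inner (\<i> *\<^sub>C A x) y = - inner x (\<i> *\<^sub>C adj A y)"
      by (simp add: inner_ii_shift adj[symmetric] clinear_ii[OF c(2), symmetric])
    ultimately show "inner (im_part A x) y = inner x (im_part A y)"
      by (simp add: im_part_def blinfun.diff_left blinfun.scaleR_left ii scaleC_add_right
          inner_diff scaleC_diff_right)
  qed
  show "A = re_part A + \<i> \<cdot>\<^sub>C im_part A"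
  proof (rule blinfun_eqI)
    fix x
    have "\<i> *\<^sub>C (1 / 2) *\<^sub>R (- \<i>) *\<^sub>C v = (1 / 2) *\<^sub>R v" for v :: 'h
      by (simp add: scaleR_scaleC scaleC_scaleC)
    then have "\<i> *\<^sub>C im_part A x = (1 / 2) *\<^sub>R (A x - adj A x)"
      by (simp add: im_part_def blinfun.scaleR_left blinfun.diff_left)
    then have "(re_part A + \<i> \<cdot>\<^sub>C im_part A) x = (1 / 2) *\<^sub>R A x + (1 / 2) *\<^sub>R A x"
      by (simp add: re_part_def blinfun.add_left blinfun.scaleR_left scaleR_add_right scaleR_diff_right)
    then show "A x = (re_part A + \<i> \<cdot>\<^sub>C im_part A) x"
      by (simp add: scaleR_add_left[symmetric])
  qed
qed

lemma abs_tr_le_norm: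
  assumes A: "A \<in> R" shows "\<bar>tr A\<bar> \<le> norm A"
proof -
  note p = re_im_part[OF A]
  have "\<tau> A = complex_of_real (tr (re_part A)) + \<i> * complex_of_real (tr (im_part A))"
    by (subst p(5)) (simp add: p(1-4) tau_add tau_cscale cscale_mem tau_sym(1))
  then have "tr A = tr (re_part A)" by (simp add: tr_def)
  moreover have "norm (re_part A) \<le> norm A"
  proof (rule norm_sym_op_le)
    fix x
    have "inner (re_part A x) x = inner (A x) x"
      using adj_inner[OF clin[OF A], of x x]
      by (simp add: re_part_def blinfun.add_left blinfun.scaleR_left inner_add inner_commute)
    then show "\<bar>inner (re_part A x) x\<bar> \<le> norm A * inner x x" using abs_inner_blinfun_le by metis
  qed (use p in auto)
  ultimately show ?thesis using tau_sym(2)[OF p(1,2)] by linarith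
qed

lemma tr_tendsto:
  assumes F: "F \<longlonglongrightarrow> L" "\<And>n. F n \<in> R"
  shows "(\<lambda>n. tr (F n)) \<longlonglongrightarrow> tr L"
proof -
  have L: "L \<in> R" using F by (rule limit_mem)
  have "(\<lambda>n. tr (F n - L)) \<longlonglongrightarrow> 0"
  proof (rule Lim_null_comparison)
    show "\<forall>\<^sub>F n in sequentially. norm (tr (F n - L)) \<le> norm (F n - L)"
      using abs_tr_le_norm diff_mem[OF F(2) L] by auto
    show "(\<lambda>n. norm (F n - L)) \<longlonglongrightarrow> 0" using F(1) by (simp add: LIM_zero tendsto_norm_zero)
  qed
  then show ?thesis using F(2) L by (simp add: tr_diff LIM_zero_iff)
qed

lemma tr_sums:
  assumes F: "F sums L" "\<And>n. F n \<in> R"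
  shows "(\<lambda>n. tr (F n)) sums tr L"
proof -
  have mem: "(\<Sum>n<N. F n) \<in> R" for N by (induction N) (auto intro: add_mem F)
  have "tr (\<Sum>n<N. F n) = (\<Sum>n<N. tr (F n))" for N
    by (induction N) (auto simp: tr_add F mem)
  then show ?thesis using tr_tendsto[OF F(1)[unfolded sums_def] mem] by (simp add: sums_def)
qed

subsection \<open>Positive invertible elements\<close>

text \<open>
  For the lower bound on a positive invertible \<open>A\<close>, write \<open>A = C\<^sup>2\<close>: then \<open>\<langle>A x, x\<rangle> = \<parallel>C x\<parallel>\<^sup>2\<close>, and
  \<open>C\<close> has the left inverse \<open>A\<^sup>-\<^sup>1 C\<close>.
\<close>

lemma GL_iff:
  "A \<in> GL_pos R \<longleftrightarrow> A \<in> R \<and> sym_op A \<and> (\<exists>a>0. \<forall>x. a * inner x x \<le> inner (A x) x)"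
proof
  assume "A \<in> GL_pos R"
  then have A: "A \<in> R" "sym_op A" "\<And>x. 0 \<le> inner (A x) x"
    and inv: "invertible_in R A" by (auto simp: GL_pos_def positive_op_iff)
  have "inner (A x) x \<le> norm A * inner x x" for x using abs_inner_blinfun_le[of A x] by simp
  with A have "sa_between 0 (norm A) A" by (simp add: sa_between_def)
  from sqrt_exists[OF A(1) clin[OF A(1)] this]
  obtain C where C: "C \<in> R" "sym_op C" "(C o\<^sub>L C) = A" by (auto simp: sa_between_def)
  obtain B where B: "B \<in> R" "(B o\<^sub>L A) = id_blinfun" using inv by (auto simp: invertible_in_def)
  define k where "k = norm (B o\<^sub>L C) + 1"
  have k: "k > 0" by (simp add: k_def add_nonneg_pos)
  have "(1 / k\<^sup>2) * inner x x \<le> inner (A x) x" for x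
  proof -
    have "((B o\<^sub>L C) o\<^sub>L C) = id_blinfun" using B(2) C(3) by (simp add: comp_simps)
    then have "x = (B o\<^sub>L C) (C x)"
      by (metis blinfun_apply_blinfun_compose blinfun_apply_id_blinfun id_apply)
    then have "norm x \<le> norm (B o\<^sub>L C) * norm (C x)" by (metis norm_blinfun)
    also have "\<dots> \<le> k * norm (C x)" by (intro mult_right_mono) (auto simp: k_def)
    finally have "(norm x)\<^sup>2 \<le> k\<^sup>2 * (norm (C x))\<^sup>2"
      using power_mono[of "norm x" "k * norm (C x)" 2] by (simp add: power_mult_distrib)
    moreover have "inner (A x) x = (norm (C x))\<^sup>2"
      using C(2) by (simp add: C(3)[symmetric] power2_norm_eq_inner sym_op_def)
    ultimately show ?thesis using k by (simp add: pos_divide_le_eq dot_square_norm mult.commute)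
  qed
  then show "A \<in> R \<and> sym_op A \<and> (\<exists>a>0. \<forall>x. a * inner x x \<le> inner (A x) x)"
    using A k by (intro conjI exI[of _ "1 / k\<^sup>2"]) auto
next
  assume "A \<in> R \<and> sym_op A \<and> (\<exists>a>0. \<forall>x. a * inner x x \<le> inner (A x) x)"
  then obtain a where A: "A \<in> R" "sym_op A" and a: "a > 0" "\<And>x. a * inner x x \<le> inner (A x) x"
    by blast
  have "inner (A x) x \<le> norm A * inner x x" for x using abs_inner_blinfun_le[of A x] by simp
  with A a have "sa_between a (norm A) A" by (simp add: sa_between_def)
  from op_inv_bounded_below[OF A(1) this a(1)] have "invertible_in R A"
    by (auto simp: invertible_in_def)
  moreover have "0 \<le> inner (A x) x" for x
    using a(2)[of x] a(1) by (meson inner_ge_zero less_imp_le mult_nonneg_nonneg order_trans)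
  ultimately show "A \<in> GL_pos R" using A clin by (auto simp: GL_pos_def positive_op_iff)
qed

lemma GL_I: "A \<in> R \<Longrightarrow> sa_between a b A \<Longrightarrow> 0 < a \<Longrightarrow> A \<in> GL_pos R"
  unfolding GL_iff sa_between_def by blast

lemma GL_mem: "A \<in> GL_pos R \<Longrightarrow> A \<in> R"
  and GL_sym: "A \<in> GL_pos R \<Longrightarrow> sym_op A"
  by (auto simp: GL_iff)

lemma GL_E:
  assumes "A \<in> GL_pos R"
  obtains a b where "0 < a" "a \<le> b" "sa_between a b A"
proof -
  obtain a where a: "a > 0" "\<And>x. a * inner x x \<le> inner (A x) x" and A: "sym_op A"
    using assms by (auto simp: GL_iff)
  have "inner (A x) x \<le> norm A * inner x x" for x using abs_inner_blinfun_le[of A x] by simp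
  with A a have s: "sa_between a (norm A) A" by (simp add: sa_between_def)
  from that[OF a(1) bounds_le[OF s] s] show ?thesis .
qed

lemma GL_inv:
  assumes A: "A \<in> GL_pos R"
  shows "op_inv A \<in> GL_pos R" "(A o\<^sub>L op_inv A) = id_blinfun" "(op_inv A o\<^sub>L A) = id_blinfun"
proof -
  obtain a b where ab: "0 < a" "sa_between a b A" using A by (rule GL_E)
  note i = op_inv_bounded_below[OF GL_mem[OF A] ab(2,1)]
  then show "(A o\<^sub>L op_inv A) = id_blinfun" "(op_inv A o\<^sub>L A) = id_blinfun" by auto
  then have Ai: "A (op_inv A x) = x" for x
    by (metis blinfun_apply_blinfun_compose blinfun_apply_id_blinfun id_apply)
  have "inner (op_inv A x) y = inner x (op_inv A y)" for x y
    using GL_sym[OF A] Ai unfolding sym_op_def by metis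
  moreover have "0 \<le> inner (op_inv A x) x" for x
  proof -
    have "0 \<le> inner (A (op_inv A x)) (op_inv A x)"
      using A by (auto simp: GL_pos_def positive_op_iff)
    then show ?thesis by (simp add: Ai inner_commute)
  qed
  moreover have "invertible_in R (op_inv A)"
    using i GL_mem[OF A] by (auto simp: invertible_in_def)
  ultimately show "op_inv A \<in> GL_pos R"
    using i clin by (auto simp: GL_pos_def positive_op_iff sym_op_def)
qed

lemma GL_inv_inv: "A \<in> GL_pos R \<Longrightarrow> op_inv (op_inv A) = A"
  by (intro op_inv_eqI GL_inv)

lemma GL_id [simp]: "id_blinfun \<in> GL_pos R"
  unfolding GL_iff by (auto intro!: exI[of _ 1])

lemma GL_scaleR: "A \<in> GL_pos R \<Longrightarrow> 0 < r \<Longrightarrow> r *\<^sub>R A \<in> GL_pos R"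
  unfolding GL_iff
proof (elim conjE exE, intro conjI)
  fix a assume a: "0 < a" "\<forall>x. a * inner x x \<le> inner (A x) x" and r: "0 < r"
  have "r * (a * inner x x) \<le> r * inner (A x) x" for x using a r by (intro mult_left_mono) auto
  then show "\<exists>a>0. \<forall>x. a * inner x x \<le> inner ((r *\<^sub>R A) x) x"
    using a r by (intro exI[of _ "r * a"]) (auto simp: blinfun.scaleR_left mult.assoc)
qed (auto intro: scaleR_mem sym_op_scaleR)

lemma GL_add: "A \<in> GL_pos R \<Longrightarrow> B \<in> GL_pos R \<Longrightarrow> A + B \<in> GL_pos R"
  unfolding GL_iff
proof (elim conjE exE, intro conjI)
  fix a b assume "0 < a" "\<forall>x. a * inner x x \<le> inner (A x) x"
    "0 < b" "\<forall>x. b * inner x x \<le> inner (B x) x"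
  then show "\<exists>a>0. \<forall>x. a * inner x x \<le> inner ((A + B) x) x"
    by (intro exI[of _ "a + b"]) (auto simp: blinfun.add_left inner_add algebra_simps add_mono)
qed (auto intro: add_mem sym_op_add)

lemma GL_sandwich:
  assumes T: "T \<in> GL_pos R" and A: "A \<in> GL_pos R"
  shows "(T o\<^sub>L (A o\<^sub>L T)) \<in> GL_pos R"
proof -
  obtain a where a: "a > 0" "\<And>x. a * inner x x \<le> inner (A x) x" using A by (auto simp: GL_iff)
  obtain t where t: "t > 0" "\<And>x. t * inner x x \<le> inner (T x) x" using T by (auto simp: GL_iff)
  have "(a * t\<^sup>2) * inner x x \<le> inner ((T o\<^sub>L (A o\<^sub>L T)) x) x" for x
  proof -
    have "t * norm x \<le> norm (T x)"
    proof (cases "x = 0")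
      case False
      have "t * (norm x)\<^sup>2 \<le> norm (T x) * norm x"
        using t(2)[of x] norm_cauchy_schwarz[of "T x" x] by (simp add: dot_square_norm)
      then show ?thesis using False by (simp add: power2_eq_square)
    qed simp
    then have "t\<^sup>2 * inner x x \<le> inner (T x) (T x)"
      using power_mono[of "t * norm x" "norm (T x)" 2] t(1)
      by (simp add: power_mult_distrib dot_square_norm)
    then have "a * (t\<^sup>2 * inner x x) \<le> a * inner (T x) (T x)" using a by (intro mult_left_mono) auto
    also have "\<dots> \<le> inner (A (T x)) (T x)" by (rule a)
    also have "\<dots> = inner ((T o\<^sub>L (A o\<^sub>L T)) x) x" using GL_sym[OF T] by (simp add: sym_op_def)
    finally show ?thesis by (simp add: mult.assoc)
  qed
  moreover have "a * t\<^sup>2 > 0" using a t by simp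
  ultimately show ?thesis unfolding GL_iff
    by (intro conjI comp_mem sym_op_sandwich GL_mem GL_sym assms) blast
qed

lemma GL_shift: "A \<in> R \<Longrightarrow> sym_op A \<Longrightarrow> norm A < c \<Longrightarrow> A + c *\<^sub>R id_blinfun \<in> GL_pos R"
  using sa_between_affine[OF sa_between_norm[of A "norm A"], of 1 c]
  by (intro GL_I[of _ "c - norm A" "c + norm A"]) (auto intro: add_mem scaleR_mem id_mem simp: add.commute)

lemma GL_sqrt:
  assumes A: "A \<in> GL_pos R"
  shows "\<exists>B\<in>GL_pos R. (B o\<^sub>L B) = A"
proof -
  obtain a b where ab: "0 < a" "sa_between a b A" using A by (rule GL_E)
  obtain B where "B \<in> R" "sa_between (sqrt a) (sqrt b) B" "(B o\<^sub>L B) = A"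
    using sqrt_exists[OF GL_mem[OF A] clin[OF GL_mem[OF A]] ab(2)] ab(1) by auto
  then show ?thesis using GL_I ab(1) by (intro bexI[of _ B]) auto
qed

text \<open>The trace form separates symmetric elements, even when tested on \<open>GL_pos R\<close> only.\<close>

lemma tr_comp_eq_0:
  assumes E: "E \<in> R" "sym_op E" and 0: "\<And>P. P \<in> GL_pos R \<Longrightarrow> tr (P o\<^sub>L E) = 0"
  shows "E = 0"
proof -
  \<comment> \<open>test with \<open>P = E + c\<close> and with \<open>P = 1\<close>, which leaves \<open>\<tau>(E\<^sup>2) = 0\<close>\<close>
  define c where "c = norm E + 1"
  have c: "E + c *\<^sub>R id_blinfun \<in> GL_pos R" using E by (intro GL_shift) (auto simp: c_def)
  have "tr (E + c *\<^sub>R id_blinfun o\<^sub>L E) = tr (E o\<^sub>L E) + c * tr (id_blinfun o\<^sub>L E)"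
    using E by (simp add: comp_simps tr_add tr_scaleR comp_mem scaleR_mem)
  with 0[OF c] 0[OF GL_id] have "tr (E o\<^sub>L E) = 0" by simp
  then show ?thesis using tr_square_eq_0 E by blast
qed

subsection \<open>The logarithm of the determinant\<close>

text \<open>
  \<open>ln \<Delta>(A)\<close> for positive invertible \<open>A\<close>; see \<open>fk_det_eq\<close>.
\<close>

definition lndet :: "'h op \<Rightarrow> real" where "lndet A = tr (cfc ln A)"

lemma lndet_series:
  assumes A: "A \<in> R" "sa_between a b A" "0 < a"
  defines "C \<equiv> id_blinfun - (1 / b) *\<^sub>R A"
  shows "(\<lambda>n. tr (opow C (Suc n)) / real (Suc n)) sums (ln b - lndet A)" "cfc ln A \<in> R"
proof -
  have C: "C \<in> R" unfolding C_def by (intro diff_mem scaleR_mem A id_mem)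
  have ab: "a \<le> b" using bounds_le[OF A(2)] .
  let ?F = "\<lambda>n. (1 / real (Suc n)) *\<^sub>R opow C (Suc n)"
  have s: "?F sums (ln b *\<^sub>R id_blinfun - cfc ln A)"
    unfolding C_def by (rule cfc_ln_series[OF clin[OF A(1)] A(2,3) ab])
  have mem: "opow C n \<in> R" for n unfolding opow_def by (rule poly_op_mem[OF C])
  have "(\<Sum>n<N. ?F n) \<in> R" for N by (induction N) (auto intro: add_mem scaleR_mem mem)
  then have "ln b *\<^sub>R id_blinfun - cfc ln A \<in> R" by (rule limit_mem[OF s[unfolded sums_def]])
  then have "ln b *\<^sub>R id_blinfun - (ln b *\<^sub>R id_blinfun - cfc ln A) \<in> R"
    by (rule diff_mem[OF scaleR_mem[OF id_mem]])
  then show R: "cfc ln A \<in> R" by simp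
  have "(\<lambda>n. tr (?F n)) sums tr (ln b *\<^sub>R id_blinfun - cfc ln A)"
    by (intro tr_sums s scaleR_mem mem)
  then show "(\<lambda>n. tr (opow C (Suc n)) / real (Suc n)) sums (ln b - lndet A)"
    using R by (simp add: tr_scaleR mem tr_diff scaleR_mem lndet_def del: of_nat_Suc)
qed

lemma lndet_scaleR_id: "0 < c \<Longrightarrow> lndet (c *\<^sub>R id_blinfun) = ln c"
proof -
  assume c: "0 < c"
  have s: "sa_between c c (c *\<^sub>R (id_blinfun :: 'h op))"
    by (simp add: sa_between_def sym_op_scaleR blinfun.scaleR_left)
  have o: "opow 0 (Suc n) = (0 :: 'h op)" for n by (simp add: opow_Suc comp_simps)
  have "(\<lambda>n. 0) sums (ln c - lndet (c *\<^sub>R id_blinfun))"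
    using lndet_series(1)[OF _ s c] c by (simp add: o scaleR_mem)
  then show ?thesis by (simp add: sums_iff)
qed

lemma lndet_id: "lndet id_blinfun = 0"
  using lndet_scaleR_id[of 1] by simp

lemma cfc_ln_sym:
  assumes A: "A \<in> GL_pos R" shows "cfc ln A \<in> R" "sym_op (cfc ln A)"
proof -
  obtain a b where ab: "0 < a" "a \<le> b" "sa_between a b A" using A by (rule GL_E)
  show "cfc ln A \<in> R" by (rule lndet_series(2)[OF GL_mem[OF A] ab(3,1)])
  define C where "C = id_blinfun - (1 / b) *\<^sub>R A"
  have C: "sym_op C" unfolding C_def by (intro sym_op_diff sym_op_scaleR GL_sym A sym_op_id)
  let ?F = "\<lambda>n. (1 / real (Suc n)) *\<^sub>R opow C (Suc n)"
  have s: "?F sums (ln b *\<^sub>R id_blinfun - cfc ln A)"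
    unfolding C_def by (rule cfc_ln_series[OF clin[OF GL_mem[OF A]] ab(3,1,2)])
  have "sym_op (\<Sum>n<N. ?F n)" for N
    by (induction N) (auto intro: sym_op_add sym_op_scaleR sym_op_poly C simp: opow_def sym_op_def[of 0])
  then have "sym_op (ln b *\<^sub>R id_blinfun - cfc ln A)" by (rule sym_op_tendsto[OF s[unfolded sums_def]])
  then have "sym_op (ln b *\<^sub>R id_blinfun - (ln b *\<^sub>R id_blinfun - cfc ln A))"
    by (rule sym_op_diff[OF sym_op_scaleR[OF sym_op_id]])
  then show "sym_op (cfc ln A)" by simp
qed

lemma fk_det_eq:
  assumes A: "A \<in> GL_pos R"
  shows "fk_det \<tau> A = complex_of_real (exp (lndet A))"
proof -
  obtain a b where ab: "0 < a" "a \<le> b" "sa_between a b A" using A by (rule GL_E)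
  have "cfc sqrt (adj A o\<^sub>L A) = A"
    using cfc_sqrt_square[OF clin[OF GL_mem[OF A]] ab(3)] ab(1) sym_adj[OF GL_mem[OF A] GL_sym[OF A]]
    by simp
  then show ?thesis
    using tau_sym(1)[OF cfc_ln_sym[OF A]] by (simp add: fk_det_def lndet_def exp_of_real)
qed

end

context tracial_algebra
begin

section \<open>Differentiating the logarithm of the determinant\<close>

lemma comp_cancel:
  fixes A B Y :: "'h op"
  shows "(A o\<^sub>L B) = id_blinfun \<Longrightarrow> (A o\<^sub>L (B o\<^sub>L Y)) = Y"
  by (simp add: comp_simps(9)[symmetric]) (simp add: comp_simps)

lemma opow_add: "(opow C m o\<^sub>L opow C n) = opow C (m + n)"
  by (simp add: opow_def power_add poly_op_mult)

lemma opow_mem: "C \<in> R \<Longrightarrow> opow C n \<in> R"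
  unfolding opow_def by (rule poly_op_mem)

lemma tr_has_derivative:
  assumes F: "(F has_vector_derivative F') (at t within S)"
    and mem: "\<And>s. s \<in> S \<Longrightarrow> F s \<in> R" "F' \<in> R" and t: "t \<in> S"
  shows "((\<lambda>s. tr (F s)) has_real_derivative tr F') (at t within S)"
proof -
  have lim: "((\<lambda>s. norm ((F s - F t) - (s - t) *\<^sub>R F') / norm (s - t)) \<longlongrightarrow> 0) (at t within S)"
    using F by (simp add: has_vector_derivative_def has_derivative_iff_norm)
  have "((\<lambda>s. norm ((tr (F s) - tr (F t)) - tr F' * (s - t)) / norm (s - t)) \<longlongrightarrow> 0) (at t within S)"
  proof (rule Lim_null_comparison[OF _ lim])
    have "\<forall>\<^sub>F s in at t within S. s \<in> S" by (simp add: eventually_at_filter)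
    then show "\<forall>\<^sub>F s in at t within S. norm (norm ((tr (F s) - tr (F t)) - tr F' * (s - t)) / norm (s - t))
        \<le> norm ((F s - F t) - (s - t) *\<^sub>R F') / norm (s - t)"
    proof eventually_elim
      case (elim s)
      have "tr ((F s - F t) - (s - t) *\<^sub>R F') = (tr (F s) - tr (F t)) - tr F' * (s - t)"
        by (simp add: tr_diff tr_scaleR diff_mem scaleR_mem mem elim t)
      moreover have "\<bar>tr ((F s - F t) - (s - t) *\<^sub>R F')\<bar> \<le> norm ((F s - F t) - (s - t) *\<^sub>R F')"
        by (intro abs_tr_le_norm diff_mem scaleR_mem mem elim t)
      ultimately show ?case by (simp add: divide_right_mono)
    qed
  qed
  then show ?thesis
    by (simp add: has_field_derivative_def has_derivative_iff_norm bounded_linear_mult_right)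
qed

text \<open>Under the trace, the noncommutative product rule collapses to the scalar power rule.\<close>

lemma opow_has_derivative:
  assumes C: "(C has_vector_derivative C') (at t within S)" and mem: "C t \<in> R" "C' \<in> R"
  shows "\<exists>E\<in>R. ((\<lambda>s. opow (C s) n) has_vector_derivative E) (at t within S) \<and>
    (\<forall>m. tr (opow (C t) m o\<^sub>L E) = real n * tr (opow (C t) (m + n - 1) o\<^sub>L C'))"
proof (induction n)
  case 0
  show ?case by (intro bexI[of _ 0]) (auto simp: comp_simps)
next
  case (Suc n)
  then obtain E where E: "E \<in> R" "((\<lambda>s. opow (C s) n) has_vector_derivative E) (at t within S)"
    "\<And>m. tr (opow (C t) m o\<^sub>L E) = real n * tr (opow (C t) (m + n - 1) o\<^sub>L C')" by blast
  define P where "P = opow (C t)"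
  have P: "P k \<in> R" for k by (simp add: P_def opow_mem mem)
  define E' where "E' = (C t o\<^sub>L E) + (C' o\<^sub>L P n)"
  have "((\<lambda>s. opow (C s) (Suc n)) has_vector_derivative E') (at t within S)"
    unfolding opow_Suc E'_def P_def
    by (rule bounded_bilinear.has_vector_derivative[OF bounded_bilinear_blinfun_compose C E(2)])
  moreover have "E' \<in> R" unfolding E'_def by (intro add_mem comp_mem mem E P)
  moreover have "tr (P m o\<^sub>L E') = real (Suc n) * tr (P (m + Suc n - 1) o\<^sub>L C')" for m
  proof -
    have "(P m o\<^sub>L E') = (P (Suc m) o\<^sub>L E) + (P m o\<^sub>L (C' o\<^sub>L P n))"
      unfolding P_def opow_Suc2 by (simp add: E'_def P_def comp_simps)
    then have "tr (P m o\<^sub>L E') = tr (P (Suc m) o\<^sub>L E) + tr ((P m o\<^sub>L C') o\<^sub>L P n)"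
      by (simp add: tr_add comp_mem P E mem comp_simps(9))
    also have "tr ((P m o\<^sub>L C') o\<^sub>L P n) = tr (P n o\<^sub>L (P m o\<^sub>L C'))"
      by (intro tr_comm comp_mem P mem)
    also have "(P n o\<^sub>L (P m o\<^sub>L C')) = (P (m + n) o\<^sub>L C')"
      by (simp add: P_def opow_add comp_simps(9)[symmetric] add.commute)
    also have "tr (P (Suc m) o\<^sub>L E) = real n * tr (P (m + n) o\<^sub>L C')"
      using E(3)[of "Suc m"] by (simp add: P_def)
    finally show ?thesis by (simp add: algebra_simps)
  qed
  ultimately show ?case unfolding P_def by blast
qed

text \<open>
  Termwise differentiation of \<open>lndet_series\<close>: with \<open>C = 1 - A/b\<close> the derived series is
  \<open>\<Sum> \<tau>(C\<^sup>n C')\<close>, a Neumann series for \<open>- \<tau>(A\<^sup>-\<^sup>1 A')\<close>.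
\<close>

lemma lndet_has_derivative:
  fixes A A' :: "real \<Rightarrow> 'h op"
  assumes A: "\<And>t. t \<in> {0..1} \<Longrightarrow> A t \<in> R" "\<And>t. t \<in> {0..1} \<Longrightarrow> sa_between a b (A t)" "0 < a"
    and A': "\<And>t. t \<in> {0..1} \<Longrightarrow> (A has_vector_derivative A' t) (at t within {0..1})"
      "\<And>t. t \<in> {0..1} \<Longrightarrow> A' t \<in> R" "bounded (A' ` {0..1})"
    and t: "t \<in> {0..1}"
  shows "((\<lambda>t. lndet (A t)) has_real_derivative tr (op_inv (A t) o\<^sub>L A' t)) (at t within {0..1})"
proof -
  let ?I = "{0..1::real}"
  have ab: "a \<le> b" using bounds_le[OF A(2)[of 0]] by simp
  then have b: "b > 0" using A(3) by simp
  define k where "k = 1 - a / b"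
  have k: "0 \<le> k" "k < 1" using ab b A(3) by (auto simp: k_def)
  obtain K where K: "\<And>t. t \<in> ?I \<Longrightarrow> norm (A' t) \<le> K"
    using A'(3) unfolding bounded_iff by blast
  define C where "C t = id_blinfun - (1 / b) *\<^sub>R A t" for t
  define C' where "C' t = - (1 / b) *\<^sub>R A' t" for t
  have C: "C t \<in> R" "norm (C t) \<le> k" "C' t \<in> R" "norm (C' t) \<le> K / b" if "t \<in> ?I" for t
    using that b A A'(2) K norm_one_minus_le[OF A(2)[OF that] A(3) ab]
    using scaleR_mem[OF A'(2)[OF that], of "- (1 / b)"]
    by (auto simp: C_def C'_def k_def divide_right_mono intro!: diff_mem scaleR_mem)
  have dC: "(C has_vector_derivative C' t) (at t within ?I)" if "t \<in> ?I" for t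
    unfolding C_def C'_def
    using has_vector_derivative_diff[OF has_vector_derivative_const
        has_vector_derivative_scaleR[OF DERIV_const A'(1)[OF that]], of "id_blinfun" "1 / b"]
    by simp
  define f where "f n t = tr (opow (C t) (Suc n)) / real (Suc n)" for n t
  define f' where "f' n t = tr (opow (C t) n o\<^sub>L C' t)" for n t
  have df: "(f n has_real_derivative f' n t) (at t within ?I)" if t: "t \<in> ?I" for n t
  proof -
    obtain E where E: "E \<in> R" "((\<lambda>s. opow (C s) (Suc n)) has_vector_derivative E) (at t within ?I)"
      "\<And>m. tr (opow (C t) m o\<^sub>L E) = real (Suc n) * tr (opow (C t) (m + Suc n - 1) o\<^sub>L C' t)"
      using opow_has_derivative[OF dC[OF t] C(1,3)[OF t], of "Suc n"] by blast
    have "((\<lambda>s. tr (opow (C s) (Suc n))) has_real_derivative tr E) (at t within ?I)"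
      by (intro tr_has_derivative E opow_mem C that)
    then have "(f n has_real_derivative tr E / real (Suc n)) (at t within ?I)"
      unfolding f_def by (rule DERIV_cdivide)
    moreover have "tr E = real (Suc n) * f' n t"
      using E(3)[of 0] by (simp add: f'_def comp_simps)
    ultimately show ?thesis by (simp del: of_nat_Suc)
  qed
  have unif: "uniform_limit ?I (\<lambda>N t. \<Sum>n<N. f' n t) (\<lambda>t. \<Sum>n. f' n t) sequentially"
  proof (rule Weierstrass_m_test)
    show "summable (\<lambda>n. k ^ n * (K / b))" using k by (intro summable_mult2 summable_geometric) simp
    fix n t assume t: "t \<in> ?I"
    have "norm (f' n t) \<le> norm (opow (C t) n o\<^sub>L C' t)"
      using abs_tr_le_norm[of "opow (C t) n o\<^sub>L C' t"] C[OF t] by (simp add: f'_def comp_mem opow_mem)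
    also have "\<dots> \<le> norm (opow (C t) n) * norm (C' t)" by (rule norm_blinfun_compose)
    also have "\<dots> \<le> norm (C t) ^ n * norm (C' t)" by (intro mult_right_mono norm_opow_le) simp
    also have "\<dots> \<le> k ^ n * (K / b)"
      using C[OF t] k by (intro mult_mono power_mono) auto
    finally show "norm (f' n t) \<le> k ^ n * (K / b)" .
  qed
  have f_sums: "(\<lambda>n. f n t) sums (ln b - lndet (A t))" if "t \<in> ?I" for t
    using lndet_series(1)[OF A(1,2)[OF that] A(3)] by (simp add: f_def C_def)
  have f'_sums: "(\<Sum>n. f' n t) = - tr (op_inv (A t) o\<^sub>L A' t)" if "t \<in> ?I" for t
  proof -
    define B where "B = (\<Sum>n. opow (C t) n)"
    have nC: "norm (C t) < 1" using C[OF that] k by simp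
    have A_eq: "A t = b *\<^sub>R (id_blinfun - C t)" using b by (simp add: C_def algebra_simps)
    have inv: "op_inv (A t) = (1 / b) *\<^sub>R B"
      using neumann[OF nC] b unfolding B_def[symmetric]
      by (intro op_inv_eqI) (simp_all add: A_eq comp_simps(5,6))
    have "(\<lambda>n. opow (C t) n) sums B"
      using summable_sums[OF summable_opow[OF nC]] by (simp add: B_def)
    then have "(\<lambda>n. opow (C t) n o\<^sub>L C' t) sums (B o\<^sub>L C' t)"
      by (rule bounded_linear.sums[OF bounded_bilinear.bounded_linear_left[OF bounded_bilinear_blinfun_compose]])
    then have "(\<lambda>n. f' n t) sums tr (B o\<^sub>L C' t)"
      unfolding f'_def using C[OF that] by (intro tr_sums comp_mem opow_mem)
    moreover have "(B o\<^sub>L C' t) = (- 1) *\<^sub>R (op_inv (A t) o\<^sub>L A' t)"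
      by (simp add: inv C'_def comp_simps)
    moreover have "op_inv (A t) \<in> R"
      using GL_mem[OF GL_inv(1)[OF GL_I]] A that by blast
    ultimately show ?thesis using A'(2)[OF that] tr_scaleR[OF comp_mem, of "op_inv (A t)" "A' t" "- 1"]
      by (simp add: sums_iff)
  qed
  obtain g where g: "\<And>t. t \<in> ?I \<Longrightarrow> (\<lambda>n. f n t) sums g t"
    "\<And>t. t \<in> ?I \<Longrightarrow> (g has_real_derivative (\<Sum>n. f' n t)) (at t within ?I)"
    using has_field_derivative_series[OF _ df unif, of 0] f_sums[of 0] by (auto simp: sums_iff)
  have eq: "lndet (A t) = ln b - g t" if "t \<in> ?I" for t
    using sums_unique2[OF g(1)[OF that] f_sums[OF that]] by simp
  have "((\<lambda>t. ln b - g t) has_real_derivative 0 - (\<Sum>n. f' n t)) (at t within ?I)"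
    by (intro derivative_intros g t)
  then have "((\<lambda>t. ln b - g t) has_real_derivative tr (op_inv (A t) o\<^sub>L A' t)) (at t within ?I)"
    by (simp add: f'_sums[OF t])
  then show ?thesis
    by (rule has_field_derivative_transform_within[OF _ zero_less_one t]) (simp add: eq)
qed

section \<open>Multiplicativity\<close>

text \<open>
  Along \<open>Q\<^sub>t = (1 - t) + tT\<close> both \<open>lndet (Q\<^sub>t X Q\<^sub>t)\<close> and \<open>2 lndet Q\<^sub>t\<close> have the derivative
  \<open>2 \<tau>(Q\<^sub>t\<^sup>-\<^sup>1 (T - 1))\<close>, so their difference at \<open>t = 0\<close> and at \<open>t = 1\<close> is the same.
\<close>

lemma lndet_sandwich:
  assumes T: "T \<in> GL_pos R" and X: "X \<in> GL_pos R"
  shows "lndet (T o\<^sub>L (X o\<^sub>L T)) = 2 * lndet T + lndet X"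
proof -
  let ?I = "{0..1::real}"
  define Q where "Q t = id_blinfun + t *\<^sub>R (T - id_blinfun)" for t
  define E where "E = T - id_blinfun"
  define A where "A t = (Q t o\<^sub>L (X o\<^sub>L Q t))" for t
  define A' where "A' t = (Q t o\<^sub>L (X o\<^sub>L E)) + (E o\<^sub>L (X o\<^sub>L Q t))" for t
  have E: "E \<in> R" unfolding E_def by (intro diff_mem id_mem GL_mem T)
  obtain c d where cd: "0 < c" "c \<le> d" "sa_between c d T" using T by (rule GL_E)
  obtain x y where xy: "0 < x" "x \<le> y" "sa_between x y X" using X by (rule GL_E)
  define m M where "m = min 1 c" and "M = max 1 d"
  have mM: "0 < m" "m \<le> M" "0 < M" using cd by (auto simp: m_def M_def)
  have Q: "Q t \<in> R" for t
    unfolding Q_def by (intro add_mem scaleR_mem diff_mem id_mem GL_mem T)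
  have Qb: "sa_between m M (Q t)" if "t \<in> ?I" for t
  proof -
    have "sa_between ((1 - t) + t * c) ((1 - t) + t * d) ((1 - t) *\<^sub>R id_blinfun + t *\<^sub>R T)"
      using that by (intro sa_between_affine cd) auto
    moreover have "(1 - t) * m + t * m \<le> (1 - t) * 1 + t * c"
      using that by (intro add_mono mult_left_mono) (auto simp: m_def)
    moreover have "(1 - t) * 1 + t * d \<le> (1 - t) * M + t * M"
      using that by (intro add_mono mult_left_mono) (auto simp: M_def)
    ultimately show ?thesis
      by (simp add: Q_def algebra_simps) (erule sa_between_mono; simp add: algebra_simps)
  qed
  have QGL: "Q t \<in> GL_pos R" if "t \<in> ?I" for t by (rule GL_I[OF Q Qb[OF that] mM(1)])
  have dQ: "(Q has_vector_derivative E) (at t within ?I)" for t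
    unfolding Q_def E_def by (auto intro!: derivative_eq_intros)
  have dA: "(A has_vector_derivative A' t) (at t within ?I)" for t
    unfolding A_def A'_def
    by (intro bounded_bilinear.has_vector_derivative[OF bounded_bilinear_blinfun_compose] dQ
        bounded_linear.has_vector_derivative[OF bounded_bilinear.bounded_linear_right[OF bounded_bilinear_blinfun_compose]])
  have contQ: "continuous_on ?I Q" unfolding Q_def by (intro continuous_intros)
  have "continuous_on ?I A'" unfolding A'_def
    by (intro continuous_intros bounded_bilinear.continuous_on[OF bounded_bilinear_blinfun_compose] contQ)
  then have bA': "bounded (A' ` ?I)" by (intro compact_imp_bounded compact_continuous_image) auto
  have A'R: "A' t \<in> R" for t unfolding A'_def by (intro add_mem comp_mem Q E GL_mem X)
  have AR: "A t \<in> R" for t unfolding A_def by (intro comp_mem Q GL_mem X)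
  have Ab: "sa_between (x * m\<^sup>2) (y * M\<^sup>2) (A t)" if t: "t \<in> ?I" for t
    unfolding sa_between_def
  proof (intro conjI allI)
    have sQ: "sym_op (Q t)" using Qb[OF t] by (simp add: sa_between_def)
    show "sym_op (A t)" unfolding A_def by (intro sym_op_sandwich sQ GL_sym X)
    fix v
    have A_eq: "inner (A t v) v = inner (X (Q t v)) (Q t v)"
      using sQ by (simp add: A_def sym_op_def)
    have "m * (norm v)\<^sup>2 \<le> norm (Q t v) * norm v"
      using Qb[OF t] norm_cauchy_schwarz[of "Q t v" v]
      by (auto simp: sa_between_def dot_square_norm intro: order_trans)
    then have "m * norm v \<le> norm (Q t v)"
      by (cases "v = 0") (auto simp: power2_eq_square)
    then have low: "m\<^sup>2 * inner v v \<le> inner (Q t v) (Q t v)"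
      using power_mono[of "m * norm v" "norm (Q t v)" 2] mM(1)
      by (simp add: power_mult_distrib dot_square_norm)
    have "norm (Q t) \<le> M"
    proof (rule norm_sym_op_le)
      fix w :: 'h
      have "m * inner w w \<le> inner (Q t w) w" "inner (Q t w) w \<le> M * inner w w"
        using Qb[OF t] by (auto simp: sa_between_def)
      moreover have "0 \<le> m * inner w w" using mM by simp
      ultimately show "\<bar>inner (Q t w) w\<bar> \<le> M * inner w w" by linarith
    qed (use sQ mM in auto)
    then have "norm (Q t v) \<le> M * norm v"
      by (meson mult_right_mono norm_blinfun norm_ge_zero order_trans)
    then have up: "inner (Q t v) (Q t v) \<le> M\<^sup>2 * inner v v"
      using power_mono[of "norm (Q t v)" "M * norm v" 2]
      by (simp add: power_mult_distrib dot_square_norm)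
    have "x * (m\<^sup>2 * inner v v) \<le> x * inner (Q t v) (Q t v)"
      using low xy by (intro mult_left_mono) auto
    also have "\<dots> \<le> inner (A t v) v" using xy(3) by (simp add: sa_between_def A_eq)
    finally show "x * m\<^sup>2 * inner v v \<le> inner (A t v) v" by (simp add: mult.assoc)
    have "inner (A t v) v \<le> y * inner (Q t v) (Q t v)" using xy(3) by (simp add: sa_between_def A_eq)
    also have "\<dots> \<le> y * (M\<^sup>2 * inner v v)" using up xy by (intro mult_left_mono) auto
    finally show "inner (A t v) v \<le> y * M\<^sup>2 * inner v v" by (simp add: mult.assoc)
  qed
  have zero: "((\<lambda>t. lndet (A t) - 2 * lndet (Q t)) has_real_derivative 0) (at t within ?I)"
    if t: "t \<in> ?I" for t
  proof -
    have 1: "((\<lambda>t. lndet (A t)) has_real_derivative tr (op_inv (A t) o\<^sub>L A' t)) (at t within ?I)"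
      by (rule lndet_has_derivative[OF AR Ab _ dA A'R bA' t]) (use xy mM in auto)
    have 2: "((\<lambda>t. lndet (Q t)) has_real_derivative tr (op_inv (Q t) o\<^sub>L E)) (at t within ?I)"
      by (rule lndet_has_derivative[OF Q Qb mM(1) dQ E _ t]) (auto simp: image_constant_conv)
    define Qi Xi where "Qi = op_inv (Q t)" and "Xi = op_inv X"
    have Qi: "Qi \<in> R" "(Q t o\<^sub>L Qi) = id_blinfun" "(Qi o\<^sub>L Q t) = id_blinfun"
      using GL_inv[OF QGL[OF t]] GL_mem by (auto simp: Qi_def)
    have Xi: "Xi \<in> R" "(X o\<^sub>L Xi) = id_blinfun" "(Xi o\<^sub>L X) = id_blinfun"
      using GL_inv[OF X] GL_mem by (auto simp: Xi_def)
    note mem = Qi(1) Xi(1) Q E GL_mem[OF X] and cancel = Qi(2,3)[THEN comp_cancel] Xi(2,3)[THEN comp_cancel]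
    have Ai: "op_inv (A t) = (Qi o\<^sub>L (Xi o\<^sub>L Qi))"
      by (rule op_inv_eqI) (simp_all add: A_def comp_simps(9) cancel Qi Xi)
    have "tr (op_inv (A t) o\<^sub>L A' t)
        = tr (Qi o\<^sub>L E) + tr ((Qi o\<^sub>L (Xi o\<^sub>L (Qi o\<^sub>L (E o\<^sub>L X)))) o\<^sub>L Q t)"
      unfolding Ai A'_def comp_simps(2)
      by (subst tr_add) (auto intro!: comp_mem mem simp: comp_simps(9) cancel)
    also have "tr ((Qi o\<^sub>L (Xi o\<^sub>L (Qi o\<^sub>L (E o\<^sub>L X)))) o\<^sub>L Q t)
        = tr (Q t o\<^sub>L (Qi o\<^sub>L (Xi o\<^sub>L (Qi o\<^sub>L (E o\<^sub>L X)))))"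
      by (intro tr_comm comp_mem mem)
    also have "\<dots> = tr (Xi o\<^sub>L (Qi o\<^sub>L (E o\<^sub>L X)))" by (simp add: cancel)
    also have "\<dots> = tr ((Qi o\<^sub>L (E o\<^sub>L X)) o\<^sub>L Xi)" by (intro tr_comm comp_mem mem)
    also have "\<dots> = tr (Qi o\<^sub>L E)" by (simp add: comp_simps Xi)
    finally have "tr (op_inv (A t) o\<^sub>L A' t) = 2 * tr (Qi o\<^sub>L E)" by simp
    then show ?thesis using DERIV_diff[OF 1 DERIV_cmult[OF 2, of 2]] by (simp add: Qi_def)
  qed
  obtain k where "\<And>t. t \<in> ?I \<Longrightarrow> lndet (A t) - 2 * lndet (Q t) = k"
    using has_field_derivative_zero_constant[OF _ zero] by auto
  from this[of 0] this[of 1] have "lndet (A 0) - 2 * lndet (Q 0) = lndet (A 1) - 2 * lndet (Q 1)" by simp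
  then show ?thesis by (simp add: A_def Q_def lndet_id comp_simps)
qed

lemma lndet_scaleR:
  assumes A: "A \<in> GL_pos R" and c: "0 < c"
  shows "lndet (c *\<^sub>R A) = ln c + lndet A"
proof -
  have "lndet (sqrt c *\<^sub>R id_blinfun o\<^sub>L (A o\<^sub>L sqrt c *\<^sub>R id_blinfun)) = 2 * ln (sqrt c) + lndet A"
    using c by (simp add: lndet_sandwich[OF GL_scaleR A] lndet_scaleR_id)
  moreover have "(sqrt c *\<^sub>R id_blinfun o\<^sub>L (A o\<^sub>L sqrt c *\<^sub>R id_blinfun)) = c *\<^sub>R A"
    using c by (simp add: comp_simps)
  ultimately show ?thesis using c by (simp add: ln_sqrt)
qed

text \<open>The first variation of \<open>ln \<Delta>\<close> at \<open>A\<close> in direction \<open>B\<close> is \<open>\<tau>(A\<^sup>-\<^sup>1 B)\<close>.\<close>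

lemma lndet_variation:
  assumes A: "A \<in> GL_pos R" and B: "B \<in> GL_pos R"
  shows "((\<lambda>t. lndet (A + t *\<^sub>R B)) has_real_derivative tr (op_inv A o\<^sub>L B)) (at 0 within {0..1})"
proof -
  obtain a b where ab: "0 < a" "a \<le> b" "sa_between a b A" using A by (rule GL_E)
  obtain c d where cd: "0 < c" "c \<le> d" "sa_between c d B" using B by (rule GL_E)
  have "((\<lambda>t. lndet (A + t *\<^sub>R B)) has_real_derivative tr (op_inv (A + 0 *\<^sub>R B) o\<^sub>L B)) (at 0 within {0..1})"
  proof (rule lndet_has_derivative[where a = a and b = "b + d"])
    show "A + t *\<^sub>R B \<in> R" for t by (intro add_mem scaleR_mem GL_mem A B)
    show "sa_between a (b + d) (A + t *\<^sub>R B)" if t: "t \<in> {0..1}" for t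
      unfolding sa_between_def
    proof (intro conjI allI)
      show "sym_op (A + t *\<^sub>R B)" by (intro sym_op_add sym_op_scaleR GL_sym A B)
      fix v
      have 1: "a * inner v v \<le> inner (A v) v" "inner (A v) v \<le> b * inner v v"
        using ab by (auto simp: sa_between_def)
      have "c * inner v v \<le> inner (B v) v" and 2: "inner (B v) v \<le> d * inner v v"
        using cd by (auto simp: sa_between_def)
      moreover have "0 \<le> c * inner v v" using cd by simp
      ultimately have 3: "0 \<le> inner (B v) v" by linarith
      have "0 \<le> t * inner (B v) v" "t * inner (B v) v \<le> 1 * inner (B v) v"
        using 3 t by (auto intro: mult_left_le_one_le)
      with 1 2 show "a * inner v v \<le> inner ((A + t *\<^sub>R B) v) v"
        "inner ((A + t *\<^sub>R B) v) v \<le> (b + d) * inner v v"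
        by (auto simp: blinfun.add_left blinfun.scaleR_left inner_add distrib_right)
    qed
    show "((\<lambda>t. A + t *\<^sub>R B) has_vector_derivative B) (at t within {0..1})" for t
      by (auto intro!: derivative_eq_intros)
  qed (use ab B GL_mem in \<open>auto simp: image_constant_conv\<close>)
  then show ?thesis by simp
qed

end

section \<open>Equality in the Jensen and Minkowski inequalities\<close>

lemma ln_le_quadratic:
  fixes x b :: real
  assumes "0 < x" "x \<le> b"
  shows "ln x \<le> x - 1 - (x - 1)\<^sup>2 / (sqrt b + 1)\<^sup>2"
proof -
  define s where "s = sqrt x"
  have s: "0 < s" "x = s\<^sup>2" "s \<le> sqrt b" using assms by (auto simp: s_def)
  \<comment> \<open>\<open>ln x \<le> x - 1\<close> applied to \<open>\<surd>x\<close> leaves the square \<open>(\<surd>x - 1)\<^sup>2\<close> to spare\<close>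
  have "ln x = 2 * ln s" using s by (simp add: ln_realpow)
  also have "\<dots> \<le> 2 * (s - 1)" using ln_le_minus_one[OF s(1)] by simp
  also have "\<dots> = x - 1 - (s - 1)\<^sup>2" by (simp add: s power2_eq_square algebra_simps)
  finally have "ln x \<le> x - 1 - (s - 1)\<^sup>2" .
  moreover have "(x - 1)\<^sup>2 / (sqrt b + 1)\<^sup>2 \<le> (s - 1)\<^sup>2"
  proof -
    have "(x - 1)\<^sup>2 = (s - 1)\<^sup>2 * (s + 1)\<^sup>2"
      by (simp add: s power2_eq_square algebra_simps)
    also have "\<dots> \<le> (s - 1)\<^sup>2 * (sqrt b + 1)\<^sup>2"
      using s by (intro mult_left_mono power_mono) auto
    finally show ?thesis using s by (simp add: pos_divide_le_eq add_pos_nonneg)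
  qed
  ultimately show ?thesis by simp
qed

context tracial_algebra
begin

lemma tr_GL_pos: "V \<in> GL_pos R \<Longrightarrow> 0 < tr V"
proof -
  assume V: "V \<in> GL_pos R"
  obtain a b where ab: "0 < a" "sa_between a b V" using V by (rule GL_E)
  have "sa_between 0 (b - a) (V - a *\<^sub>R id_blinfun)"
    using sa_between_affine[OF ab(2), of 1 "- a"] by (simp add: algebra_simps)
  from tr_nonneg[OF _ this] GL_mem[OF V] ab(1) show ?thesis
    by (simp add: tr_diff tr_scaleR diff_mem scaleR_mem)
qed

text \<open>
  The scalar inequality \<open>ln x \<le> x - 1 - c (x - 1)\<^sup>2\<close>, transferred to \<open>V\<close> by functional calculus; the
  constant \<open>c\<close> depends on an upper bound of \<open>V\<close>.
\<close>

lemma lndet_le_quadratic: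
  assumes V: "V \<in> GL_pos R"
  shows "\<exists>c>0. lndet V \<le> tr V - 1 - c * tr ((V - id_blinfun) o\<^sub>L (V - id_blinfun))"
proof -
  obtain a b where ab: "0 < a" "a \<le> b" "sa_between a b V" using V by (rule GL_E)
  have VR: "V \<in> R" "V \<in> clinear_ops" using V GL_mem clin by auto
  define c where "c = 1 / (sqrt b + 1)\<^sup>2"
  have "sqrt b + 1 > 0" using ab by (intro add_nonneg_pos) auto
  then have c: "c > 0" by (simp add: c_def)
  have cont: "continuous_on {a..b} ln" using ab by (intro continuous_intros) auto
  obtain p where p: "uniform_limit {a..b} (\<lambda>n x. poly (p n) x) ln sequentially"
    using weierstrass_poly[OF cont] by blast
  obtain L where L: "(\<lambda>n. poly_op (p n) V) \<longlonglongrightarrow> L"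
    using poly_op_convergent[OF VR(2) ab(3) p] by (auto simp: convergent_def)
  have L_eq: "cfc ln V = L"
  proof (rule cfc_eqI[OF GL_sym[OF V] _ L])
    show "uniform_limit {x. complex_of_real x \<in> op_spectrum V} (\<lambda>n. poly (p n)) ln sequentially"
      by (rule uniform_limit_on_subset[OF p]) (use spectrum_subset[OF VR(2) ab(3)] in auto)
  qed
  define g where "g = [:- 1, 1:] - smult c ([:- 1, 1:] * [:- 1, 1:])"
  define G where "G = (V - id_blinfun) - c *\<^sub>R ((V - id_blinfun) o\<^sub>L (V - id_blinfun))"
  have g: "poly g x = (x - 1) - c * (x - 1)\<^sup>2" for x
    by (simp add: g_def power2_eq_square algebra_simps)
  have "poly_op [:- 1, 1:] V = V - id_blinfun" by (simp add: poly_op_linear)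
  then have G: "poly_op g V = G"
    unfolding g_def G_def poly_op_diff poly_op_smult poly_op_mult by simp
  have "uniform_limit {a..b} (\<lambda>n x. poly g x - poly (p n) x) (\<lambda>x. poly g x - ln x) sequentially"
    by (intro uniform_limit_minus uniform_limit_const p)
  then have lim: "uniform_limit {a..b} (\<lambda>n x. poly (g - p n) x) (\<lambda>x. poly g x - ln x) sequentially"
    by simp
  have "(\<lambda>n. poly_op (g - p n) V) \<longlonglongrightarrow> G - L"
    unfolding poly_op_diff G by (intro tendsto_intros L)
  then have "sa_between 0 (b - ln a) (G - L)"
  proof (rule sa_between_poly_op_limit[OF VR(2) ab(3) lim])
    fix x assume x: "a \<le> x" "x \<le> b"
    have "ln a \<le> ln x" using x ab by simp
    moreover have "0 \<le> c * (x - 1)\<^sup>2" using c by simp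
    moreover have q: "ln x \<le> x - 1 - c * (x - 1)\<^sup>2"
      using ln_le_quadratic[of x b] x ab by (simp add: c_def)
    ultimately show "0 \<le> poly g x - ln x \<and> poly g x - ln x \<le> b - ln a"
      using q x unfolding g by linarith
  qed
  moreover have WR: "V - id_blinfun \<in> R" by (intro diff_mem id_mem VR)
  moreover have GR: "G \<in> R" unfolding G_def by (intro diff_mem scaleR_mem comp_mem id_mem VR)
  moreover have LR: "L \<in> R" using cfc_ln_sym(1)[OF V] by (simp add: L_eq)
  ultimately have "0 \<le> tr G - lndet V"
    using tr_nonneg[of "G - L"] by (simp add: diff_mem tr_diff lndet_def L_eq)
  also have "tr G = tr V - 1 - c * tr ((V - id_blinfun) o\<^sub>L (V - id_blinfun))"
    unfolding G_def using WR VR by (simp add: tr_diff tr_scaleR comp_mem scaleR_mem)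
  finally show ?thesis using c by (intro exI[of _ c]) auto
qed

text \<open>Jensen's inequality \<open>\<Delta>(V) \<le> \<tau>(V)\<close>; equality forces \<open>V\<close> to be scalar.\<close>

lemma lndet_jensen:
  assumes V: "V \<in> GL_pos R"
  shows "lndet V \<le> ln (tr V)" "ln (tr V) \<le> lndet V \<Longrightarrow> V = tr V *\<^sub>R id_blinfun"
proof -
  define m where "m = tr V"
  have m: "0 < m" unfolding m_def by (rule tr_GL_pos[OF V])
  define W where "W = (1 / m) *\<^sub>R V"
  have W: "W \<in> GL_pos R" using m unfolding W_def by (intro GL_scaleR V) simp
  define N where "N = W - id_blinfun"
  have N: "N \<in> R" "sym_op N"
    unfolding N_def by (intro diff_mem sym_op_diff GL_mem[OF W] GL_sym[OF W] id_mem sym_op_id)+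
  obtain c where c: "c > 0" "lndet W \<le> tr W - 1 - c * tr (N o\<^sub>L N)"
    using lndet_le_quadratic[OF W] unfolding N_def by blast
  have "tr W = 1" using m GL_mem[OF V] by (simp add: W_def tr_scaleR m_def)
  moreover have "lndet W = lndet V - ln m"
    using m unfolding W_def by (subst lndet_scaleR[OF V]) (auto simp: ln_div)
  ultimately have le: "lndet V \<le> ln m - c * tr (N o\<^sub>L N)" using c(2) by simp
  have nn: "0 \<le> tr (N o\<^sub>L N)" by (rule tr_square_nonneg[OF N])
  then have "0 \<le> c * tr (N o\<^sub>L N)" using c by simp
  with le show "lndet V \<le> ln (tr V)" by (simp add: m_def)
  assume "ln (tr V) \<le> lndet V"
  with le have "c * tr (N o\<^sub>L N) \<le> 0" by (simp add: m_def)
  with nn c(1) have "tr (N o\<^sub>L N) = 0" by (simp add: mult_le_0_iff)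
  then have "N = 0" using tr_square_eq_0[OF N] by simp
  then have "m *\<^sub>R W = m *\<^sub>R id_blinfun" by (simp add: N_def)
  then show "V = tr V *\<^sub>R id_blinfun" using m by (simp add: W_def m_def)
qed

text \<open>
  Equality in Minkowski's inequality \<open>\<Delta>(X + Y) \<ge> \<Delta>(X) + \<Delta>(Y)\<close>. After conjugating by
  \<open>(X + Y)\<^sup>-\<^sup>1\<^sup>/\<^sup>2\<close> one has \<open>U + V = 1\<close> and \<open>\<Delta>(U) + \<Delta>(V) = 1 = \<tau>(U) + \<tau>(V)\<close>, so
  both Jensen inequalities are equalities.
\<close>

lemma minkowski_equality:
  assumes X: "X \<in> GL_pos R" and Y: "Y \<in> GL_pos R"
    and eq: "exp (lndet (X + Y)) = exp (lndet X) + exp (lndet Y)"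
  shows "X = (exp (lndet X) / exp (lndet (X + Y))) *\<^sub>R (X + Y)"
proof -
  have S: "X + Y \<in> GL_pos R" using X Y by (rule GL_add)
  obtain Q where Q: "Q \<in> GL_pos R" "(Q o\<^sub>L Q) = X + Y" using GL_sqrt[OF S] by blast
  define W where "W = op_inv Q"
  have W: "W \<in> GL_pos R" "(Q o\<^sub>L W) = id_blinfun" "(W o\<^sub>L Q) = id_blinfun"
    using GL_inv[OF Q(1)] by (auto simp: W_def)
  define U V where "U = (W o\<^sub>L (X o\<^sub>L W))" and "V = (W o\<^sub>L (Y o\<^sub>L W))"
  have U: "U \<in> GL_pos R" and V: "V \<in> GL_pos R"
    unfolding U_def V_def by (intro GL_sandwich W X Y)+
  have "(W o\<^sub>L ((X + Y) o\<^sub>L W)) = id_blinfun"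
    unfolding Q(2)[symmetric] by (simp add: comp_simps(9) W comp_cancel comp_simps(10))
  then have UV: "U + V = id_blinfun" by (simp add: U_def V_def comp_simps)
  have "lndet (W o\<^sub>L ((X + Y) o\<^sub>L W)) = 2 * lndet W + lndet (X + Y)" by (rule lndet_sandwich[OF W(1) S])
  then have LW: "2 * lndet W = - lndet (X + Y)"
    using \<open>(W o\<^sub>L ((X + Y) o\<^sub>L W)) = id_blinfun\<close> lndet_id by simp
  have LU: "lndet U = lndet X - lndet (X + Y)" and LV: "lndet V = lndet Y - lndet (X + Y)"
    unfolding U_def V_def using LW by (simp_all add: lndet_sandwich W X Y)
  have sum1: "exp (lndet U) + exp (lndet V) = 1"
    unfolding LU LV exp_diff add_divide_distrib[symmetric] eq[symmetric] by simp
  have "tr U + tr V = 1" using tr_add[OF GL_mem[OF U] GL_mem[OF V]] by (simp add: UV)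
  moreover have "exp (lndet U) \<le> tr U" "exp (lndet V) \<le> tr V"
    using lndet_jensen(1)[OF U] lndet_jensen(1)[OF V] tr_GL_pos[OF U] tr_GL_pos[OF V]
    by (simp_all add: ln_ge_iff)
  ultimately have tU: "tr U = exp (lndet U)" using sum1 by linarith
  then have "U = tr U *\<^sub>R id_blinfun" by (intro lndet_jensen(2)[OF U]) simp
  then have "(Q o\<^sub>L (U o\<^sub>L Q)) = tr U *\<^sub>R (X + Y)"
    using Q(2) by (metis comp_simps(5,6,11))
  moreover have "(Q o\<^sub>L (U o\<^sub>L Q)) = X"
    by (simp add: U_def comp_simps(9) comp_cancel W comp_simps(10))
  ultimately show ?thesis by (simp add: tU LU exp_diff)
qed

end

section \<open>From the determinant identity to an additive map\<close>

context tracial_algebra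
begin

lemma lndet_map:
  assumes map: "\<And>A. A \<in> GL_pos R \<Longrightarrow> \<phi> A \<in> GL_pos R"
    and H: "\<And>A B. A \<in> GL_pos R \<Longrightarrow> B \<in> GL_pos R \<Longrightarrow> lndet (\<phi> A + \<phi> B) = d + lndet (A + B)"
    and A: "A \<in> GL_pos R"
  shows "lndet (\<phi> A) = d + lndet A"
proof -
  have "lndet (2 *\<^sub>R \<phi> A) = d + lndet (2 *\<^sub>R A)" using H[OF A A] by (simp add: scaleR_2)
  then show ?thesis using A map by (simp add: lndet_scaleR)
qed

text \<open>Since \<open>\<Delta>(\<phi>(tA) + \<phi>(A)) = \<Delta>(\<phi>(tA)) + \<Delta>(\<phi>(A))\<close>, the equality case of Minkowski's
  inequality makes \<open>\<phi>(tA)\<close> proportional to \<open>\<phi>(A)\<close>.\<close>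

lemma map_homogeneous:
  assumes map: "\<And>A. A \<in> GL_pos R \<Longrightarrow> \<phi> A \<in> GL_pos R"
    and H: "\<And>A B. A \<in> GL_pos R \<Longrightarrow> B \<in> GL_pos R \<Longrightarrow> lndet (\<phi> A + \<phi> B) = d + lndet (A + B)"
    and A: "A \<in> GL_pos R" and t: "0 < t"
  shows "\<phi> (t *\<^sub>R A) = t *\<^sub>R \<phi> A"
proof -
  define X Y where "X = \<phi> (t *\<^sub>R A)" and "Y = \<phi> A"
  have tA: "t *\<^sub>R A \<in> GL_pos R" using A t by (rule GL_scaleR)
  have XY: "X \<in> GL_pos R" "Y \<in> GL_pos R" using map A tA by (auto simp: X_def Y_def)
  have X: "exp (lndet X) = t * exp (d + lndet A)"
    using lndet_map[OF map H tA] A t by (simp add: X_def lndet_scaleR exp_add algebra_simps)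
  have Y: "exp (lndet Y) = exp (d + lndet A)"
    using lndet_map[OF map H A] by (simp add: Y_def)
  have "lndet (X + Y) = d + lndet ((t + 1) *\<^sub>R A)"
    using H[OF tA A] by (simp add: X_def Y_def scaleR_add_left)
  then have S: "exp (lndet (X + Y)) = (t + 1) * exp (d + lndet A)"
    using A t by (simp add: lndet_scaleR exp_add mult_ac)
  have "X = (exp (lndet X) / exp (lndet (X + Y))) *\<^sub>R (X + Y)"
    by (rule minkowski_equality[OF XY]) (simp add: S X Y algebra_simps)
  also have "exp (lndet X) / exp (lndet (X + Y)) = t / (t + 1)" unfolding X S by simp
  finally have "(t + 1) *\<^sub>R X = (t + 1) *\<^sub>R (t / (t + 1)) *\<^sub>R (X + Y)" by simp
  then have "(t + 1) *\<^sub>R X = t *\<^sub>R (X + Y)" using t by simp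
  then show ?thesis by (simp add: X_def Y_def algebra_simps)
qed

text \<open>
  The first variations of \<open>ln \<Delta>(\<phi>(A) + t \<phi>(B))\<close> and \<open>ln \<Delta>(A + tB)\<close> at \<open>t = 0\<close> agree.
\<close>

lemma map_trace_form:
  assumes map: "\<And>A. A \<in> GL_pos R \<Longrightarrow> \<phi> A \<in> GL_pos R"
    and H: "\<And>A B. A \<in> GL_pos R \<Longrightarrow> B \<in> GL_pos R \<Longrightarrow> lndet (\<phi> A + \<phi> B) = d + lndet (A + B)"
    and A: "A \<in> GL_pos R" and B: "B \<in> GL_pos R"
  shows "tr (op_inv (\<phi> A) o\<^sub>L \<phi> B) = tr (op_inv A o\<^sub>L B)"
proof -
  have eq: "d + lndet (A + t *\<^sub>R B) = lndet (\<phi> A + t *\<^sub>R \<phi> B)" if "t \<in> {0..1}" for t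
  proof (cases "t = 0")
    case False
    then have t: "t > 0" using that by simp
    show ?thesis using H[OF A GL_scaleR[OF B t]] map_homogeneous[OF map H B t] by simp
  qed (simp add: lndet_map[OF map H A])
  have 1: "((\<lambda>t. lndet (\<phi> A + t *\<^sub>R \<phi> B)) has_real_derivative tr (op_inv (\<phi> A) o\<^sub>L \<phi> B)) (at 0 within {0..1})"
    by (intro lndet_variation map A B)
  have "((\<lambda>t. d + lndet (A + t *\<^sub>R B)) has_real_derivative 0 + tr (op_inv A o\<^sub>L B)) (at 0 within {0..1})"
    by (intro DERIV_add DERIV_const lndet_variation A B)
  then have 2: "((\<lambda>t. lndet (\<phi> A + t *\<^sub>R \<phi> B)) has_real_derivative tr (op_inv A o\<^sub>L B)) (at 0 within {0..1})"
    using has_field_derivative_transform_within[OF _ zero_less_one, of _ _ 0 "{0..1}"] eq by force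
  show ?thesis
    using 1 2 vector_derivative_unique_within_closed_interval[of 0 1 0]
    unfolding has_real_derivative_iff_has_vector_derivative by auto
qed

text \<open>
  The right-hand side of the trace identity is additive in \<open>B\<close>, and the elements \<open>\<phi>(A)\<^sup>-\<^sup>1\<close>
  exhaust \<open>GL_pos R\<close>, so the defect of additivity is orthogonal to \<open>GL_pos R\<close>.
\<close>

lemma map_additive:
  assumes bij: "bij_betw \<phi> (GL_pos R) (GL_pos R)"
    and tf: "\<And>A B. A \<in> GL_pos R \<Longrightarrow> B \<in> GL_pos R \<Longrightarrow> tr (op_inv (\<phi> A) o\<^sub>L \<phi> B) = tr (op_inv A o\<^sub>L B)"
    and B: "B \<in> GL_pos R" and C: "C \<in> GL_pos R"
  shows "\<phi> (B + C) = \<phi> B + \<phi> C"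
proof -
  have map: "\<phi> A \<in> GL_pos R" if "A \<in> GL_pos R" for A using bij that by (auto simp: bij_betw_def)
  have mem: "B \<in> R" "C \<in> R" "\<phi> B \<in> R" "\<phi> C \<in> R" "\<phi> (B + C) \<in> R"
    using GL_mem map GL_add B C by blast+
  define E where "E = \<phi> (B + C) - (\<phi> B + \<phi> C)"
  have "E = 0"
  proof (rule tr_comp_eq_0)
    show "E \<in> R" unfolding E_def by (intro diff_mem add_mem mem)
    show "sym_op E" unfolding E_def by (intro sym_op_diff sym_op_add GL_sym map GL_add B C)
    fix P assume P: "P \<in> GL_pos R"
    obtain A where A: "A \<in> GL_pos R" "\<phi> A = op_inv P"
      using bij GL_inv(1)[OF P] unfolding bij_betw_def by (metis image_iff)
    have P_eq: "P = op_inv (\<phi> A)" using GL_inv_inv[OF P] A(2) by simp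
    have Ai: "op_inv A \<in> R" using GL_mem GL_inv(1)[OF A(1)] by blast
    have "tr (P o\<^sub>L E) = tr (P o\<^sub>L \<phi> (B + C)) - (tr (P o\<^sub>L \<phi> B) + tr (P o\<^sub>L \<phi> C))"
      using GL_mem[OF P] mem by (simp add: E_def comp_simps tr_diff tr_add comp_mem add_mem)
    also have "\<dots> = tr (op_inv A o\<^sub>L (B + C)) - (tr (op_inv A o\<^sub>L B) + tr (op_inv A o\<^sub>L C))"
      unfolding P_eq by (simp only: tf A(1) B C GL_add)
    also have "\<dots> = 0" using Ai mem by (simp add: comp_simps tr_add comp_mem)
    finally show "tr (P o\<^sub>L E) = 0" .
  qed
  then show ?thesis by (simp add: E_def)
qed

end

section \<open>From an additive map to a Jordan isomorphism\<close>

text \<open>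
  A unital, additive and positively homogeneous bijection of the cone of positive invertible
  elements that preserves the form \<open>\<tau>(A\<^sup>-\<^sup>1 B)\<close>.
\<close>

locale unital_cone_map = tracial_algebra +
  fixes \<psi> :: "'a op \<Rightarrow> 'a op"
  assumes bij: "bij_betw \<psi> (GL_pos R) (GL_pos R)"
    and psi_id: "\<psi> id_blinfun = id_blinfun"
    and psi_add: "A \<in> GL_pos R \<Longrightarrow> B \<in> GL_pos R \<Longrightarrow> \<psi> (A + B) = \<psi> A + \<psi> B"
    and psi_scaleR: "A \<in> GL_pos R \<Longrightarrow> 0 < t \<Longrightarrow> \<psi> (t *\<^sub>R A) = t *\<^sub>R \<psi> A"
    and psi_form: "A \<in> GL_pos R \<Longrightarrow> B \<in> GL_pos R \<Longrightarrow>
      tr (op_inv (\<psi> A) o\<^sub>L \<psi> B) = tr (op_inv A o\<^sub>L B)"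

lemma small_quadratic_eq_0:
  fixes a b K :: real
  assumes "\<And>s. 0 < s \<Longrightarrow> s \<le> 1 \<Longrightarrow> \<bar>s * a + s\<^sup>2 * b\<bar> \<le> K * s ^ 3"
  shows "a = 0" "b = 0"
proof -
  have ev: "\<forall>\<^sub>F s in at_right 0. 0 < s \<and> s \<le> (1::real)"
    by (auto simp: eventually_at_right_field intro!: exI[of _ 1])
  have "((\<lambda>s. a + s * b) \<longlongrightarrow> a + 0 * b) (at_right 0)" by (intro tendsto_intros)
  moreover have "((\<lambda>s. a + s * b) \<longlongrightarrow> 0) (at_right 0)"
  proof (rule Lim_null_comparison)
    show "\<forall>\<^sub>F s in at_right 0. norm (a + s * b) \<le> K * s\<^sup>2" using ev
    proof eventually_elim
      case (elim s)
      have "s * a + s\<^sup>2 * b = s * (a + s * b)" by (simp add: algebra_simps power2_eq_square)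
      moreover have "\<bar>s * (a + s * b)\<bar> = s * \<bar>a + s * b\<bar>" using elim by (simp add: abs_mult)
      moreover have "K * s ^ 3 = s * (K * s\<^sup>2)" by (simp add: power3_eq_cube power2_eq_square)
      ultimately have "s * \<bar>a + s * b\<bar> \<le> s * (K * s\<^sup>2)" using assms[of s] elim by metis
      then show ?case using elim by simp
    qed
    have "((\<lambda>s. K * s\<^sup>2) \<longlongrightarrow> K * 0\<^sup>2) (at_right 0)" by (intro tendsto_intros)
    then show "((\<lambda>s. K * s\<^sup>2) \<longlongrightarrow> 0) (at_right 0)" by simp
  qed
  ultimately show a: "a = 0" using tendsto_unique trivial_limit_at_right_real by fastforce
  have "((\<lambda>s. b) \<longlongrightarrow> 0) (at_right (0::real))"
  proof (rule Lim_null_comparison)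
    show "\<forall>\<^sub>F s in at_right 0. norm b \<le> K * s" using ev
    proof eventually_elim
      case (elim s)
      moreover have "\<bar>s * a + s\<^sup>2 * b\<bar> = s\<^sup>2 * \<bar>b\<bar>" by (simp add: a abs_mult)
      moreover have "K * s ^ 3 = s\<^sup>2 * (K * s)" by (simp add: power3_eq_cube power2_eq_square)
      ultimately have "s\<^sup>2 * \<bar>b\<bar> \<le> s\<^sup>2 * (K * s)" using assms[of s] by metis
      then show ?case using elim by simp
    qed
    have "((\<lambda>s. K * s) \<longlongrightarrow> K * 0) (at_right 0)" by (intro tendsto_intros)
    then show "((\<lambda>s. K * s) \<longlongrightarrow> 0) (at_right 0)" by simp
  qed
  then show "b = 0" using tendsto_unique[OF trivial_limit_at_right_real tendsto_const] by blast
qed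

context tracial_algebra
begin

text \<open>
  \<open>(1 + sX)\<^sup>-\<^sup>1 = 1 - sX + s\<^sup>2 X\<^sup>2 - s\<^sup>3 X\<^sup>3 (1 + sX)\<^sup>-\<^sup>1\<close>, where the resolvent has norm at most one.
\<close>

lemma resolvent_expansion:
  assumes X: "X \<in> GL_pos R" and Y: "Y \<in> GL_pos R"
  shows "\<exists>K. \<forall>s. 0 < s \<and> s \<le> 1 \<longrightarrow>
    \<bar>tr (op_inv (id_blinfun + s *\<^sub>R X) o\<^sub>L Y)
      - (tr Y - s * tr (X o\<^sub>L Y) + s\<^sup>2 * tr (X o\<^sub>L (X o\<^sub>L Y)))\<bar> \<le> K * s ^ 3"
proof (intro exI allI impI)
  fix s :: real assume s: "0 < s \<and> s \<le> 1"
  define A where "A = id_blinfun + s *\<^sub>R X"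
  define I where "I = op_inv A"
  have A: "A \<in> GL_pos R" unfolding A_def using s by (intro GL_add GL_id GL_scaleR X) auto
  have I: "I \<in> R" "(A o\<^sub>L I) = id_blinfun" "(I o\<^sub>L A) = id_blinfun"
    using GL_inv[OF A] GL_mem by (auto simp: I_def)
  have m: "X \<in> R" "Y \<in> R" using X Y GL_mem by auto
  have XI: "I = id_blinfun - s *\<^sub>R (X o\<^sub>L I)"
    using I(2) by (simp add: A_def comp_simps algebra_simps)
  have exp1: "(I o\<^sub>L Y) = Y - s *\<^sub>R (X o\<^sub>L (I o\<^sub>L Y))"
    by (subst XI) (simp add: comp_simps)
  have exp3: "(I o\<^sub>L Y) = Y - s *\<^sub>R (X o\<^sub>L Y) + s\<^sup>2 *\<^sub>R (X o\<^sub>L (X o\<^sub>L Y)) - s ^ 3 *\<^sub>R (X o\<^sub>L (X o\<^sub>L (X o\<^sub>L (I o\<^sub>L Y))))"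
    by (subst exp1, subst exp1, subst exp1)
      (simp add: comp_simps algebra_simps power2_eq_square power3_eq_cube)
  have tr_eq: "tr (I o\<^sub>L Y) = tr Y - s * tr (X o\<^sub>L Y) + s\<^sup>2 * tr (X o\<^sub>L (X o\<^sub>L Y))
      - s ^ 3 * tr (X o\<^sub>L (X o\<^sub>L (X o\<^sub>L (I o\<^sub>L Y))))"
    unfolding arg_cong[OF exp3, of tr] using m I(1)
    by (simp add: tr_add tr_diff tr_scaleR comp_mem scaleR_mem add_mem diff_mem)
  have nI: "norm I \<le> 1"
  proof (rule norm_blinfun_bound)
    fix v
    define w where "w = I v"
    have v: "v = w + s *\<^sub>R X w"
    proof -
      have "v = (A o\<^sub>L I) v" by (simp add: I(2))
      then show ?thesis by (simp add: A_def w_def blinfun.add_left blinfun.scaleR_left)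
    qed
    have "0 \<le> inner (X w) w" using X by (auto simp: GL_pos_def positive_op_iff)
    then have "(norm w)\<^sup>2 \<le> inner v w"
      unfolding v using s by (simp add: inner_add power2_norm_eq_inner)
    also have "\<dots> \<le> norm v * norm w" by (rule norm_cauchy_schwarz)
    finally show "norm (I v) \<le> 1 * norm v"
      by (cases "w = 0") (auto simp: power2_eq_square w_def)
  qed simp
  have "\<bar>tr (X o\<^sub>L (X o\<^sub>L (X o\<^sub>L (I o\<^sub>L Y))))\<bar> \<le> norm (X o\<^sub>L (X o\<^sub>L (X o\<^sub>L (I o\<^sub>L Y))))"
    by (intro abs_tr_le_norm comp_mem m I)
  also have "\<dots> \<le> norm X * (norm X * (norm X * (norm I * norm Y)))"
    by (intro order_trans[OF norm_blinfun_compose] mult_left_mono order_refl norm_ge_zero)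
  also have "\<dots> \<le> norm X * (norm X * (norm X * (1 * norm Y)))"
    by (intro mult_left_mono mult_right_mono nI norm_ge_zero)
  finally have "\<bar>tr (X o\<^sub>L (X o\<^sub>L (X o\<^sub>L (I o\<^sub>L Y))))\<bar> * s ^ 3
      \<le> norm X * (norm X * (norm X * (1 * norm Y))) * s ^ 3"
    using s by (intro mult_right_mono) auto
  then show "\<bar>tr (op_inv (id_blinfun + s *\<^sub>R X) o\<^sub>L Y)
      - (tr Y - s * tr (X o\<^sub>L Y) + s\<^sup>2 * tr (X o\<^sub>L (X o\<^sub>L Y)))\<bar>
      \<le> norm X * (norm X * (norm X * (1 * norm Y))) * s ^ 3"
    using s tr_eq by (simp add: I_def A_def abs_mult mult.commute)
qed

end

context unital_cone_map
begin

lemma psi_mem: "A \<in> GL_pos R \<Longrightarrow> \<psi> A \<in> GL_pos R"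
  using bij by (auto simp: bij_betw_def)

lemma psi_surj: "B \<in> GL_pos R \<Longrightarrow> \<exists>A\<in>GL_pos R. \<psi> A = B"
  using bij by (force simp: bij_betw_def)

lemma psi_inj: "A \<in> GL_pos R \<Longrightarrow> B \<in> GL_pos R \<Longrightarrow> \<psi> A = \<psi> B \<Longrightarrow> A = B"
  using bij by (auto simp: bij_betw_def inj_on_def)

lemma psi_scaleR_id: "0 < c \<Longrightarrow> \<psi> (c *\<^sub>R id_blinfun) = c *\<^sub>R id_blinfun"
  by (simp add: psi_scaleR psi_id)

lemma psi_shift: "A \<in> GL_pos R \<Longrightarrow> 0 < c \<Longrightarrow> \<psi> (A + c *\<^sub>R id_blinfun) = \<psi> A + c *\<^sub>R id_blinfun"
  by (simp add: psi_add psi_scaleR_id GL_scaleR)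

lemma tr_psi: "B \<in> GL_pos R \<Longrightarrow> tr (\<psi> B) = tr B"
proof -
  assume B: "B \<in> GL_pos R"
  have "op_inv (id_blinfun :: 'a op) = id_blinfun" by (rule op_inv_eqI) (simp_all add: comp_simps)
  then show ?thesis using psi_form[OF GL_id B] by (simp add: psi_id comp_simps)
qed

text \<open>Comparing the expansions of \<open>\<tau>((1 + s\<psi>(X))\<^sup>-\<^sup>1 \<psi>(Y)) = \<tau>((1 + sX)\<^sup>-\<^sup>1 Y)\<close> in \<open>s\<close>.\<close>

lemma tr_psi_moments:
  assumes X: "X \<in> GL_pos R" and Y: "Y \<in> GL_pos R"
  shows "tr (\<psi> X o\<^sub>L \<psi> Y) = tr (X o\<^sub>L Y)"
    "tr (\<psi> X o\<^sub>L (\<psi> X o\<^sub>L \<psi> Y)) = tr (X o\<^sub>L (X o\<^sub>L Y))"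
proof -
  obtain K1 where K1: "\<And>s. 0 < s \<and> s \<le> 1 \<Longrightarrow> \<bar>tr (op_inv (id_blinfun + s *\<^sub>R X) o\<^sub>L Y)
      - (tr Y - s * tr (X o\<^sub>L Y) + s\<^sup>2 * tr (X o\<^sub>L (X o\<^sub>L Y)))\<bar> \<le> K1 * s ^ 3"
    using resolvent_expansion[OF X Y] by blast
  obtain K2 where K2: "\<And>s. 0 < s \<and> s \<le> 1 \<Longrightarrow> \<bar>tr (op_inv (id_blinfun + s *\<^sub>R \<psi> X) o\<^sub>L \<psi> Y)
      - (tr (\<psi> Y) - s * tr (\<psi> X o\<^sub>L \<psi> Y) + s\<^sup>2 * tr (\<psi> X o\<^sub>L (\<psi> X o\<^sub>L \<psi> Y)))\<bar> \<le> K2 * s ^ 3"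
    using resolvent_expansion[OF psi_mem[OF X] psi_mem[OF Y]] by blast
  define a where "a = tr (\<psi> X o\<^sub>L \<psi> Y) - tr (X o\<^sub>L Y)"
  define b where "b = tr (X o\<^sub>L (X o\<^sub>L Y)) - tr (\<psi> X o\<^sub>L (\<psi> X o\<^sub>L \<psi> Y))"
  have "\<bar>s * a + s\<^sup>2 * b\<bar> \<le> (K1 + K2) * s ^ 3" if s: "0 < s" "s \<le> 1" for s
  proof -
    have "id_blinfun + s *\<^sub>R \<psi> X = \<psi> (id_blinfun + s *\<^sub>R X)"
      using s X by (simp add: psi_add psi_scaleR psi_id GL_scaleR)
    then have "tr (op_inv (id_blinfun + s *\<^sub>R \<psi> X) o\<^sub>L \<psi> Y) = tr (op_inv (id_blinfun + s *\<^sub>R X) o\<^sub>L Y)"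
      using s X Y by (simp add: psi_form GL_add GL_scaleR)
    then show ?thesis
      using K1[of s] K2[of s] s unfolding tr_psi[OF Y] a_def b_def by (simp add: algebra_simps) 
  qed
  from small_quadratic_eq_0[OF this] show "tr (\<psi> X o\<^sub>L \<psi> Y) = tr (X o\<^sub>L Y)"
    "tr (\<psi> X o\<^sub>L (\<psi> X o\<^sub>L \<psi> Y)) = tr (X o\<^sub>L (X o\<^sub>L Y))" by (simp_all add: a_def b_def)
qed

lemma GL_square: "X \<in> GL_pos R \<Longrightarrow> (X o\<^sub>L X) \<in> GL_pos R"
  using GL_sandwich[of X id_blinfun] by (simp add: comp_simps)

text \<open>By the second moments, \<open>\<psi>(X\<^sup>2) - \<psi>(X)\<^sup>2\<close> is orthogonal to the range of \<open>\<psi>\<close>.\<close>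

lemma psi_square:
  assumes X: "X \<in> GL_pos R"
  shows "\<psi> (X o\<^sub>L X) = (\<psi> X o\<^sub>L \<psi> X)"
proof -
  define E where "E = \<psi> (X o\<^sub>L X) - (\<psi> X o\<^sub>L \<psi> X)"
  have m: "\<psi> X \<in> R" "\<psi> (X o\<^sub>L X) \<in> R" "X \<in> R" using X psi_mem GL_square GL_mem by blast+
  have "E = 0"
  proof (rule tr_comp_eq_0)
    show "E \<in> R" unfolding E_def by (intro diff_mem comp_mem m)
    show "sym_op E" unfolding E_def by (intro sym_op_diff GL_sym psi_mem GL_square X)
    fix P assume "P \<in> GL_pos R"
    then obtain Y where Y: "Y \<in> GL_pos R" "P = \<psi> Y" using psi_surj by blast
    have mY: "\<psi> Y \<in> R" "Y \<in> R" using Y psi_mem GL_mem by blast+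
    have "tr (P o\<^sub>L E) = tr (\<psi> Y o\<^sub>L \<psi> (X o\<^sub>L X)) - tr (\<psi> Y o\<^sub>L (\<psi> X o\<^sub>L \<psi> X))"
      using m mY by (simp add: E_def Y(2) comp_simps tr_diff comp_mem)
    also have "tr (\<psi> Y o\<^sub>L \<psi> (X o\<^sub>L X)) = tr (Y o\<^sub>L (X o\<^sub>L X))"
      by (rule tr_psi_moments(1)[OF Y(1) GL_square[OF X]])
    also have "tr (Y o\<^sub>L (X o\<^sub>L X)) = tr ((X o\<^sub>L X) o\<^sub>L Y)" by (intro tr_comm comp_mem m mY)
    also have "tr (\<psi> Y o\<^sub>L (\<psi> X o\<^sub>L \<psi> X)) = tr ((\<psi> X o\<^sub>L \<psi> X) o\<^sub>L \<psi> Y)" by (intro tr_comm comp_mem m mY)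
    finally show "tr (P o\<^sub>L E) = 0" using tr_psi_moments(2)[OF X Y(1)] by (simp add: comp_simps(9))
  qed
  then show ?thesis by (simp add: E_def)
qed

text \<open>
  The extension of \<open>\<psi>\<close> to symmetric elements, which are shifted into the cone by a scalar; any
  other admissible shift gives the same value (\<open>psi_sym_eq\<close>).
\<close>

definition psi_sym :: "'a op \<Rightarrow> 'a op" where
  "psi_sym X = \<psi> (X + (norm X + 1) *\<^sub>R id_blinfun) - (norm X + 1) *\<^sub>R id_blinfun"

lemma psi_sym_eq:
  assumes X: "X \<in> R" "sym_op X" and c: "X + c *\<^sub>R id_blinfun \<in> GL_pos R"
  shows "psi_sym X = \<psi> (X + c *\<^sub>R id_blinfun) - c *\<^sub>R id_blinfun"
proof -
  have eq: "\<psi> (X + d *\<^sub>R id_blinfun) - d *\<^sub>R id_blinfun = \<psi> (X + c *\<^sub>R id_blinfun) - c *\<^sub>R id_blinfun"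
    if "X + c *\<^sub>R id_blinfun \<in> GL_pos R" "c < d" for c d
  proof -
    have "X + d *\<^sub>R id_blinfun = (X + c *\<^sub>R id_blinfun) + (d - c) *\<^sub>R id_blinfun"
      by (simp add: algebra_simps)
    then show ?thesis using psi_shift[OF that(1), of "d - c"] that(2) by (simp add: algebra_simps)
  qed
  have "X + (norm X + 1) *\<^sub>R id_blinfun \<in> GL_pos R" by (intro GL_shift X) simp
  from eq[OF this, of "max (norm X + 1) c + 1"] eq[OF c, of "max (norm X + 1) c + 1"]
  show ?thesis by (simp add: psi_sym_def)
qed

lemma sym_shift_GL: "X \<in> R \<Longrightarrow> sym_op X \<Longrightarrow> \<exists>c>0. X + c *\<^sub>R id_blinfun \<in> GL_pos R"
  using GL_shift[of X "norm X + 1"] by (intro exI[of _ "norm X + 1"]) (auto simp: add_nonneg_pos)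

lemma psi_sym_GL: "X \<in> GL_pos R \<Longrightarrow> psi_sym X = \<psi> X"
  using psi_sym_eq[of X 0] GL_mem GL_sym by simp

lemma psi_sym_zero: "psi_sym 0 = 0"
  by (simp add: psi_sym_def psi_id)

lemma psi_sym_mem:
  assumes X: "X \<in> R" "sym_op X" shows "psi_sym X \<in> R" "sym_op (psi_sym X)" "tr (psi_sym X) = tr X"
proof -
  obtain c where c: "X + c *\<^sub>R id_blinfun \<in> GL_pos R" using sym_shift_GL[OF X] by blast
  have P: "\<psi> (X + c *\<^sub>R id_blinfun) \<in> GL_pos R" by (rule psi_mem[OF c])
  show "psi_sym X \<in> R" "sym_op (psi_sym X)"
    unfolding psi_sym_eq[OF X c]
    by (intro diff_mem sym_op_diff scaleR_mem sym_op_scaleR GL_mem[OF P] GL_sym[OF P] id_mem sym_op_id)+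
  show "tr (psi_sym X) = tr X"
    unfolding psi_sym_eq[OF X c] using GL_mem[OF P] X(1)
    by (simp add: tr_diff tr_psi[OF c] tr_add tr_scaleR scaleR_mem)
qed

lemma psi_sym_add:
  assumes X: "X \<in> R" "sym_op X" and Y: "Y \<in> R" "sym_op Y"
  shows "psi_sym (X + Y) = psi_sym X + psi_sym Y"
proof -
  obtain c where c: "X + c *\<^sub>R id_blinfun \<in> GL_pos R" using sym_shift_GL[OF X] by blast
  obtain d where d: "Y + d *\<^sub>R id_blinfun \<in> GL_pos R" using sym_shift_GL[OF Y] by blast
  have eq: "(X + Y) + (c + d) *\<^sub>R id_blinfun = (X + c *\<^sub>R id_blinfun) + (Y + d *\<^sub>R id_blinfun)"
    by (simp add: algebra_simps)
  have "psi_sym (X + Y) = \<psi> ((X + Y) + (c + d) *\<^sub>R id_blinfun) - (c + d) *\<^sub>R id_blinfun"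
    using GL_add[OF c d] X Y unfolding eq[symmetric] by (intro psi_sym_eq add_mem sym_op_add)
  then show ?thesis
    unfolding eq psi_add[OF c d] psi_sym_eq[OF X c] psi_sym_eq[OF Y d] by (simp add: algebra_simps)
qed

lemma psi_sym_minus:
  assumes X: "X \<in> R" "sym_op X" shows "psi_sym (- X) = - psi_sym X"
  using psi_sym_add[OF X, of "- X"] scaleR_mem[OF X(1), of "- 1"] sym_op_scaleR[OF X(2), of "- 1"]
  by (simp add: psi_sym_zero eq_neg_iff_add_eq_0 add.commute)

lemma psi_sym_scaleR:
  assumes X: "X \<in> R" "sym_op X" shows "psi_sym (r *\<^sub>R X) = r *\<^sub>R psi_sym X"
proof -
  have pos: "psi_sym (r *\<^sub>R X) = r *\<^sub>R psi_sym X" if r: "r > 0" for r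
  proof -
    obtain c where c: "X + c *\<^sub>R id_blinfun \<in> GL_pos R" using sym_shift_GL[OF X] by blast
    have eq: "r *\<^sub>R X + (r * c) *\<^sub>R id_blinfun = r *\<^sub>R (X + c *\<^sub>R id_blinfun)"
      by (simp add: algebra_simps)
    have "psi_sym (r *\<^sub>R X) = \<psi> (r *\<^sub>R X + (r * c) *\<^sub>R id_blinfun) - (r * c) *\<^sub>R id_blinfun"
      using GL_scaleR[OF c r] X unfolding eq[symmetric] by (intro psi_sym_eq scaleR_mem sym_op_scaleR)
    then show ?thesis unfolding eq psi_scaleR[OF c r] psi_sym_eq[OF X c] by (simp add: algebra_simps)
  qed
  consider "r > 0" | "r = 0" | "r < 0" by linarith
  then show ?thesis
  proof cases
    case 3
    have "psi_sym (- ((- r) *\<^sub>R X)) = - psi_sym ((- r) *\<^sub>R X)"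
      by (intro psi_sym_minus scaleR_mem sym_op_scaleR X)
    then show ?thesis using pos[of "- r"] 3 by simp
  qed (auto simp: pos psi_sym_zero)
qed

lemma sym_op_square: "sym_op X \<Longrightarrow> sym_op (X o\<^sub>L X)"
  by (rule sym_op_commuting) auto

lemma psi_sym_square:
  assumes X: "X \<in> R" "sym_op X" shows "psi_sym (X o\<^sub>L X) = (psi_sym X o\<^sub>L psi_sym X)"
proof -
  obtain c where c: "X + c *\<^sub>R id_blinfun \<in> GL_pos R" using sym_shift_GL[OF X] by blast
  define P where "P = X + c *\<^sub>R id_blinfun"
  have P: "P \<in> GL_pos R" using c by (simp add: P_def)
  have mP: "P \<in> R" "sym_op P" using P GL_mem GL_sym by auto
  have mI: "id_blinfun \<in> R" "sym_op (id_blinfun :: 'a op)" by auto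
  have X_eq: "X = P + (- c) *\<^sub>R id_blinfun" by (simp add: P_def)
  have sq: "(X o\<^sub>L X) = (P o\<^sub>L P) + ((- 2 * c) *\<^sub>R P + (c * c) *\<^sub>R id_blinfun)"
    unfolding X_eq by (simp add: comp_simps algebra_simps) (simp add: scaleR_2[symmetric])
  have "psi_sym (X o\<^sub>L X) = psi_sym (P o\<^sub>L P) + ((- 2 * c) *\<^sub>R psi_sym P + (c * c) *\<^sub>R psi_sym id_blinfun)"
    unfolding sq
    by (simp only: psi_sym_add psi_sym_scaleR add_mem comp_mem scaleR_mem sym_op_add sym_op_scaleR
        sym_op_square mP mI)
  also have "\<dots> = (\<psi> P o\<^sub>L \<psi> P) + ((- 2 * c) *\<^sub>R \<psi> P + (c * c) *\<^sub>R id_blinfun)"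
    by (simp add: psi_sym_GL P GL_square psi_square psi_id)
  also have "\<dots> = ((\<psi> P + (- c) *\<^sub>R id_blinfun) o\<^sub>L (\<psi> P + (- c) *\<^sub>R id_blinfun))"
    by (simp add: comp_simps algebra_simps) (simp add: scaleR_2[symmetric])
  also have "\<psi> P + (- c) *\<^sub>R id_blinfun = psi_sym X"
    using psi_sym_eq[OF X c] by (simp add: P_def)
  finally show ?thesis .
qed

lemma psi_sym_jordan:
  assumes X: "X \<in> R" "sym_op X" and Y: "Y \<in> R" "sym_op Y"
  shows "psi_sym ((X o\<^sub>L Y) + (Y o\<^sub>L X)) = (psi_sym X o\<^sub>L psi_sym Y) + (psi_sym Y o\<^sub>L psi_sym X)"
    "sym_op ((X o\<^sub>L Y) + (Y o\<^sub>L X))"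
proof -
  show s: "sym_op ((X o\<^sub>L Y) + (Y o\<^sub>L X))"
    using X Y by (simp add: sym_op_def blinfun.add_left inner_add)
  let ?J = "(X o\<^sub>L Y) + (Y o\<^sub>L X)"
  have J: "?J \<in> R" by (intro add_mem comp_mem X Y)
  have "((X + Y) o\<^sub>L (X + Y)) = (X o\<^sub>L X) + ((Y o\<^sub>L Y) + ?J)" by (simp add: comp_simps algebra_simps)
  then have 1: "psi_sym ((X + Y) o\<^sub>L (X + Y)) = psi_sym (X o\<^sub>L X) + (psi_sym (Y o\<^sub>L Y) + psi_sym ?J)"
    by (simp only: psi_sym_add add_mem comp_mem sym_op_add sym_op_square X Y J s)
  have 2: "psi_sym ((X + Y) o\<^sub>L (X + Y)) = (psi_sym X + psi_sym Y o\<^sub>L psi_sym X + psi_sym Y)"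
    by (simp only: psi_sym_square psi_sym_add add_mem sym_op_add X Y)
  show "psi_sym ?J = (psi_sym X o\<^sub>L psi_sym Y) + (psi_sym Y o\<^sub>L psi_sym X)"
    using trans[OF 1[symmetric] 2] by (simp add: psi_sym_square X Y comp_simps algebra_simps)
qed

lemma psi_sym_inj:
  assumes X: "X \<in> R" "sym_op X" and Y: "Y \<in> R" "sym_op Y" and eq: "psi_sym X = psi_sym Y"
  shows "X = Y"
proof -
  obtain c where c: "c > 0" "X - Y + c *\<^sub>R id_blinfun \<in> GL_pos R"
    using sym_shift_GL[of "X - Y"] X Y diff_mem sym_op_diff by blast
  have mY: "- Y \<in> R" "sym_op (- Y)"
    using scaleR_mem[OF Y(1), of "- 1"] sym_op_scaleR[OF Y(2), of "- 1"] by auto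
  have "psi_sym (X - Y) = 0"
    using psi_sym_add[OF X mY] psi_sym_minus[OF Y] eq by simp
  then have "\<psi> (X - Y + c *\<^sub>R id_blinfun) = \<psi> (c *\<^sub>R id_blinfun)"
    using psi_sym_eq[OF _ _ c(2)] X Y c(1) by (simp add: diff_mem sym_op_diff psi_scaleR_id)
  then have "X - Y + c *\<^sub>R id_blinfun = c *\<^sub>R id_blinfun"
    by (rule psi_inj[OF c(2) GL_scaleR[OF GL_id c(1)]])
  then show ?thesis by simp
qed

lemma psi_sym_surj:
  assumes Y: "Y \<in> R" "sym_op Y" shows "\<exists>X\<in>R. sym_op X \<and> psi_sym X = Y"
proof -
  obtain c where c: "Y + c *\<^sub>R id_blinfun \<in> GL_pos R" using sym_shift_GL[OF Y] by blast
  obtain P where P: "P \<in> GL_pos R" "\<psi> P = Y + c *\<^sub>R id_blinfun" using psi_surj[OF c] by blast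
  define X where "X = P - c *\<^sub>R id_blinfun"
  have "X \<in> R" "sym_op X" unfolding X_def
    by (intro diff_mem sym_op_diff scaleR_mem sym_op_scaleR GL_mem[OF P(1)] GL_sym[OF P(1)] id_mem sym_op_id)+
  moreover from this have "psi_sym X = Y"
    using psi_sym_eq[of X c] P by (simp add: X_def)
  ultimately show ?thesis by blast
qed

end

subsection \<open>The complex-linear extension\<close>

lemma cscale_simps:
  fixes A B :: "'h::complex_hilbert_space op"
  shows "c \<cdot>\<^sub>C (A + B) = c \<cdot>\<^sub>C A + c \<cdot>\<^sub>C B" "c \<cdot>\<^sub>C (d \<cdot>\<^sub>C A) = (c * d) \<cdot>\<^sub>C A"
    "(c + d) \<cdot>\<^sub>C A = c \<cdot>\<^sub>C A + d \<cdot>\<^sub>C A"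
    "(c \<cdot>\<^sub>C A o\<^sub>L B) = c \<cdot>\<^sub>C (A o\<^sub>L B)"
    "A \<in> clinear_ops \<Longrightarrow> (A o\<^sub>L c \<cdot>\<^sub>C B) = c \<cdot>\<^sub>C (A o\<^sub>L B)"
  by (auto intro!: blinfun_eqI simp: blinfun.add_left scaleC_add_right scaleC_add_left
      scaleC_scaleC clinear_ops_def)

context tracial_algebra
begin

lemma cartesian_unique:
  assumes X: "X \<in> R" "sym_op X" and Y: "Y \<in> R" "sym_op Y"
  shows "adj (X + \<i> \<cdot>\<^sub>C Y) = X + \<i> \<cdot>\<^sub>C (- Y)"
    "re_part (X + \<i> \<cdot>\<^sub>C Y) = X" "im_part (X + \<i> \<cdot>\<^sub>C Y) = Y"
proof -
  have m: "X + \<i> \<cdot>\<^sub>C Y \<in> clinear_ops" by (intro clin add_mem cscale_mem X Y)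
  have sY: "inner (\<i> *\<^sub>C Y x) y = - inner x (\<i> *\<^sub>C Y y)" for x y
    using Y(2)[unfolded sym_op_def, rule_format, of x "\<i> *\<^sub>C y"]
    by (simp add: inner_ii_shift clinear_ii[OF clin[OF Y(1)]])
  have neg: "\<i> *\<^sub>C (- v) = - (\<i> *\<^sub>C v)" for v :: 'h
    by (metis scaleC_minus_one scaleC_scaleC mult.commute)
  show a: "adj (X + \<i> \<cdot>\<^sub>C Y) = X + \<i> \<cdot>\<^sub>C (- Y)"
  proof (rule adj_eqI[OF m])
    fix x y
    show "inner ((X + \<i> \<cdot>\<^sub>C Y) x) y = inner x ((X + \<i> \<cdot>\<^sub>C (- Y)) y)"
      using X(2)[unfolded sym_op_def, rule_format, of x y] sY[of x y]
      by (simp add: blinfun.add_left blinfun.minus_left inner_add inner_diff neg)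
  qed
  have mi: "\<i> \<cdot>\<^sub>C (- Y) = - (\<i> \<cdot>\<^sub>C Y)"
    by (rule blinfun_eqI) (simp add: blinfun.minus_left neg)
  show "re_part (X + \<i> \<cdot>\<^sub>C Y) = X"
    by (simp add: re_part_def a mi scaleR_2[symmetric])
  have 2: "X + \<i> \<cdot>\<^sub>C Y - adj (X + \<i> \<cdot>\<^sub>C Y) = 2 *\<^sub>R (\<i> \<cdot>\<^sub>C Y)"
    by (simp add: a mi scaleR_2)
  have "(1 / 2) *\<^sub>R ((- \<i>) \<cdot>\<^sub>C (2 *\<^sub>R (\<i> \<cdot>\<^sub>C Y))) = Y"
    by (rule blinfun_eqI) (simp add: blinfun.scaleR_left scaleR_scaleC scaleC_scaleC)
  then show "im_part (X + \<i> \<cdot>\<^sub>C Y) = Y" unfolding im_part_def 2 .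
qed

lemma cartesian_E:
  assumes "A \<in> R"
  obtains X Y where "X \<in> R" "sym_op X" "Y \<in> R" "sym_op Y" "A = X + \<i> \<cdot>\<^sub>C Y"
  using re_im_part[OF assms] that by blast

lemma cscale_cartesian:
  "c \<cdot>\<^sub>C (X + \<i> \<cdot>\<^sub>C Y) = (Re c *\<^sub>R X + (- Im c) *\<^sub>R Y) + \<i> \<cdot>\<^sub>C (Im c *\<^sub>R X + Re c *\<^sub>R Y)"
proof -
  have "c \<cdot>\<^sub>C (X + \<i> \<cdot>\<^sub>C Y) = (of_real (Re c) + \<i> * of_real (Im c)) \<cdot>\<^sub>C X
      + ((of_real (Re c) + \<i> * of_real (Im c)) * \<i>) \<cdot>\<^sub>C Y"
    by (simp add: cscale_simps complex_eq[symmetric])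
  also have "(of_real (Re c) + \<i> * of_real (Im c)) * \<i> = of_real (- Im c) + \<i> * of_real (Re c)"
    by (simp add: complex_eq_iff)
  finally show ?thesis
    by (simp only: cscale_simps(1,3) cscale_simps(2)[symmetric] cscale_of_real) (simp add: algebra_simps)
qed

end

context unital_cone_map
begin

text \<open>
  The complex-linear extension to the whole algebra.
\<close>

definition psi_ext :: "'a op \<Rightarrow> 'a op" where
  "psi_ext A = psi_sym (re_part A) + \<i> \<cdot>\<^sub>C psi_sym (im_part A)"

lemma psi_ext_cartesian:
  "X \<in> R \<Longrightarrow> sym_op X \<Longrightarrow> Y \<in> R \<Longrightarrow> sym_op Y \<Longrightarrow>
    psi_ext (X + \<i> \<cdot>\<^sub>C Y) = psi_sym X + \<i> \<cdot>\<^sub>C psi_sym Y"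
  by (simp add: psi_ext_def cartesian_unique)

lemma psi_ext_sym: "X \<in> R \<Longrightarrow> sym_op X \<Longrightarrow> psi_ext X = psi_sym X"
proof -
  have "\<i> *\<^sub>C 0 = (0 :: 'a)" using scaleC_add_right[of \<i> 0 "0 :: 'a"] by simp
  then have "\<i> \<cdot>\<^sub>C 0 = (0 :: 'a op)" by (intro blinfun_eqI) simp
  moreover have "sym_op (0 :: 'a op)" by (simp add: sym_op_def)
  moreover assume "X \<in> R" "sym_op X"
  ultimately show ?thesis using psi_ext_cartesian[of X 0] by (simp add: psi_sym_zero)
qed

lemma psi_ext_jordan: "jordan_star_iso R psi_ext" "trace_preserving R \<tau> psi_ext"
proof -
  have mem: "psi_ext A \<in> R" if "A \<in> R" for A
    using re_im_part[OF that] unfolding psi_ext_def by (intro add_mem cscale_mem psi_sym_mem)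
  have add: "psi_ext (A + B) = psi_ext A + psi_ext B" if A: "A \<in> R" and B: "B \<in> R" for A B
  proof -
    obtain X Y where X: "X \<in> R" "sym_op X" and Y: "Y \<in> R" "sym_op Y" and A_eq: "A = X + \<i> \<cdot>\<^sub>C Y"
      using A by (rule cartesian_E)
    obtain U V where U: "U \<in> R" "sym_op U" and V: "V \<in> R" "sym_op V" and B_eq: "B = U + \<i> \<cdot>\<^sub>C V"
      using B by (rule cartesian_E)
    have "A + B = (X + U) + \<i> \<cdot>\<^sub>C (Y + V)" by (simp add: A_eq B_eq cscale_simps)
    then have "psi_ext (A + B) = (psi_sym X + psi_sym U) + \<i> \<cdot>\<^sub>C (psi_sym Y + psi_sym V)"
      by (simp only: psi_ext_cartesian add_mem sym_op_add psi_sym_add X Y U V)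
    then show ?thesis unfolding A_eq B_eq
      by (simp only: psi_ext_cartesian X Y U V) (simp add: cscale_simps)
  qed
  have scale: "psi_ext (c \<cdot>\<^sub>C A) = c \<cdot>\<^sub>C psi_ext A" if A: "A \<in> R" for c A
  proof -
    obtain X Y where X: "X \<in> R" "sym_op X" and Y: "Y \<in> R" "sym_op Y" and A_eq: "A = X + \<i> \<cdot>\<^sub>C Y"
      using A by (rule cartesian_E)
    show ?thesis unfolding A_eq cscale_cartesian
      by (simp only: psi_ext_cartesian add_mem scaleR_mem sym_op_add sym_op_scaleR psi_sym_add
          psi_sym_scaleR X Y cscale_cartesian)
  qed
  have square: "psi_ext (A o\<^sub>L A) = (psi_ext A o\<^sub>L psi_ext A)" if A: "A \<in> R" for A
  proof -
    obtain X Y where X: "X \<in> R" "sym_op X" and Y: "Y \<in> R" "sym_op Y" and A_eq: "A = X + \<i> \<cdot>\<^sub>C Y"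
      using A by (rule cartesian_E)
    have sq: "(X + \<i> \<cdot>\<^sub>C Y o\<^sub>L X + \<i> \<cdot>\<^sub>C Y) = ((X o\<^sub>L X) + (- 1) *\<^sub>R (Y o\<^sub>L Y)) + \<i> \<cdot>\<^sub>C ((X o\<^sub>L Y) + (Y o\<^sub>L X))"
      if "X \<in> R" "Y \<in> R" for X Y
    proof -
      have "(\<i> * \<i>) \<cdot>\<^sub>C (Y o\<^sub>L Y) = (- 1) *\<^sub>R (Y o\<^sub>L Y)"
        using cscale_of_real[of "- 1" "Y o\<^sub>L Y"] by simp
      then show ?thesis using clin[OF that(1)] clin[OF that(2)]
        by (simp add: comp_simps(1,2) cscale_simps)
    qed
    have "psi_ext (A o\<^sub>L A) = (psi_sym (X o\<^sub>L X) + (- 1) *\<^sub>R psi_sym (Y o\<^sub>L Y))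
        + \<i> \<cdot>\<^sub>C psi_sym ((X o\<^sub>L Y) + (Y o\<^sub>L X))"
      unfolding A_eq sq[OF X(1) Y(1)]
      by (simp only: psi_ext_cartesian add_mem scaleR_mem comp_mem sym_op_add sym_op_scaleR
          sym_op_square psi_sym_jordan(2) psi_sym_add psi_sym_scaleR X Y)
    also have "\<dots> = (psi_sym X + \<i> \<cdot>\<^sub>C psi_sym Y o\<^sub>L psi_sym X + \<i> \<cdot>\<^sub>C psi_sym Y)"
      by (simp only: sq psi_sym_mem X Y psi_sym_square psi_sym_jordan(1))
    finally show ?thesis unfolding A_eq by (simp only: psi_ext_cartesian X Y)
  qed
  have adj: "psi_ext (adj A) = adj (psi_ext A)" if A: "A \<in> R" for A
  proof -
    obtain X Y where X: "X \<in> R" "sym_op X" and Y: "Y \<in> R" "sym_op Y" and A_eq: "A = X + \<i> \<cdot>\<^sub>C Y"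
      using A by (rule cartesian_E)
    have mY: "- Y \<in> R" "sym_op (- Y)"
      using scaleR_mem[OF Y(1), of "- 1"] sym_op_scaleR[OF Y(2), of "- 1"] by auto
    show ?thesis unfolding A_eq
      by (simp only: cartesian_unique(1) psi_ext_cartesian X Y mY psi_sym_mem psi_sym_minus)
  qed
  have "inj_on psi_ext R"
  proof (rule inj_onI)
    fix A B assume A: "A \<in> R" and B: "B \<in> R" and eq: "psi_ext A = psi_ext B"
    note a = re_im_part[OF A] and b = re_im_part[OF B]
    have "psi_sym (re_part A) = psi_sym (re_part B)" "psi_sym (im_part A) = psi_sym (im_part B)"
      using eq a b unfolding psi_ext_def by (metis cartesian_unique(2) psi_sym_mem(1,2),
        metis cartesian_unique(3) psi_sym_mem(1,2))
    then have "re_part A = re_part B" "im_part A = im_part B"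
      using a(1-4) b(1-4) by (auto intro: psi_sym_inj)
    then show "A = B" using a(5) b(5) by simp
  qed
  moreover have "psi_ext ` R = R"
  proof
    show "psi_ext ` R \<subseteq> R" using mem by auto
    show "R \<subseteq> psi_ext ` R"
    proof
      fix B assume "B \<in> R"
      then obtain U V where U: "U \<in> R" "sym_op U" and V: "V \<in> R" "sym_op V" and B_eq: "B = U + \<i> \<cdot>\<^sub>C V"
        by (rule cartesian_E)
      obtain X where X: "X \<in> R" "sym_op X" "psi_sym X = U" using psi_sym_surj[OF U] by blast
      obtain Y where Y: "Y \<in> R" "sym_op Y" "psi_sym Y = V" using psi_sym_surj[OF V] by blast
      have "B = psi_ext (X + \<i> \<cdot>\<^sub>C Y)" using X Y by (simp add: B_eq psi_ext_cartesian)
      then show "B \<in> psi_ext ` R" using X Y by (auto intro: add_mem cscale_mem)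
    qed
  qed
  ultimately have "bij_betw psi_ext R R" by (simp add: bij_betw_def)
  with mem add scale square adj show "jordan_star_iso R psi_ext"
    by (simp add: jordan_star_iso_def jordan_hom_def)
  show "trace_preserving R \<tau> psi_ext"
    unfolding trace_preserving_def
  proof
    fix A assume A: "A \<in> R"
    note a = re_im_part[OF A]
    have "\<tau> (psi_ext A) = of_real (tr (re_part A)) + \<i> * of_real (tr (im_part A))"
      using a(1-4) psi_sym_mem unfolding psi_ext_def
      by (simp add: tau_add tau_cscale cscale_mem tau_sym(1))
    also have "\<dots> = \<tau> (re_part A + \<i> \<cdot>\<^sub>C im_part A)"
      using a(1-4) by (simp add: tau_add tau_cscale cscale_mem tau_sym(1))
    finally show "\<tau> (psi_ext A) = \<tau> A" using a(5) by simp
  qed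
qed

lemma psi_ext_GL: "A \<in> GL_pos R \<Longrightarrow> psi_ext A = \<psi> A"
  using GL_mem GL_sym by (simp add: psi_ext_sym psi_sym_GL)

end

section \<open>Trace-preserving Jordan isomorphisms preserve the determinant\<close>

context tracial_algebra
begin

text \<open>A fixed trace-preserving Jordan \<open>*\<close>-isomorphism \<open>J\<close>.\<close>

context
  fixes J
  assumes J: "jordan_star_iso R J" and Jt: "trace_preserving R \<tau> J"
begin

lemma J_mem: "A \<in> R \<Longrightarrow> J A \<in> R"
  and J_add: "A \<in> R \<Longrightarrow> B \<in> R \<Longrightarrow> J (A + B) = J A + J B"
  and J_cscale: "A \<in> R \<Longrightarrow> J (c \<cdot>\<^sub>C A) = c \<cdot>\<^sub>C J A"
  and J_square: "A \<in> R \<Longrightarrow> J (A o\<^sub>L A) = (J A o\<^sub>L J A)"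
  and J_adj: "A \<in> R \<Longrightarrow> J (adj A) = adj (J A)"
  and J_surj: "B \<in> R \<Longrightarrow> \<exists>A\<in>R. J A = B"
  using J unfolding jordan_star_iso_def jordan_hom_def bij_betw_def by (blast | metis imageE)+

lemma J_scaleR: "A \<in> R \<Longrightarrow> J (r *\<^sub>R A) = r *\<^sub>R J A"
  using J_cscale[of A "of_real r"] by (simp add: cscale_of_real)

lemma J_diff: "A \<in> R \<Longrightarrow> B \<in> R \<Longrightarrow> J (A - B) = J A - J B"
  using J_add[of A "(- 1) *\<^sub>R B"] J_scaleR[of B "- 1"] scaleR_mem[of B "- 1"] by simp

lemma tr_J: "A \<in> R \<Longrightarrow> tr (J A) = tr A"
  using Jt by (simp add: trace_preserving_def tr_def)

lemma J_jordan_product: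
  assumes A: "A \<in> R" and B: "B \<in> R"
  shows "J ((A o\<^sub>L B) + (B o\<^sub>L A)) = (J A o\<^sub>L J B) + (J B o\<^sub>L J A)"
proof -
  let ?P = "(A o\<^sub>L B) + (B o\<^sub>L A)"
  have "((A + B) o\<^sub>L (A + B)) = (A o\<^sub>L A) + ((B o\<^sub>L B) + ?P)" by (simp add: comp_simps algebra_simps)
  then have 1: "J ((A + B) o\<^sub>L (A + B)) = J (A o\<^sub>L A) + (J (B o\<^sub>L B) + J ?P)"
    by (simp only: J_add add_mem comp_mem A B)
  have 2: "J ((A + B) o\<^sub>L (A + B)) = (J A + J B o\<^sub>L J A + J B)"
    by (simp only: J_square J_add add_mem A B)
  show ?thesis
    using trans[OF 1[symmetric] 2] by (simp add: J_square A B comp_simps algebra_simps)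
qed

text \<open>
  Choose \<open>B\<close> with \<open>J B = I\<close> in \<open>J(IB + BI) = J(I) J(B) + J(B) J(I)\<close>.
\<close>

lemma J_id: "J id_blinfun = id_blinfun"
proof -
  obtain B where B: "B \<in> R" "J B = id_blinfun" using J_surj[OF id_mem] by blast
  have "J (2 *\<^sub>R B) = 2 *\<^sub>R J id_blinfun"
    using J_jordan_product[OF id_mem B(1)] by (simp add: comp_simps B(2) scaleR_2)
  then show ?thesis using B by (simp add: J_scaleR)
qed

lemma J_opow:
  assumes C: "C \<in> R" shows "J (opow C n) = opow (J C) n"
proof (induction n)
  case (Suc n)
  have m: "opow C k \<in> R" for k by (rule opow_mem[OF C])
  have "2 *\<^sub>R opow C (Suc n) = (C o\<^sub>L opow C n) + (opow C n o\<^sub>L C)"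
    by (simp add: opow_Suc[symmetric] opow_Suc2[symmetric] scaleR_2)
  then have "J (2 *\<^sub>R opow C (Suc n)) = 2 *\<^sub>R opow (J C) (Suc n)"
    using J_jordan_product[OF C m] Suc
    by (simp add: opow_Suc[symmetric] opow_Suc2[symmetric] scaleR_2)
  then show ?case using m by (simp add: J_scaleR)
qed (simp add: J_id)

lemma sym_J:
  assumes A: "A \<in> R" "sym_op A" shows "sym_op (J A)"
proof -
  have "adj (J A) = J A" using J_adj[OF A(1)] sym_adj[OF A] by simp
  then show ?thesis
    unfolding sym_op_def using adj_inner[OF clin[OF J_mem[OF A(1)]]] by metis
qed

text \<open>
  A positive element is a square \<open>B\<^sup>2\<close> with symmetric \<open>B\<close>, and \<open>J(B\<^sup>2) = J(B)\<^sup>2\<close>.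
\<close>

lemma J_nonneg:
  assumes A: "A \<in> R" "sa_between 0 b A" shows "0 \<le> inner (J A x) x"
proof -
  obtain B where B: "B \<in> R" "sym_op B" "(B o\<^sub>L B) = A"
    using sqrt_exists[OF A(1) clin[OF A(1)] A(2)] by (auto simp: sa_between_def)
  have "inner (J A x) x = inner (J B x) (J B x)"
    using J_square[OF B(1)] B(3) sym_J[OF B(1,2)] by (simp add: sym_op_def)
  then show ?thesis by simp
qed

lemma J_between:
  assumes A: "A \<in> R" "sa_between a b A" shows "sa_between a b (J A)"
  unfolding sa_between_def
proof (intro conjI allI)
  show "sym_op (J A)" using A by (intro sym_J) (auto simp: sa_between_def)
  fix x
  have 1: "sa_between 0 (b - a) (A - a *\<^sub>R id_blinfun)"
    using sa_between_affine[OF A(2), of 1 "- a"] by (simp add: algebra_simps)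
  have 2: "sa_between 0 (b - a) (b *\<^sub>R id_blinfun - A)"
    using sa_between_affine[OF sa_between_uminus[OF A(2)], of 1 b] by simp
  have "0 \<le> inner (J (A - a *\<^sub>R id_blinfun) x) x" "0 \<le> inner (J (b *\<^sub>R id_blinfun - A) x) x"
    by (rule J_nonneg[OF _ 1] J_nonneg[OF _ 2]; intro diff_mem scaleR_mem id_mem A)+
  then show "a * inner x x \<le> inner (J A x) x" "inner (J A x) x \<le> b * inner x x"
    using A(1) by (simp_all add: J_diff J_scaleR J_id scaleR_mem blinfun.diff_left
        blinfun.scaleR_left inner_diff)
qed

lemma J_GL: "A \<in> GL_pos R \<Longrightarrow> J A \<in> GL_pos R"
  by (metis GL_E GL_I GL_mem J_mem J_between)

text \<open>
  Both sides have the same power series, since \<open>J\<close> preserves the bounds \<open>a \<le> A \<le> b\<close>, powers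
  and the trace.
\<close>

lemma lndet_J:
  assumes A: "A \<in> GL_pos R" shows "lndet (J A) = lndet A"
proof -
  obtain a b where ab: "0 < a" "sa_between a b A" using A by (rule GL_E)
  note AR = GL_mem[OF A]
  define C where "C = id_blinfun - (1 / b) *\<^sub>R A"
  have C: "C \<in> R" unfolding C_def by (intro diff_mem scaleR_mem id_mem AR)
  have JC: "id_blinfun - (1 / b) *\<^sub>R J A = J C"
    using AR by (simp add: C_def J_diff J_id J_scaleR scaleR_mem)
  have "tr (opow (J C) n) = tr (opow C n)" for n
    using tr_J[OF opow_mem[OF C]] by (simp add: J_opow[OF C])
  then have "(\<lambda>n. tr (opow C (Suc n)) / real (Suc n)) sums (ln b - lndet (J A))"
    using lndet_series(1)[OF J_mem[OF AR] J_between[OF AR ab(2)] ab(1)] by (simp add: JC)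
  moreover have "(\<lambda>n. tr (opow C (Suc n)) / real (Suc n)) sums (ln b - lndet A)"
    unfolding C_def by (rule lndet_series(1)[OF AR ab(2,1)])
  ultimately show ?thesis using sums_unique2 by fastforce
qed

text \<open>
  One direction of the characterisation, on the level of \<open>ln \<Delta>\<close>.
\<close>

lemma sandwich_J_lndet:
  assumes T: "T \<in> GL_pos R" and map: "\<And>A. A \<in> GL_pos R \<Longrightarrow> \<phi> A = (T o\<^sub>L J A o\<^sub>L T)"
    and A: "A \<in> GL_pos R" and B: "B \<in> GL_pos R"
  shows "lndet (\<phi> A + \<phi> B) = lndet (\<phi> id_blinfun) + lndet (A + B)"
proof -
  have "\<phi> A + \<phi> B = (T o\<^sub>L (J (A + B) o\<^sub>L T))"
    using A B GL_mem by (simp add: map J_add comp_simps)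
  then have "lndet (\<phi> A + \<phi> B) = 2 * lndet T + lndet (A + B)"
    by (simp add: lndet_sandwich T J_GL GL_add A B lndet_J)
  moreover have "lndet (\<phi> id_blinfun) = 2 * lndet T"
    using lndet_sandwich[OF T GL_id] by (simp add: map J_id comp_simps lndet_id)
  ultimately show ?thesis by simp
qed

end

section \<open>Maps satisfying the determinant identity\<close>

text \<open>
  The other direction: the unital map is \<open>\<psi>(A) = W \<phi>(A) W\<close> with \<open>T\<^sup>2 = \<phi>(I)\<close> and
  \<open>W = T\<^sup>-\<^sup>1\<close>.
\<close>

lemma determinant_map_form:
  assumes bij: "bij_betw \<phi> (GL_pos R) (GL_pos R)"
    and H: "\<And>A B. A \<in> GL_pos R \<Longrightarrow> B \<in> GL_pos R \<Longrightarrow>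
      lndet (\<phi> A + \<phi> B) = lndet (\<phi> id_blinfun) + lndet (A + B)"
  shows "\<exists>J T. jordan_star_iso R J \<and> trace_preserving R \<tau> J \<and> T \<in> GL_pos R \<and>
    (\<forall>A\<in>GL_pos R. \<phi> A = T o\<^sub>L J A o\<^sub>L T)"
proof -
  have map: "\<phi> A \<in> GL_pos R" if "A \<in> GL_pos R" for A using bij that by (auto simp: bij_betw_def)
  have form: "tr (op_inv (\<phi> A) o\<^sub>L \<phi> B) = tr (op_inv A o\<^sub>L B)" if "A \<in> GL_pos R" "B \<in> GL_pos R" for A B
    by (rule map_trace_form[OF map H that])
  have hom: "\<phi> (t *\<^sub>R A) = t *\<^sub>R \<phi> A" if "A \<in> GL_pos R" "0 < t" for A t
    by (rule map_homogeneous[OF map H that])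
  have add: "\<phi> (A + B) = \<phi> A + \<phi> B" if "A \<in> GL_pos R" "B \<in> GL_pos R" for A B
    by (rule map_additive[OF bij form that])
  obtain T where T: "T \<in> GL_pos R" "(T o\<^sub>L T) = \<phi> id_blinfun"
    using GL_sqrt[OF map[OF GL_id]] by blast
  define W where "W = op_inv T"
  have W: "W \<in> GL_pos R" "(T o\<^sub>L W) = id_blinfun" "(W o\<^sub>L T) = id_blinfun"
    using GL_inv[OF T(1)] by (auto simp: W_def)
  note cancel = W(2,3) W(2,3)[THEN comp_cancel]
  define \<psi> where "\<psi> A = (W o\<^sub>L (\<phi> A o\<^sub>L W))" for A
  have phi_psi: "\<phi> A = (T o\<^sub>L \<psi> A o\<^sub>L T)" for A
    by (simp add: \<psi>_def comp_simps(9,10) cancel)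
  have psi: "\<psi> A \<in> GL_pos R" if "A \<in> GL_pos R" for A
    unfolding \<psi>_def by (intro GL_sandwich W map that)
  have "unital_cone_map R \<tau> \<psi>"
  proof
    have "inj_on \<psi> (GL_pos R)"
      by (rule inj_onI) (metis phi_psi bij bij_betw_def inj_on_def)
    moreover have "GL_pos R \<subseteq> \<psi> ` GL_pos R"
    proof
      fix B assume B: "B \<in> GL_pos R"
      have "(T o\<^sub>L (B o\<^sub>L T)) \<in> \<phi> ` GL_pos R"
        using bij GL_sandwich[OF T(1) B] by (simp add: bij_betw_def)
      then obtain A where A: "A \<in> GL_pos R" "\<phi> A = (T o\<^sub>L (B o\<^sub>L T))" by auto
      then have "\<psi> A = B" by (simp add: \<psi>_def comp_simps(9,10) cancel)
      with A show "B \<in> \<psi> ` GL_pos R" by auto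
    qed
    ultimately show "bij_betw \<psi> (GL_pos R) (GL_pos R)" using psi by (auto simp: bij_betw_def)
    show "\<psi> id_blinfun = id_blinfun"
      by (simp add: \<psi>_def T(2)[symmetric] comp_simps(9) cancel)
    fix A B assume A: "A \<in> GL_pos R" and B: "B \<in> GL_pos R"
    show "\<psi> (A + B) = \<psi> A + \<psi> B" using add[OF A B] by (simp add: \<psi>_def comp_simps)
    note mem = GL_mem[OF map[OF A]] GL_mem[OF map[OF B]] GL_mem[OF GL_inv(1)[OF map[OF A]]]
      GL_mem[OF T(1)] GL_mem[OF W(1)]
    have "op_inv (\<psi> A) = (T o\<^sub>L (op_inv (\<phi> A) o\<^sub>L T))"
      using GL_inv[OF map[OF A]] comp_cancel[OF GL_inv(2)[OF map[OF A]]] comp_cancel[OF GL_inv(3)[OF map[OF A]]]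
      by (intro op_inv_eqI) (simp_all add: \<psi>_def comp_simps(9,10) cancel)
    then have "(op_inv (\<psi> A) o\<^sub>L \<psi> B) = (T o\<^sub>L (op_inv (\<phi> A) o\<^sub>L (\<phi> B o\<^sub>L W)))"
      by (simp add: \<psi>_def comp_simps(9) cancel)
    also have "tr \<dots> = tr ((op_inv (\<phi> A) o\<^sub>L (\<phi> B o\<^sub>L W)) o\<^sub>L T)" by (intro tr_comm comp_mem mem)
    also have "((op_inv (\<phi> A) o\<^sub>L (\<phi> B o\<^sub>L W)) o\<^sub>L T) = (op_inv (\<phi> A) o\<^sub>L \<phi> B)"
      by (simp add: comp_simps(9,10) cancel)
    finally show "tr (op_inv (\<psi> A) o\<^sub>L \<psi> B) = tr (op_inv A o\<^sub>L B)" using form[OF A B] by simp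
  next
    fix A and t :: real assume A: "A \<in> GL_pos R" and t: "0 < t"
    show "\<psi> (t *\<^sub>R A) = t *\<^sub>R \<psi> A" using hom[OF A t] by (simp add: \<psi>_def comp_simps)
  qed
  then interpret unital_cone_map R \<tau> \<psi> .
  have "\<forall>A\<in>GL_pos R. \<phi> A = T o\<^sub>L psi_ext A o\<^sub>L T" by (simp add: psi_ext_GL phi_psi)
  then show ?thesis using psi_ext_jordan T(1) by blast
qed

end

theorem theorem4p2:
  fixes R :: "('h::complex_hilbert_space \<Rightarrow>\<^sub>L 'h) set"
    and \<tau> :: "('h \<Rightarrow>\<^sub>L 'h) \<Rightarrow> complex"
    and \<phi> :: "('h \<Rightarrow>\<^sub>L 'h) \<Rightarrow> ('h \<Rightarrow>\<^sub>L 'h)"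
  assumes separable: "separable_space (euclidean :: 'h topology)"
    and finite_vna: "finite_von_neumann_algebra R"
    and trace: "faithful_tracial_state R \<tau>"
    and bij: "bij_betw \<phi> (GL_pos R) (GL_pos R)"
  shows "(\<forall>A\<in>GL_pos R. \<forall>B\<in>GL_pos R.
            fk_det \<tau> (\<phi> A + \<phi> B) = fk_det \<tau> (\<phi> id_blinfun) * fk_det \<tau> (A + B))
         \<longleftrightarrow>
         (\<exists>J T. jordan_star_iso R J \<and> trace_preserving R \<tau> J \<and> T \<in> GL_pos R \<and>
            (\<forall>A\<in>GL_pos R. \<phi> A = T o\<^sub>L J A o\<^sub>L T))"
proof -
  interpret tracial_algebra R \<tau>
    using finite_vna trace
    by (intro von_neumann_tracial_algebra) (auto simp: finite_von_neumann_algebra_def)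
  have map: "\<phi> A \<in> GL_pos R" if "A \<in> GL_pos R" for A using bij that by (auto simp: bij_betw_def)
  have det: "fk_det \<tau> (\<phi> A + \<phi> B) = fk_det \<tau> (\<phi> id_blinfun) * fk_det \<tau> (A + B) \<longleftrightarrow>
      lndet (\<phi> A + \<phi> B) = lndet (\<phi> id_blinfun) + lndet (A + B)"
    if "A \<in> GL_pos R" "B \<in> GL_pos R" for A B
    using that map by (simp add: fk_det_eq GL_add exp_add[symmetric] flip: of_real_mult)
  show ?thesis
  proof
    assume "\<forall>A\<in>GL_pos R. \<forall>B\<in>GL_pos R.
      fk_det \<tau> (\<phi> A + \<phi> B) = fk_det \<tau> (\<phi> id_blinfun) * fk_det \<tau> (A + B)"
    then show "\<exists>J T. jordan_star_iso R J \<and> trace_preserving R \<tau> J \<and> T \<in> GL_pos R \<and>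
        (\<forall>A\<in>GL_pos R. \<phi> A = T o\<^sub>L J A o\<^sub>L T)"
      by (intro determinant_map_form[OF bij]) (simp add: det)
  next
    assume "\<exists>J T. jordan_star_iso R J \<and> trace_preserving R \<tau> J \<and> T \<in> GL_pos R \<and>
        (\<forall>A\<in>GL_pos R. \<phi> A = T o\<^sub>L J A o\<^sub>L T)"
    then show "\<forall>A\<in>GL_pos R. \<forall>B\<in>GL_pos R.
        fk_det \<tau> (\<phi> A + \<phi> B) = fk_det \<tau> (\<phi> id_blinfun) * fk_det \<tau> (A + B)"
      using sandwich_J_lndet det by blast
  qed
qed

end
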